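(* Let $n\ge1$, $k\ge1$, $\mu\in\mathrm{WComp}_{n-1}$ with $\mathrm{supp}(\mu)\subseteq[k]$. The set $\{\bar c(T,\sigma):(T,\sigma)\in\mathsf{Comb}_\mu\}$ is a basis of $\widetilde H^{n-3}((\hat0,[n]^\mu))$ and $\{[T,\sigma]:(T,\sigma)\in\mathsf{Comb}_\mu\}$ is a basis of $\mathcal{L}ie(\mu)$.
   Context: Fix a field $\mathbf{k}$. $\mathrm{WComp}_{m}$: weak compositions with sum $m$; $\mathbf{e}_r$ the $r$-th unit vector. $\mathcal{L}ie(\mu)$ is the subspace of the multilinear component of the free Lie algebra on $[n]$ with compatible Lie brackets $[\cdot,\cdot]_j$, $j\in\mathbb{P}$ (relations: antisymmetry and Jacobi for each bracket, and $[x,[y,z]_j]_i+[z,[x,y]_j]_i+[y,[z,x]_j]_i+[x,[y,z]_i]_j+[z,[x,y]_i]_j+[y,[z,x]_i]_j=0$ for $i\ne j$) spanned by bracketed permutations with exactly $\mu(j)$ brackets of type $j$. $\Pi_n^k$: poset of weighted partitions $\{B_1^{\mu_1},\dots,B_t^{\mu_t}\}$ ($\{B_i\}$ set partition of $[n]$, $\mu_i\in\mathrm{WComp}_{|B_i|-1}$ with support in $[k]$), covers merging two blocks $A^a,B^b$ into $(A\cup B)^{a+b+\mathbf{e}_r}$, $r\in[k]$; $\hat0$ singletons with zero weights; $[n]^\mu=\{[n]^\mu\}$; reduced simplicial cohomology over $\mathbf{k}$ of the order complex. A labeled colored binary tree $(T,\sigma)$: planar rooted binary tree with $n$ leaves,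 internal nodes colored in $\mathbb{P}$, $j$-th leaf from left labeled $\sigma(j)$. $[T,\sigma]=\sigma$ if $n=1$, else $[[T_1,\sigma_1],[T_2,\sigma_2]]_j$ with left/right labeled subtrees of the root and $j$ the root color. With internal nodes $v_1,\dots,v_{n-1}$ in postorder, $c(T,\sigma)$ is the maximal chain $\hat0=\alpha_0\lessdot\dots\lessdot\alpha_{n-1}=[n]^\mu$ where $\alpha_t$ arises from $\alpha_{t-1}$ by merging the blocks of leaf labels of the left and right subtrees of $v_t$, adding $\mathbf{e}_{\mathrm{color}(v_t)}$ to the sum of their weights; $\bar c(T,\sigma)=c(T,\sigma)\setminus\{\hat0,[n]^\mu\}$, viewed as a top face of the order complex of the open interval and as its cohomology class. Normalized: for every internal node $x$, the smallest leaf label below $x$ is below its left child. A colored comb is a normalized such tree where each internal node $x$ whose right child $R(x)$ is internal satisfies $\mathrm{color}(x)>\mathrm{color}(R(x))$; $\mathsf{Comb}_\mu$ is the set of colored combs on $[n]$ with exactly $\mu(j)$ internal nodes of color $j$. *)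

theory Defs
  imports
    "Jordan_Normal_Form.VS_Connect"
    "HOL-Algebra.AbelCoset"
    "HOL-Library.Disjoint_Sets"
begin

section \<open>Vector spaces of functions and quotient spaces\<close>

text \<open>
  Vector spaces are module records over \<open>class_ring\<close>, the ring record of a field given as
  a type, so that bases are bases in the sense of \<open>vectorspace.basis\<close>. The fields
  \<open>mult\<close> and \<open>one\<close> of a module record carry no meaning for vector spaces.
\<close>

definition fun_module :: "('x \<Rightarrow> 'a::field) set \<Rightarrow> ('a, 'x \<Rightarrow> 'a) module" where
  "fun_module C =
     \<lparr>carrier = C, mult = undefined, one = undefined, zero = (\<lambda>x. 0),
      add = (\<lambda>f g x. f x + g x), smult = (\<lambda>a f x. a * f x)\<rparr>"

text \<open>
  The summand \<open>W\<close> in the scalar multiplication matters only for the scalar \<open>0\<close>,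
  which otherwise would send a coset to \<open>{0}\<close> instead of \<open>W\<close>.
\<close>

definition quot_module :: "('a, 'b) module \<Rightarrow> 'b set \<Rightarrow> ('a, 'b set) module" where
  "quot_module M W =
     \<lparr>carrier = a_rcosets\<^bsub>M\<^esub> W, mult = undefined, one = undefined, zero = W,
      add = set_add M, smult = (\<lambda>a X. W <+>\<^bsub>M\<^esub> (\<lambda>v. a \<odot>\<^bsub>M\<^esub> v) ` X)\<rparr>"

lemma fun_module_coset:
  fixes C :: "('x \<Rightarrow> 'a::field) set"
  shows "W +>\<^bsub>fun_module C\<^esub> v = {\<lambda>x. w x + v x | w. w \<in> W}"
  by (auto simp: a_r_coset_def' fun_module_def)

lemma vectorspace_fun_module:
  fixes C :: "('x \<Rightarrow> 'a::field) set"
  assumes "(\<lambda>x. 0) \<in> C"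
    and add: "\<And>u v. u \<in> C \<Longrightarrow> v \<in> C \<Longrightarrow> (\<lambda>x. u x + v x) \<in> C"
    and smult: "\<And>a u. u \<in> C \<Longrightarrow> (\<lambda>x. a * u x) \<in> C"
  shows "vectorspace class_ring (fun_module C)"
proof -
  have neg: "\<exists>v\<in>C. (\<lambda>x. u x + v x) = (\<lambda>x. 0)" if "u \<in> C" for u
    by (rule bexI[OF _ smult[OF that, of "-1"]]) auto
  have "module class_ring (fun_module C)"
    by (rule module_criteria)
      (use assms neg in \<open>auto simp: fun_module_def algebra_simps class_cring.is_cring\<close>)
  then show ?thesis
    by (simp add: vectorspace_def class_field.field_axioms)
qed

lemma vectorspace_quot_module:
  fixes C W :: "('x \<Rightarrow> 'a::field) set"
  assumes C: "(\<lambda>x. 0) \<in> C"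
    "\<And>u v. u \<in> C \<Longrightarrow> v \<in> C \<Longrightarrow> (\<lambda>x. u x + v x) \<in> C"
    "\<And>a u. u \<in> C \<Longrightarrow> (\<lambda>x. a * u x) \<in> C"
  and W: "W \<subseteq> C" "(\<lambda>x. 0) \<in> W"
    "\<And>u v. u \<in> W \<Longrightarrow> v \<in> W \<Longrightarrow> (\<lambda>x. u x + v x) \<in> W"
    "\<And>a u. u \<in> W \<Longrightarrow> (\<lambda>x. a * u x) \<in> W"
  shows "vectorspace class_ring (quot_module (fun_module C) W)"
proof -
  define k where "k v = W +>\<^bsub>fun_module C\<^esub> v" for v
  have kdef: "k v = {\<lambda>x. w x + v x | w. w \<in> W}" for v
    by (simp add: k_def fun_module_coset)
  have mem: "f \<in> k v \<longleftrightarrow> (\<lambda>x. f x - v x) \<in> W" for f v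
  proof
    assume "f \<in> k v" then show "(\<lambda>x. f x - v x) \<in> W" by (auto simp: kdef)
  next
    assume "(\<lambda>x. f x - v x) \<in> W"
    then show "f \<in> k v" unfolding kdef by (intro CollectI exI[of _ "\<lambda>x. f x - v x"]) auto
  qed
  have car: "carrier (quot_module (fun_module C) W) = k ` C"
    by (auto simp: quot_module_def A_RCOSETS_def' k_def) (auto simp: fun_module_def)
  have zer: "\<zero>\<^bsub>quot_module (fun_module C) W\<^esub> = k (\<lambda>x. 0)"
    by (auto simp: quot_module_def kdef)
  have add: "k u \<oplus>\<^bsub>quot_module (fun_module C) W\<^esub> k v = k (\<lambda>x. u x + v x)" for u v
  proof -
    have "k u <+>\<^bsub>fun_module C\<^esub> k v = k (\<lambda>x. u x + v x)"
    proof (intro equalityI subsetI)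
      fix f assume "f \<in> k u <+>\<^bsub>fun_module C\<^esub> k v"
      then obtain w w' where "w \<in> W" "w' \<in> W" "f = (\<lambda>x. (w x + u x) + (w' x + v x))"
        by (auto simp: set_add_def set_mult_def fun_module_def kdef)
      then show "f \<in> k (\<lambda>x. u x + v x)"
        using W(3)[of w w'] by (auto simp: mem algebra_simps)
    next
      fix f assume "f \<in> k (\<lambda>x. u x + v x)"
      then obtain w where w: "w \<in> W" "f = (\<lambda>x. w x + (u x + v x))" by (auto simp: kdef)
      have "(\<lambda>x. w x + u x) \<in> k u" "v \<in> k v" using w W(2) by (auto simp: mem)
      moreover have "f = (\<lambda>x. (w x + u x) + v x)" using w by (auto simp: algebra_simps)
      ultimately show "f \<in> k u <+>\<^bsub>fun_module C\<^esub> k v"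
        by (auto simp: set_add_def set_mult_def fun_module_def)
    qed
    then show ?thesis by (simp add: quot_module_def)
  qed
  have smult: "a \<odot>\<^bsub>quot_module (fun_module C) W\<^esub> k u = k (\<lambda>x. a * u x)" for a u
  proof -
    have "W <+>\<^bsub>fun_module C\<^esub> (\<lambda>v. a \<odot>\<^bsub>fun_module C\<^esub> v) ` k u = k (\<lambda>x. a * u x)"
    proof (intro equalityI subsetI)
      fix f assume "f \<in> W <+>\<^bsub>fun_module C\<^esub> (\<lambda>v. a \<odot>\<^bsub>fun_module C\<^esub> v) ` k u"
      then obtain w w' where "w \<in> W" "w' \<in> W" "f = (\<lambda>x. w x + a * (w' x + u x))"
        by (auto simp: set_add_def set_mult_def fun_module_def kdef)
      then show "f \<in> k (\<lambda>x. a * u x)"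
        using W(3)[OF _ W(4), of w w' a] by (auto simp: mem algebra_simps)
    next
      fix f assume "f \<in> k (\<lambda>x. a * u x)"
      then obtain w where w: "w \<in> W" "f = (\<lambda>x. w x + a * u x)" by (auto simp: kdef)
      have "u \<in> k u" using W(2) by (auto simp: mem)
      with w show "f \<in> W <+>\<^bsub>fun_module C\<^esub> (\<lambda>v. a \<odot>\<^bsub>fun_module C\<^esub> v) ` k u"
        by (auto simp: set_add_def set_mult_def fun_module_def)
    qed
    then show ?thesis by (simp add: quot_module_def)
  qed
  have neg: "\<exists>v\<in>C. k (\<lambda>x. u x + v x) = k (\<lambda>x. 0)" if "u \<in> C" for u
    by (rule bexI[OF _ C(3)[OF that, of "-1"]]) auto
  have "module class_ring (quot_module (fun_module C) W)"
    apply (rule module_criteria)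
    using C neg by (auto simp: car zer add smult algebra_simps class_cring.is_cring)
  then show ?thesis
    by (simp add: vectorspace_def class_field.field_axioms)
qed


section \<open>Weak compositions and weighted partitions\<close>

text \<open>
  A weak composition is a function on \<^typ>\<open>nat\<close> that vanishes at \<open>0\<close>, since
  compositions (and colors) are indexed by the positive integers.
\<close>

definition supp :: "(nat \<Rightarrow> nat) \<Rightarrow> nat set" where
  "supp \<mu> = {j. \<mu> j \<noteq> 0}"

definition wcomp :: "nat \<Rightarrow> (nat \<Rightarrow> nat) set" where
  "wcomp m = {\<mu>. \<mu> 0 = 0 \<and> finite (supp \<mu>) \<and> (\<Sum>j\<in>supp \<mu>. \<mu> j) = m}"

type_synonym wpart = "(nat set \<times> (nat \<Rightarrow> nat)) set"

definition wpartitions :: "nat \<Rightarrow> nat \<Rightarrow> wpart set" where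
  "wpartitions n k =
     {\<pi>. partition_on {1..n} (fst ` \<pi>) \<and> inj_on fst \<pi> \<and>
         (\<forall>(B, \<mu>)\<in>\<pi>. \<mu> \<in> wcomp (card B - 1) \<and> supp \<mu> \<subseteq> {1..k})}"

definition merged_weight :: "(nat \<Rightarrow> nat) \<Rightarrow> (nat \<Rightarrow> nat) \<Rightarrow> nat \<Rightarrow> nat \<Rightarrow> nat" where
  "merged_weight a b r = (\<lambda>i. a i + b i + (if i = r then 1 else 0))"

definition wcovers :: "nat \<Rightarrow> nat \<Rightarrow> wpart \<Rightarrow> wpart \<Rightarrow> bool" where
  "wcovers n k \<pi> \<pi>' \<longleftrightarrow>
     \<pi> \<in> wpartitions n k \<and> \<pi>' \<in> wpartitions n k \<and>
     (\<exists>A a B b r. (A, a) \<in> \<pi> \<and> (B, b) \<in> \<pi> \<and> A \<noteq> B \<and> r \<in> {1..k} \<and>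
        \<pi>' = \<pi> - {(A, a), (B, b)} \<union> {(A \<union> B, merged_weight a b r)})"

definition wle :: "nat \<Rightarrow> nat \<Rightarrow> wpart \<Rightarrow> wpart \<Rightarrow> bool" where
  "wle n k = (wcovers n k)\<^sup>*\<^sup>*"

definition wbot :: "nat \<Rightarrow> wpart" where
  "wbot n = (\<lambda>i. ({i}, \<lambda>_. 0)) ` {1..n}"

definition wtop :: "nat \<Rightarrow> (nat \<Rightarrow> nat) \<Rightarrow> wpart" where
  "wtop n \<mu> = {({1..n}, \<mu>)}"


section \<open>Reduced simplicial cohomology of open intervals of a poset\<close>

text \<open>
  A poset is a carrier \<open>P\<close> with an order \<open>leq\<close>. Dimensions are integers; the empty
  face has dimension \<open>-1\<close>, which makes the cohomology reduced.
\<close>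

definition open_interval :: "'p set \<Rightarrow> ('p \<Rightarrow> 'p \<Rightarrow> bool) \<Rightarrow> 'p \<Rightarrow> 'p \<Rightarrow> 'p set" where
  "open_interval P leq x y = {z \<in> P. leq x z \<and> z \<noteq> x \<and> leq z y \<and> z \<noteq> y}"

text \<open>
  For \<open>x = y\<close> the usual convention for the degenerate interval \<open>(x, x)\<close> is used: its
  only face is the empty one, of dimension \<open>-2\<close>, so that its reduced cohomology is the ground
  field in degree \<open>-2\<close> and zero elsewhere. In all cases a maximal chain of length
  \<open>l\<close> from \<open>x\<close> to \<open>y\<close>, with \<open>x\<close> and \<open>y\<close> removed, is then a face of
  dimension \<open>l - 2\<close>.
\<close>

definition faces ::
    "'p set \<Rightarrow> ('p \<Rightarrow> 'p \<Rightarrow> bool) \<Rightarrow> 'p \<Rightarrow> 'p \<Rightarrow> int \<Rightarrow> 'p set set" where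
  "faces P leq x y d =
     (if x = y then (if d = -2 then {{}} else {})
      else {c. c \<subseteq> open_interval P leq x y \<and> finite c \<and>
               (\<forall>u\<in>c. \<forall>v\<in>c. leq u v \<or> leq v u) \<and> int (card c) = d + 1})"

definition cochains ::
    "'p set \<Rightarrow> ('p \<Rightarrow> 'p \<Rightarrow> bool) \<Rightarrow> 'p \<Rightarrow> 'p \<Rightarrow> int \<Rightarrow> ('p set \<Rightarrow> 'a::field) set" where
  "cochains P leq x y d = {f. \<forall>c. f c \<noteq> 0 \<longrightarrow> c \<in> faces P leq x y d}"

text \<open>
  Faces are oriented by the order: the sign belonging to the vertex \<open>z\<close> of a chain is given by the
  position of \<open>z\<close> in it.
\<close>

definition coboundary ::
    "'p set \<Rightarrow> ('p \<Rightarrow> 'p \<Rightarrow> bool) \<Rightarrow> 'p \<Rightarrow> 'p \<Rightarrow> int \<Rightarrow>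
     ('p set \<Rightarrow> 'a::field) \<Rightarrow> 'p set \<Rightarrow> 'a" where
  "coboundary P leq x y d f =
     (\<lambda>c. if c \<in> faces P leq x y (d + 1)
          then \<Sum>z\<in>c. (- 1) ^ card {w \<in> c. leq w z \<and> w \<noteq> z} * f (c - {z})
          else 0)"

definition cocycles ::
    "'p set \<Rightarrow> ('p \<Rightarrow> 'p \<Rightarrow> bool) \<Rightarrow> 'p \<Rightarrow> 'p \<Rightarrow> int \<Rightarrow> ('p set \<Rightarrow> 'a::field) set" where
  "cocycles P leq x y d = {f \<in> cochains P leq x y d. coboundary P leq x y d f = (\<lambda>c. 0)}"

definition coboundaries ::
    "'p set \<Rightarrow> ('p \<Rightarrow> 'p \<Rightarrow> bool) \<Rightarrow> 'p \<Rightarrow> 'p \<Rightarrow> int \<Rightarrow> ('p set \<Rightarrow> 'a::field) set" where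
  "coboundaries P leq x y d = coboundary P leq x y (d - 1) ` cochains P leq x y (d - 1)"

definition cohomology ::
    "'p set \<Rightarrow> ('p \<Rightarrow> 'p \<Rightarrow> bool) \<Rightarrow> 'p \<Rightarrow> 'p \<Rightarrow> int \<Rightarrow>
     ('a::field, ('p set \<Rightarrow> 'a) set) module" where
  "cohomology P leq x y d =
     quot_module (fun_module (cocycles P leq x y d)) (coboundaries P leq x y d)"

definition face_class ::
    "'p set \<Rightarrow> ('p \<Rightarrow> 'p \<Rightarrow> bool) \<Rightarrow> 'p \<Rightarrow> 'p \<Rightarrow> int \<Rightarrow> 'p set \<Rightarrow> ('p set \<Rightarrow> 'a::field) set" where
  "face_class P leq x y d c =
     coboundaries P leq x y d +>\<^bsub>fun_module (cocycles P leq x y d)\<^esub> (\<lambda>c'. if c' = c then 1 else 0)"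


section \<open>Labeled colored binary trees and colored combs\<close>

text \<open>
  A labeled colored binary tree \<open>(T, \<sigma>)\<close> is encoded as one tree with labeled leaves; the
  permutation \<open>\<sigma>\<close> is the word \<open>leaves t\<close>.
\<close>

datatype ctree = Leaf nat | Node (color: nat) ctree ctree

fun leaves :: "ctree \<Rightarrow> nat list" where
  "leaves (Leaf i) = [i]"
| "leaves (Node j l r) = leaves l @ leaves r"

fun colors :: "ctree \<Rightarrow> nat list" where
  "colors (Leaf i) = []"
| "colors (Node j l r) = colors l @ colors r @ [j]"

definition labeled_trees :: "nat \<Rightarrow> ctree set" where
  "labeled_trees n =
     {t. distinct (leaves t) \<and> set (leaves t) = {1..n} \<and> set (colors t) \<subseteq> {1..}}"

definition labeled_trees_of_type :: "nat \<Rightarrow> (nat \<Rightarrow> nat) \<Rightarrow> ctree set" where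
  "labeled_trees_of_type n \<mu> = {t \<in> labeled_trees n. \<forall>j. count_list (colors t) j = \<mu> j}"

fun normalized :: "ctree \<Rightarrow> bool" where
  "normalized (Leaf i) \<longleftrightarrow> True"
| "normalized (Node j l r) \<longleftrightarrow>
     Min (set (leaves (Node j l r))) \<in> set (leaves l) \<and> normalized l \<and> normalized r"

fun comb_colored :: "ctree \<Rightarrow> bool" where
  "comb_colored (Leaf i) \<longleftrightarrow> True"
| "comb_colored (Node j l r) \<longleftrightarrow>
     (case r of Leaf _ \<Rightarrow> True | Node i _ _ \<Rightarrow> j > i) \<and> comb_colored l \<and> comb_colored r"

definition Comb :: "nat \<Rightarrow> (nat \<Rightarrow> nat) \<Rightarrow> ctree set" where
  "Comb n \<mu> = {t \<in> labeled_trees_of_type n \<mu>. normalized t \<and> comb_colored t}"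


section \<open>The maximal chain of a labeled colored binary tree\<close>

text \<open>
  The internal nodes in postorder, each given by its color and the sets of leaf labels of its left
  and right subtrees.
\<close>

fun postorder :: "ctree \<Rightarrow> (nat \<times> nat set \<times> nat set) list" where
  "postorder (Leaf i) = []"
| "postorder (Node j l r) = postorder l @ postorder r @ [(j, set (leaves l), set (leaves r))]"

definition merge :: "(nat \<times> nat set \<times> nat set) \<Rightarrow> wpart \<Rightarrow> wpart" where
  "merge = (\<lambda>(j, A, B) \<pi>.
     {p \<in> \<pi>. fst p \<noteq> A \<and> fst p \<noteq> B} \<union>
     {(A \<union> B, merged_weight a b j) | a b. (A, a) \<in> \<pi> \<and> (B, b) \<in> \<pi>})"

definition tree_chain :: "nat \<Rightarrow> ctree \<Rightarrow> wpart set" where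
  "tree_chain n t =
     {fold merge (take m (postorder t)) (wbot n) | m. m \<le> length (postorder t)}"

definition open_tree_chain :: "nat \<Rightarrow> (nat \<Rightarrow> nat) \<Rightarrow> ctree \<Rightarrow> wpart set" where
  "open_tree_chain n \<mu> t = tree_chain n t - {wbot n, wtop n \<mu>}"


section \<open>The free Lie algebra with compatible brackets\<close>

text \<open>
  It is the quotient of the free nonassociative algebra on \<open>{1..n}\<close> with one bilinear
  product for every color by the ideal of relations. The free nonassociative algebra has as its
  basis all binary trees with leaf labels in \<open>{1..n}\<close> (repetitions allowed) and positive
  colors, and its elements are represented by their coordinate functions.
\<close>

definition free_nonassoc :: "nat \<Rightarrow> (ctree \<Rightarrow> 'a::field) set" where
  "free_nonassoc n =
     {f. finite {t. f t \<noteq> 0} \<and>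
         (\<forall>t. f t \<noteq> 0 \<longrightarrow> set (leaves t) \<subseteq> {1..n} \<and> set (colors t) \<subseteq> {1..})}"

fun bracket :: "nat \<Rightarrow> (ctree \<Rightarrow> 'a::field) \<Rightarrow> (ctree \<Rightarrow> 'a) \<Rightarrow> ctree \<Rightarrow> 'a" where
  "bracket j f g (Leaf i) = 0"
| "bracket j f g (Node i l r) = (if i = j then f l * g r else 0)"

inductive_set lie_ideal :: "nat \<Rightarrow> (ctree \<Rightarrow> 'a::field) set" for n :: nat where
  antisymmetry:
    "x \<in> free_nonassoc n \<Longrightarrow> y \<in> free_nonassoc n \<Longrightarrow> j \<ge> 1 \<Longrightarrow>
     (\<lambda>t. bracket j x y t + bracket j y x t) \<in> lie_ideal n"
| jacobi:
    "x \<in> free_nonassoc n \<Longrightarrow> y \<in> free_nonassoc n \<Longrightarrow> z \<in> free_nonassoc n \<Longrightarrow> j \<ge> 1 \<Longrightarrow>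
     (\<lambda>t. bracket j x (bracket j y z) t + bracket j z (bracket j x y) t
        + bracket j y (bracket j z x) t) \<in> lie_ideal n"
| compatibility:
    "x \<in> free_nonassoc n \<Longrightarrow> y \<in> free_nonassoc n \<Longrightarrow> z \<in> free_nonassoc n \<Longrightarrow>
     i \<ge> 1 \<Longrightarrow> j \<ge> 1 \<Longrightarrow> i \<noteq> j \<Longrightarrow>
     (\<lambda>t. bracket i x (bracket j y z) t + bracket i z (bracket j x y) t
        + bracket i y (bracket j z x) t
        + bracket j x (bracket i y z) t + bracket j z (bracket i x y) t
        + bracket j y (bracket i z x) t) \<in> lie_ideal n"
| zero: "(\<lambda>t. 0) \<in> lie_ideal n"
| add: "u \<in> lie_ideal n \<Longrightarrow> v \<in> lie_ideal n \<Longrightarrow> (\<lambda>t. u t + v t) \<in> lie_ideal n"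
| smult: "u \<in> lie_ideal n \<Longrightarrow> (\<lambda>t. a * u t) \<in> lie_ideal n"
| bracket_left:
    "x \<in> free_nonassoc n \<Longrightarrow> u \<in> lie_ideal n \<Longrightarrow> j \<ge> 1 \<Longrightarrow> bracket j x u \<in> lie_ideal n"
| bracket_right:
    "u \<in> lie_ideal n \<Longrightarrow> x \<in> free_nonassoc n \<Longrightarrow> j \<ge> 1 \<Longrightarrow> bracket j u x \<in> lie_ideal n"

definition free_lie :: "nat \<Rightarrow> ('a::field, (ctree \<Rightarrow> 'a) set) module" where
  "free_lie n = quot_module (fun_module (free_nonassoc n)) (lie_ideal n)"

lemma bracket_free:
  assumes "x \<in> free_nonassoc n" "y \<in> free_nonassoc n" "j \<ge> 1"
  shows "bracket j x y \<in> free_nonassoc n"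
proof -
  have ex: "\<exists>l r. t = Node j l r \<and> x l \<noteq> 0 \<and> y r \<noteq> 0" if "bracket j x y t \<noteq> 0" for t
    using that by (cases t) (auto split: if_splits)
  then have "{t. bracket j x y t \<noteq> 0} \<subseteq> (\<lambda>(l, r). Node j l r) ` ({t. x t \<noteq> 0} \<times> {t. y t \<noteq> 0})"
    by auto
  then have "finite {t. bracket j x y t \<noteq> 0}"
    by (rule finite_subset) (use assms in \<open>auto simp: free_nonassoc_def\<close>)
  moreover have "set (leaves t) \<subseteq> {1..n} \<and> set (colors t) \<subseteq> {1..}" if "bracket j x y t \<noteq> 0" for t
    using ex[OF that] assms by (force simp: free_nonassoc_def)
  ultimately show ?thesis by (simp add: free_nonassoc_def)
qed

lemma add_free:
  assumes "x \<in> free_nonassoc n" "y \<in> free_nonassoc n"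
  shows "(\<lambda>t. x t + y t) \<in> free_nonassoc n"
proof -
  have "{t. x t + y t \<noteq> 0} \<subseteq> {t. x t \<noteq> 0} \<union> {t. y t \<noteq> 0}" by auto
  then have "finite {t. x t + y t \<noteq> 0}"
    by (rule finite_subset) (use assms in \<open>auto simp: free_nonassoc_def\<close>)
  then show ?thesis using assms by (simp add: free_nonassoc_def) (metis add.right_neutral)
qed

lemma smult_free:
  assumes "x \<in> free_nonassoc n"
  shows "(\<lambda>t. a * x t) \<in> free_nonassoc n"
proof -
  have "{t. a * x t \<noteq> 0} \<subseteq> {t. x t \<noteq> 0}" by auto
  then have "finite {t. a * x t \<noteq> 0}"
    by (rule finite_subset) (use assms in \<open>auto simp: free_nonassoc_def\<close>)
  then show ?thesis using assms by (auto simp add: free_nonassoc_def)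
qed

lemma zero_free: "(\<lambda>t. 0) \<in> free_nonassoc n"
  by (auto simp: free_nonassoc_def)

lemma lie_ideal_free: "u \<in> lie_ideal n \<Longrightarrow> u \<in> free_nonassoc n"
  by (induction rule: lie_ideal.induct)
    (intro bracket_free add_free smult_free zero_free; assumption)+

lemma vectorspace_free_lie: "vectorspace class_ring (free_lie n)"
  unfolding free_lie_def
  by (rule vectorspace_quot_module)
    (auto intro: add_free smult_free zero_free lie_ideal_free lie_ideal.zero lie_ideal.add
      lie_ideal.smult)

fun bracketed :: "ctree \<Rightarrow> ctree \<Rightarrow> 'a::field" where
  "bracketed (Leaf i) = (\<lambda>t. if t = Leaf i then 1 else 0)"
| "bracketed (Node j l r) = bracket j (bracketed l) (bracketed r)"

definition lie_class :: "nat \<Rightarrow> ctree \<Rightarrow> (ctree \<Rightarrow> 'a::field) set" where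
  "lie_class n t = lie_ideal n +>\<^bsub>fun_module (free_nonassoc n)\<^esub> bracketed t"

definition Lie :: "nat \<Rightarrow> (nat \<Rightarrow> nat) \<Rightarrow> ('a::field, (ctree \<Rightarrow> 'a) set) module" where
  "Lie n \<mu> =
     (free_lie n)\<lparr>carrier :=
        LinearCombinations.module.span class_ring (free_lie n)
          (lie_class n ` labeled_trees_of_type n \<mu>)\<rparr>"

end

theory Submission
  imports Defs "HOL-Library.Function_Algebras" "HOL-Library.List_Lexorder"
begin

text \<open>
  Independence in the Lie algebra: expand brackets as commutators in the free algebra with
  compatible associative products, which has the comb-colored planar trees as a basis. A tree
  occurring in the expansion of a comb other than the comb itself has a lexicographically larger
  leaf word, because a normalized tree has the smallest leaf of each subtree on the left. So
  the expansions of combs are unitriangular.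

  Spanning: Jacobi and compatibility move a bracket out of the right subtree of a node unless the
  node has a larger color than its right child; this terminates by induction on the size of the
  right subtree and then on the color of the node.

  Cohomology: top cochains modulo coboundaries are generated by maximal chains, with one relation for
  each chain lacking one rank. Such a relation either exchanges two independent merges or
  involves three blocks, in which case it is a Jacobi or compatibility relation. With a suitable
  sign this matches the defining relations of the Lie algebra, so both the straightening and the
  expansion functionals carry over to chains.
\<close>

section \<open>Compatible associative products\<close>

text \<open>That combs behave as a basis of the algebra with compatible associative products comes
  down to confluence: \<open>cprod\<close> picks one normal form, and \<open>cprod_compat\<close>
  shows that the defining identities hold for it. Independence of the trees is built into the
  encoding, because a coefficient is read off by testing against the indicator of a tree. In
  cohomology the relation at a missing rank is an unsigned sum over all chains through the gap.
  Hence exchanging two independent merges negates a chain, although both orders come from the same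
  tree. The sign of the order in which block minima are removed corrects this, and it also yields
  the signs of Jacobi for three blocks. A second sign is attached to trees, since a merge forgets
  the left-right order that a bracket depends on up to sign. The two halves are transferred in
  opposite directions: trees are sent to signed cochains that obey the Lie relations modulo
  coboundaries, which gives spanning, while a chain is sent back to the tree of its merges, so that
  expansions become functionals on chains that vanish on coboundaries, which gives
  independence.\<close>

fun rcolor :: "ctree \<Rightarrow> nat" where
  "rcolor (Leaf i) = 0"
| "rcolor (Node j l r) = j"

text \<open>
  The product \<open>a \<circ>\<^sub>j b\<close> of two basis trees of the free algebra with compatible associative
  products. An element is represented by the functional that sums a function over its
  terms, which avoids formal linear combinations. The last case solves the compatibility relation
  for \<open>a \<circ>\<^sub>j (b \<circ>\<^sub>i c)\<close>,
      where \<open>b \<circ>\<^sub>i c\<close> is a single tree.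
\<close>

fun cprod :: "nat \<Rightarrow> ctree \<Rightarrow> ctree \<Rightarrow> (ctree \<Rightarrow> 'a::comm_ring_1) \<Rightarrow> 'a" where
  "cprod j a (Leaf m) f = f (Node j a (Leaf m))"
| "cprod j a (Node i b c) f =
     (if i < j then f (Node j a (Node i b c))
      else if i = j then cprod j a b (\<lambda>x. f (Node j x c))
      else cprod j a b (\<lambda>x. f (Node i x c)) + cprod i a b (\<lambda>x. cprod j x c f)
           - cprod j b c (\<lambda>y. f (Node i a y)))"

lemma cprod_add: "cprod j a b (\<lambda>x. f x + g x) = cprod j a b f + cprod j a b g"
  by (induction b arbitrary: j a f g) (simp_all add: algebra_simps)

lemma cprod_mult: "cprod j a b (\<lambda>x. c * f x) = c * cprod j a b f"
  by (induction b arbitrary: j a f) (simp_all add: distrib_left right_diff_distrib)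

lemma cprod_diff: "cprod j a b (\<lambda>x. f x - g x) = cprod j a b f - cprod j a b g"
  using cprod_add[of j a b f "\<lambda>x. (-1) * g x"] cprod_mult[of j a b "-1" g] by simp

lemma cprod_swap:
  "cprod j a b (\<lambda>x. cprod i c d (\<lambda>y. f x y)) =
      cprod i c d (\<lambda>y. cprod j a b (\<lambda>x. f x y))"
  by (induction b arbitrary: j a f) (simp_all add: cprod_add cprod_diff)

lemma comb_colored_Node:
  "comb_colored (Node j a b) \<longleftrightarrow>
     (is_Leaf b \<or> rcolor b < j) \<and> comb_colored a \<and> comb_colored b"
  by (cases b) auto

declare comb_colored.simps(2) [simp del]
declare comb_colored_Node [simp]

lemma cprod_normal: "is_Leaf b \<or> rcolor b < j \<Longrightarrow> cprod j a b f = f (Node j a b)"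
  by (cases b) auto

text \<open>Elements are functionals, so the shape of the terms of a product is recorded as a
  congruence rule. The bound on the root color is carried along because in the last case of
  \<open>cprod\<close> the subtracted trees \<open>Node i a y\<close> are combs only if
  \<open>rcolor y < i\<close>.\<close>

lemma cprod_cong:
  assumes "comb_colored a" "comb_colored b"
    and "\<And>x. comb_colored x \<Longrightarrow> \<not> is_Leaf x \<Longrightarrow>
        leaves x = leaves a @ leaves b \<Longrightarrow>
           rcolor x \<le> max j (rcolor b) \<Longrightarrow> f x = g x"
  shows "cprod j a b f = cprod j a b g"
  using assms
proof (induction b arbitrary: j a f g)
  case (Leaf m)
  then show ?case by simp
next
  case (Node i b c)
  have cc: "comb_colored b" "comb_colored c" "is_Leaf c \<or> rcolor c < i"
    using Node.prems(2) by simp_all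
  consider "i < j" | "i = j" | "i > j" by linarith
  then show ?case
  proof cases
    case 1
    then show ?thesis using Node.prems by (auto)
  next
    case 2
    then show ?thesis
      using cc Node.prems by (auto intro!: Node.IH)
  next
    case 3
    have "cprod j a b (\<lambda>x. f (Node i x c)) = cprod j a b (\<lambda>x. g (Node i x c))"
      using cc Node.prems(1) 3
      by (auto intro!: Node.IH Node.prems(3))
    moreover have "cprod i a b (\<lambda>x. cprod j x c f) = cprod i a b (\<lambda>x. cprod j x c g)"
    proof (rule Node.IH(1))
      fix x assume x: "comb_colored x" "leaves x = leaves a @ leaves b"
      show "cprod j x c f = cprod j x c g"
        using cc x 3 by (cases c; intro Node.IH(2) Node.prems(3)) auto
    qed (use Node.prems(1) cc in auto)
    moreover have "cprod j b c (\<lambda>y. f (Node i a y)) = cprod j b c (\<lambda>y. g (Node i a y))"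
    proof (rule Node.IH(2))
      fix y assume y: "comb_colored y" "leaves y = leaves b @ leaves c" "rcolor y \<le> max j (rcolor c)"
      have "rcolor y < i" using y(3) cc(3) 3 by (cases c) auto
      then show "f (Node i a y) = g (Node i a y)"
        using y 3 Node.prems(1) by (intro Node.prems(3)) (auto)
    qed (use Node.prems(1) cc in auto)
    ultimately show ?thesis using 3 by simp
  qed
qed

text \<open>All terms of the product of \<open>b\<close> and \<open>c\<close> in color
  \<open>j\<close> have root color below \<open>i\<close>, so multiplying them by \<open>a\<close>
  in color \<open>i\<close> merely joins them under a new root. Hence the subtracted term in
  \<open>cprod\<close> is a genuine product, and the recursion is the compatibility relation solved
  for one of its terms.\<close>

lemma cprod_left_of_smaller:
  assumes "comb_colored a" "comb_colored b" "is_Leaf c \<or> rcolor c < i" "comb_colored c" "j < i"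
  shows "cprod j b c (\<lambda>y. cprod i a y f) = cprod j b c (\<lambda>y. f (Node i a y))"
proof (rule cprod_cong)
  fix y assume "rcolor y \<le> max j (rcolor c)"
  then have "rcolor y < i" using assms by (cases c) auto
  then show "cprod i a y f = f (Node i a y)" by (simp add: cprod_normal)
qed (use assms in auto)

lemma cprod_Node_greater:
  "j < i \<Longrightarrow> cprod j a (Node i b c) f =
     cprod j a b (\<lambda>x. f (Node i x c)) + cprod i a b (\<lambda>x. cprod j x c f)
       - cprod j b c (\<lambda>y. f (Node i a y))"
  by simp

text \<open>This is the confluence of the rewriting behind \<open>cprod\<close>. Associativity and
  compatibility are proved together, since a larger root color on the right mixes them. The
  induction runs over the third factor \<open>Node l d e\<close>: products are expanded until only
  \<open>d\<close> and \<open>e\<close> stand on the right, where the induction hypotheses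
  apply.\<close>

lemma cprod_compat:
  fixes f :: "ctree \<Rightarrow> 'a::comm_ring_1"
  assumes "comb_colored a" "comb_colored b" "comb_colored c"
  shows "(j = i \<longrightarrow> cprod j b c (\<lambda>y. cprod j a y f) =
      cprod j a b (\<lambda>x. cprod j x c f)) \<and>
    (j < i \<longrightarrow> cprod j b c (\<lambda>y. cprod i a y f) +
        cprod i b c (\<lambda>y. cprod j a y f) =
       cprod i a b (\<lambda>x. cprod j x c f) + cprod j a b (\<lambda>x. cprod i x c f))"
  using assms
proof (induction c arbitrary: a b i j f)
  case (Leaf m)
  then show ?case by (auto simp: algebra_simps)
next
  case (Node l d e)
  note IHd = Node.IH(1) note IHe = Node.IH(2)
  have cc: "comb_colored d" "comb_colored e" and el: "is_Leaf e \<or> rcolor e < l"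
    using Node.prems by simp_all
  have ab: "comb_colored a" "comb_colored b" using Node.prems by auto
  have assd: "cprod j b d (\<lambda>y. cprod j a y f) = cprod j a b (\<lambda>x. cprod j x d f)"
    if "comb_colored a" "comb_colored b" for a b j and f :: "ctree \<Rightarrow> 'a"
    using IHd[of a b j j f] that cc by simp
  have asse: "cprod j b e (\<lambda>y. cprod j a y f) = cprod j a b (\<lambda>x. cprod j x e f)"
    if "comb_colored a" "comb_colored b" for a b j and f :: "ctree \<Rightarrow> 'a"
    using IHe[of a b j j f] that cc by simp
  have comd: "cprod j b d (\<lambda>y. cprod i a y f) + cprod i b d (\<lambda>y. cprod j a y f) =
       cprod i a b (\<lambda>x. cprod j x d f) + cprod j a b (\<lambda>x. cprod i x d f)"
    if "comb_colored a" "comb_colored b" "j < i" for a b i j and f :: "ctree \<Rightarrow> 'a"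
    using IHd[of a b j i f] that cc by simp
  have come: "cprod j b e (\<lambda>y. cprod i a y f) + cprod i b e (\<lambda>y. cprod j a y f) =
       cprod i a b (\<lambda>x. cprod j x e f) + cprod j a b (\<lambda>x. cprod i x e f)"
    if "comb_colored a" "comb_colored b" "j < i" for a b i j and f :: "ctree \<Rightarrow> 'a"
    using IHe[of a b j i f] that cc by simp
  have nle: "cprod l x e f = f (Node l x e)" for x and f :: "ctree \<Rightarrow> 'a"
    by (rule cprod_normal[OF el])
  have small: "cprod j x e (\<lambda>y. cprod l a y f) = cprod j x e (\<lambda>y. f (Node l a y))"
    if "comb_colored a" "comb_colored x" "j < l" for a x j and f :: "ctree \<Rightarrow> 'a"
    using cprod_left_of_smaller[of a x e l j f] that el cc by simp

  \<comment> \<open>For a root color \<open>l\<close> below \<open>i\<close> the product of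
    \<open>b\<close> and \<open>c\<close> in color \<open>i\<close> is the single tree
    \<open>Node i b c\<close>, and compatibility is the defining equation of \<open>cprod\<close> at
    that tree.\<close>
  have low: "cprod j a (Node i b c) f + cprod j b c (\<lambda>y. cprod i a y f) =
      cprod j a b (\<lambda>x. f (Node i x c)) + cprod i a b (\<lambda>x. cprod j x c f)"
    if "l < i" "j < i" "c = Node l d e" for i j c
    using cprod_left_of_smaller[of a b c i j f] ab that Node.prems by simp
  define N where "N = (\<lambda>x y. f (Node l x y))"
  define G where "G j = (\<lambda>x. cprod j x e f)" for j
  have node: "cprod j x (Node l y z) f =
      cprod j x y (\<lambda>u. N u z) + cprod l x y (\<lambda>u. cprod j u z f) -
          cprod j y z (\<lambda>v. N x v)"
    if "j < l" for j x y z
    using that by (simp add: N_def)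
  have node0: "cprod l x (Node l y z) f = cprod l x y (\<lambda>u. N u z)" for x y z
    by (simp add: N_def)
  have lin: "cprod j u v (\<lambda>x. g x + h x - k x) = cprod j u v g + cprod j u v h - cprod j u v k"
    for j u v and g h k :: "ctree \<Rightarrow> 'a"
    by (simp add: cprod_add cprod_diff)
  have swp: "cprod j d e (\<lambda>y. cprod i a b (\<lambda>x. F x y)) =
      cprod i a b (\<lambda>x. cprod j d e (F x))"
    for i j and F :: "ctree \<Rightarrow> ctree \<Rightarrow> 'a"
    by (rule cprod_swap)
  have same: "cprod j b (Node l d e) (\<lambda>y. cprod j a y f) =
      cprod j a b (\<lambda>x. cprod j x (Node l d e) f)"
    for j
  proof -
    consider "l < j" | "l = j" | "j < l" by linarith
    then show ?thesis
    proof cases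
      case 1
      then show ?thesis by simp
    next
      case 2
      then show ?thesis using assd[OF ab] by (simp add: cprod_normal)
    next
      \<comment> \<open>Inner products are re-associated by \<open>assd\<close> and
        \<open>asse\<close>; what remains is compatibility for \<open>d\<close>, tested on the
        product with \<open>e\<close>.\<close>
      case 3
      have 1: "cprod j b (Node l d e) (\<lambda>y. cprod j a y f) =
          (cprod j b d (\<lambda>x. cprod j a x (\<lambda>u. N u e)) +
              cprod j b d (\<lambda>x. cprod l a x (G j))
            - cprod j b d (\<lambda>x. cprod j x e (N a)))
          + cprod l b d (\<lambda>x. cprod j x e (\<lambda>y. cprod j a y f))
          - (cprod j d e (\<lambda>y. cprod j a b (\<lambda>x. N x y)) +
              cprod j d e (\<lambda>y. cprod l a b (\<lambda>x. cprod j x y f))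
            - cprod j d e (\<lambda>y. cprod j b y (N a)))"
        unfolding cprod_Node_greater[OF 3, of b] node[OF 3] lin G_def ..
      have 2: "cprod l b d (\<lambda>x. cprod j x e (\<lambda>y. cprod j a y f)) =
          cprod l b d (\<lambda>x. cprod j a x (G j))"
        unfolding G_def by (rule cprod_cong) (use ab cc asse in auto)
      have 3: "cprod l a b (\<lambda>x. cprod j d e (\<lambda>y. cprod j x y f)) =
          cprod l a b (\<lambda>x. cprod j x d (G j))"
        unfolding G_def by (rule cprod_cong) (use ab cc asse in auto)
      have 4: "cprod j a b (\<lambda>x. cprod j x (Node l d e) f) =
          cprod j a b (\<lambda>x. cprod j x d (\<lambda>u. N u e)) +
              cprod j a b (\<lambda>x. cprod l x d (G j))
          - cprod j a b (\<lambda>x. cprod j d e (N x))"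
        unfolding node[OF \<open>j < l\<close>] lin G_def ..
      show ?thesis
        unfolding 1 2 4 swp 3 assd[OF ab] asse[OF ab(2) cc(1)]
        using comd[OF ab \<open>j < l\<close>, of "G j"] by (simp add: algebra_simps)
    qed
  qed
  have diff: "cprod j b (Node l d e) (\<lambda>y. cprod i a y f) +
      cprod i b (Node l d e) (\<lambda>y. cprod j a y f) =
       cprod i a b (\<lambda>x. cprod j x (Node l d e) f) +
           cprod j a b (\<lambda>x. cprod i x (Node l d e) f)"
    if ji: "j < i"
  proof -
    consider "l < i" | "l = i" | "i < l" by linarith
    then show ?thesis
    proof cases
      case 1
      then show ?thesis using low[OF 1 ji refl] ji by (simp add: algebra_simps)
    next
      case 2
      then have jl: "j < l" using ji by simp
      have 1: "cprod j b (Node l d e) (\<lambda>y. cprod l a y f) =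
          cprod j b d (\<lambda>x. cprod l a x (\<lambda>u. N u e))
          + cprod l b d (\<lambda>x. cprod j x e (\<lambda>y. cprod l a y f))
          - cprod j d e (\<lambda>y. cprod l a b (\<lambda>x. N x y))"
        unfolding cprod_Node_greater[OF jl, of b] node0 ..
      have 2: "cprod l b d (\<lambda>x. cprod j x e (\<lambda>y. cprod l a y f)) =
          cprod l b d (\<lambda>x. cprod j x e (N a))"
        unfolding N_def by (rule cprod_cong) (use ab cc small jl in auto)
      have 3: "cprod l b (Node l d e) (\<lambda>y. cprod j a y f) =
          cprod l b d (\<lambda>x. cprod j a x (\<lambda>u. N u e)) +
              cprod l b d (\<lambda>x. cprod l a x (G j))
          - cprod l b d (\<lambda>x. cprod j x e (N a))"
      proof -
        have "cprod l b (Node l d e) (\<lambda>y. cprod j a y f) =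
            cprod l b d (\<lambda>x. cprod j a (Node l x e) f)"
          by simp
        then show ?thesis unfolding node[OF jl] lin G_def .
      qed
      have 4: "cprod l a b (\<lambda>x. cprod j x (Node l d e) f) =
          cprod l a b (\<lambda>x. cprod j x d (\<lambda>u. N u e)) +
              cprod l a b (\<lambda>x. cprod l x d (G j))
          - cprod l a b (\<lambda>x. cprod j d e (N x))"
        unfolding node[OF jl] lin G_def ..
      show ?thesis
        unfolding \<open>l = i\<close>[symmetric] 1 2 3 4 node0 swp assd[OF ab]
        using comd[OF ab jl, of "\<lambda>u. N u e"] by (simp add: algebra_simps)
    next
      \<comment> \<open>All three colors are distinct and \<open>l\<close> is the largest, so both
        products expand. Identities 2 and 5 are compatibility for \<open>e\<close> below a product
        of color \<open>l\<close>; three instances for \<open>d\<close> and one more for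
        \<open>e\<close> finish. Folding with \<open>eq_diff_eq\<close> turns each identity into a
        rule that eliminates its first term.\<close>
      case 3
      then have jl: "j < l" using ji by simp
      have 1: "cprod j b (Node l d e) (\<lambda>y. cprod i a y f) =
          (cprod j b d (\<lambda>x. cprod i a x (\<lambda>u. N u e)) +
              cprod j b d (\<lambda>x. cprod l a x (G i))
            - cprod j b d (\<lambda>x. cprod i x e (N a)))
          + cprod l b d (\<lambda>x. cprod j x e (\<lambda>y. cprod i a y f))
          - (cprod j d e (\<lambda>y. cprod i a b (\<lambda>x. N x y)) +
              cprod j d e (\<lambda>y. cprod l a b (\<lambda>x. cprod i x y f))
            - cprod j d e (\<lambda>y. cprod i b y (N a)))"
        if "j < l" "i < l" for i j
        unfolding cprod_Node_greater[OF that(1), of b] node[OF that(2)] lin G_def ..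
      have 2: "cprod l b d (\<lambda>x. cprod j x e (\<lambda>y. cprod i a y f)) +
          cprod l b d (\<lambda>x. cprod i x e (\<lambda>y. cprod j a y f))
          = cprod l b d (\<lambda>x. cprod i a x (G j)) + cprod l b d (\<lambda>x. cprod j a x (G i))"
        unfolding cprod_add[symmetric] G_def by (rule cprod_cong) (use ab cc come ji in auto)
      have 5: "cprod l a b (\<lambda>x. cprod j d e (\<lambda>y. cprod i x y f)) +
          cprod l a b (\<lambda>x. cprod i d e (\<lambda>y. cprod j x y f))
          = cprod l a b (\<lambda>x. cprod i x d (G j)) + cprod l a b (\<lambda>x. cprod j x d (G i))"
        unfolding cprod_add[symmetric] G_def by (rule cprod_cong) (use ab cc come ji in auto)
      have 4: "cprod i a b (\<lambda>x. cprod j x (Node l d e) f) =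
          cprod i a b (\<lambda>x. cprod j x d (\<lambda>u. N u e)) +
              cprod i a b (\<lambda>x. cprod l x d (G j))
          - cprod i a b (\<lambda>x. cprod j d e (N x))" if "j < l" for i j
        unfolding node[OF that] lin G_def ..
      show ?thesis
        unfolding 1[OF jl 3] 1[OF 3 jl] 4[OF jl] 4[OF 3] swp
          2[folded eq_diff_eq] 5[folded eq_diff_eq] come[OF ab(2) cc(1) ji, of "N a", folded eq_diff_eq]
          comd[OF ab ji, of "\<lambda>u. N u e", folded eq_diff_eq]
          comd[OF ab jl, of "G i", folded eq_diff_eq] comd[OF ab 3, of "G j", folded eq_diff_eq]
        by (simp add: algebra_simps)
    qed
  qed
  show ?case using same diff by blast
qed

section \<open>Commutator expansions and the Lie relations\<close>

fun lie_expand :: "ctree \<Rightarrow> (ctree \<Rightarrow> 'a::comm_ring_1) \<Rightarrow> 'a" where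
  "lie_expand (Leaf m) f = f (Leaf m)"
| "lie_expand (Node j l r) f =
     lie_expand l (\<lambda>a. lie_expand r (\<lambda>b. cprod j a b f - cprod j b a f))"

lemma lie_expand_add: "lie_expand t (\<lambda>x. f x + g x) = lie_expand t f + lie_expand t g"
proof (induction t arbitrary: f g)
  case (Node j l r)
  have "cprod j a b (\<lambda>x. f x + g x) - cprod j b a (\<lambda>x. f x + g x) =
     (cprod j a b f - cprod j b a f) + (cprod j a b g - cprod j b a g)" for a b
    by (simp add: cprod_add)
  then show ?case by (simp only: lie_expand.simps Node.IH)
qed simp

lemma lie_expand_mult: "lie_expand t (\<lambda>x. c * f x) = c * lie_expand t f"
proof (induction t arbitrary: f)
  case (Node j l r)
  have "cprod j a b (\<lambda>x. c * f x) - cprod j b a (\<lambda>x. c * f x) =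
      c * (cprod j a b f - cprod j b a f)" for a b
    by (simp add: cprod_mult right_diff_distrib)
  then show ?case by (simp only: lie_expand.simps Node.IH)
qed simp

lemma lie_expand_diff: "lie_expand t (\<lambda>x. f x - g x) = lie_expand t f - lie_expand t g"
  using lie_expand_add[of t f "\<lambda>x. (-1) * g x"] lie_expand_mult[of t "-1" g] by simp

lemma lie_expand_zero: "lie_expand t (\<lambda>x. 0) = 0"
  using lie_expand_mult[of t 0 "\<lambda>x. 0"] by simp

lemma lie_expand_sum:
  "lie_expand t (\<lambda>x. \<Sum>i\<in>I. f i x) = (\<Sum>i\<in>I. lie_expand t (f i))"
  by (induction I rule: infinite_finite_induct) (simp_all add: lie_expand_zero lie_expand_add)

lemma lie_expand_cprod:
  "lie_expand t (\<lambda>x. cprod j a b (\<lambda>y. f x y)) =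
      cprod j a b (\<lambda>y. lie_expand t (\<lambda>x. f x y))"
proof (induction b arbitrary: j a f)
  case (Node i b c)
  show ?case by (simp add: Node.IH lie_expand_add lie_expand_diff)
qed simp

lemma lie_expand_swap:
  "lie_expand s (\<lambda>x. lie_expand t (\<lambda>y. f x y)) =
      lie_expand t (\<lambda>y. lie_expand s (\<lambda>x. f x y))"
  by (induction t arbitrary: f) (simp_all add: lie_expand_diff lie_expand_cprod)

text \<open>Whatever the tree, its expansion is supported on combs, which is why
  \<open>cprod_compat\<close>, proved for combs only, can be used under \<open>lie_expand\<close>.
  The length is recorded for the comparison of leaf words in \<open>lie_expand_comb\<close>.\<close>

lemma lie_expand_cong:
  assumes "\<And>x. comb_colored x \<Longrightarrow> set (leaves x) = set (leaves t) \<Longrightarrow>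
     length (leaves x) = length (leaves t) \<Longrightarrow> f x = g x"
  shows "lie_expand t f = lie_expand t g"
  using assms
proof (induction t arbitrary: f g)
  case (Node j l r)
  show ?case unfolding lie_expand.simps
    by (intro Node.IH arg_cong2[where f = "(-)"] cprod_cong Node.prems) auto
qed auto

text \<open>A relation is a list of trees whose sum vanishes in the free Lie algebra.\<close>

inductive_set lie_rels :: "ctree list set" where
  anti: "[Node j x y, Node j y x] \<in> lie_rels"
| jac: "[Node j x (Node j y z), Node j z (Node j x y), Node j y (Node j z x)] \<in> lie_rels"
| comp: "i \<noteq> j \<Longrightarrow>
    [Node i x (Node j y z), Node i z (Node j x y), Node i y (Node j z x),
     Node j x (Node i y z), Node j z (Node i x y), Node j y (Node i z x)] \<in> lie_rels"

text \<open>A context grows at its hole, so an induction peels off the node next to the hole, and a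
  relation between subtrees is transported one bracket at a time towards the root.\<close>

inductive ctx :: "(ctree \<Rightarrow> ctree) \<Rightarrow> bool" where
  hole: "ctx (\<lambda>t. t)"
| left: "ctx K \<Longrightarrow> ctx (\<lambda>t. K (Node j t r))"
| right: "ctx K \<Longrightarrow> ctx (\<lambda>t. K (Node j l t))"

lemma cprod_sym_compat:
  assumes "comb_colored a" "comb_colored b" "comb_colored c" "i \<noteq> j"
  shows "cprod i b c (\<lambda>u. cprod j a u f) + cprod j b c (\<lambda>u. cprod i a u f) =
     cprod i a b (\<lambda>u. cprod j u c f) + cprod j a b (\<lambda>u. cprod i u c f)"
  using cprod_compat[OF assms(1-3), where f = f and i = i and j = j]
    cprod_compat[OF assms(1-3), where f = f and i = j and j = i] assms(4)
  by (metis add.commute linorder_neqE_nat)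

text \<open>The double commutator of \<open>a\<close> with \<open>b\<close> and \<open>c\<close>;
  the inner color comes first.\<close>

definition iterated ::
    "nat \<Rightarrow> nat \<Rightarrow> ctree \<Rightarrow> ctree \<Rightarrow> ctree \<Rightarrow> (ctree \<Rightarrow> 'a::comm_ring_1) \<Rightarrow> 'a" where
  "iterated j i a b c f =
     (cprod j b c (\<lambda>u. cprod i a u f) - cprod j b c (\<lambda>u. cprod i u a f))
     - (cprod j c b (\<lambda>u. cprod i a u f) - cprod j c b (\<lambda>u. cprod i u a f))"

lemma lie_expand_Node_Node:
  "lie_expand (Node i x (Node j y z)) f =
     lie_expand x (\<lambda>a. lie_expand y (\<lambda>b. lie_expand z (\<lambda>c. iterated j i a b c f)))"
  by (simp add: iterated_def cprod_diff)

lemma lie_expand_rotate: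
  "lie_expand z (\<lambda>c. lie_expand x (\<lambda>a. lie_expand y (\<lambda>b. g a b c))) =
   lie_expand x (\<lambda>a. lie_expand y (\<lambda>b. lie_expand z (\<lambda>c. g a b c)))"
  by (subst lie_expand_swap, subst lie_expand_swap) (rule refl)

lemma lie_expand_cong_comb:
  "(\<And>x. comb_colored x \<Longrightarrow> f x = g x) \<Longrightarrow> lie_expand t f = lie_expand t g"
  by (rule lie_expand_cong)

text \<open>Commutators of compatible associative products are compatible Lie brackets: once all
  expansions run over \<open>x\<close>, \<open>y\<close>, \<open>z\<close> in the same order, the
  terms of the double commutators cancel by associativity or compatibility of
  \<open>cprod\<close>.\<close>

lemma lie_expand_rels:
  assumes "R \<in> lie_rels"
  shows "(\<Sum>t\<leftarrow>R. lie_expand t f) = 0"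
  using assms
proof cases
  case (anti j x y)
  have "lie_expand (Node j x y) f + lie_expand (Node j y x) f =
     lie_expand x (\<lambda>a. lie_expand y (\<lambda>b. cprod j a b f - cprod j b a f))
     + lie_expand x (\<lambda>a. lie_expand y (\<lambda>b. cprod j b a f - cprod j a b f))"
    by (simp add: lie_expand_swap[of y x])
  also have "\<dots> = 0"
    by (simp add: lie_expand_add[symmetric] lie_expand_zero)
  finally show ?thesis using anti by simp
next
  case (jac j x y z)
  have *: "iterated j j a b c f + iterated j j c a b f + iterated j j b c a f = 0"
    if "comb_colored a" "comb_colored b" "comb_colored c" for a b c
    using cprod_compat[where f = f and i = j and j = j] that by (simp add: iterated_def)
  have "(\<Sum>t\<leftarrow>R. lie_expand t f) =
     lie_expand x (\<lambda>a. lie_expand y (\<lambda>b. lie_expand z (\<lambda>c.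
       iterated j j a b c f + iterated j j c a b f + iterated j j b c a f)))"
    unfolding jac lie_expand_add
    by (simp add: lie_expand_Node_Node lie_expand_rotate[of z x y] lie_expand_rotate[of y z x]
      del: lie_expand.simps)
  also have "\<dots> = lie_expand x (\<lambda>a. lie_expand y (\<lambda>b. lie_expand z (\<lambda>c. 0)))"
    by (intro lie_expand_cong_comb) (simp add: *)
  finally show ?thesis by (simp add: lie_expand_zero)
next
  case (comp i j x y z)
  have *: "iterated j i a b c f + iterated j i c a b f + iterated j i b c a f
      + (iterated i j a b c f + iterated i j c a b f + iterated i j b c a f) = 0"
    if "comb_colored a" "comb_colored b" "comb_colored c" for a b c
  proof -
    \<comment> \<open>\<open>L\<close> and \<open>M\<close> are the two sides of the compatibility
      relation. Adding the two double commutators with exchanged colors leaves only signed values of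
      \<open>L\<close> and \<open>M\<close>, and these cancel in the cyclic sum.\<close>
    define L where "L a b c = cprod i b c (\<lambda>u. cprod j a u f) +
        cprod j b c (\<lambda>u. cprod i a u f)" for a b c
    define M where "M a b c = cprod i a b (\<lambda>u. cprod j u c f) +
        cprod j a b (\<lambda>u. cprod i u c f)" for a b c
    have LM: "L p q r = M p q r" if "comb_colored p" "comb_colored q" "comb_colored r" for p q r
      unfolding L_def M_def by (rule cprod_sym_compat[OF that comp(2)])
    have "iterated j i p q r f + iterated i j p q r f = L p q r - M q r p - L p r q + M r q p" for p q r
      by (simp add: iterated_def L_def M_def)
    note e = this[of a b c] this[of c a b] this[of b c a]
    have "iterated j i a b c f + iterated j i c a b f + iterated j i b c a f
      + (iterated i j a b c f + iterated i j c a b f + iterated i j b c a f) =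
      (iterated j i a b c f + iterated i j a b c f) + (iterated j i c a b f + iterated i j c a b f)
      + (iterated j i b c a f + iterated i j b c a f)"
      by (simp add: ac_simps)
    also have "\<dots> = 0"
      unfolding e by (simp add: LM that)
    finally show ?thesis .
  qed
  have "(\<Sum>t\<leftarrow>R. lie_expand t f) =
     lie_expand x (\<lambda>a. lie_expand y (\<lambda>b. lie_expand z (\<lambda>c.
       iterated j i a b c f + iterated j i c a b f + iterated j i b c a f
      + (iterated i j a b c f + iterated i j c a b f + iterated i j b c a f))))"
    unfolding comp lie_expand_add
    by (simp add: lie_expand_Node_Node lie_expand_rotate[of z x y] lie_expand_rotate[of y z x]
      del: lie_expand.simps)
  also have "\<dots> = lie_expand x (\<lambda>a. lie_expand y (\<lambda>b. lie_expand z (\<lambda>c. 0)))"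
    by (intro lie_expand_cong_comb) (simp add: *)
  finally show ?thesis by (simp add: lie_expand_zero)
qed

lemma lie_expand_sum_list:
  "lie_expand t (\<lambda>x. \<Sum>s\<leftarrow>R. f s x) = (\<Sum>s\<leftarrow>R. lie_expand t (f s))"
  by (induction R) (simp_all add: lie_expand_zero lie_expand_add)

text \<open>The assumption ranges over all test functions because wrapping a bracket around the
  trees changes the test function. The scalars \<open>c\<close> admit relations with signs.\<close>

lemma lie_expand_ctx:
  assumes "ctx K" "\<And>f. (\<Sum>t\<leftarrow>R. c t * lie_expand (G t) f) = 0"
  shows "(\<Sum>t\<leftarrow>R. c t * lie_expand (K (G t)) f) = 0"
  using assms
proof (induction arbitrary: G f)
  case (left K j r)
  show ?case by (rule left.IH) (simp add: left.prems)
next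
  case (right K j l)
  have "(\<Sum>t\<leftarrow>R. c t * lie_expand (Node j l (G t)) f) =
    lie_expand l (\<lambda>a. \<Sum>t\<leftarrow>R. c t * lie_expand (G t)
        (\<lambda>b. cprod j a b f - cprod j b a f))" for f
    by (simp add: lie_expand_sum_list lie_expand_mult)
  then have "(\<Sum>t\<leftarrow>R. c t * lie_expand (Node j l (G t)) f) = 0" for f
    by (simp add: right.prems lie_expand_zero)
  then show ?case by (rule right.IH)
qed simp

section \<open>Unitriangularity of the expansions of combs\<close>

lemma leaves_nonempty [simp]: "leaves t \<noteq> []"
  by (induction t) auto

lemma hd_leaves_comb: "normalized t \<Longrightarrow> hd (leaves t) = Min (set (leaves t))"
proof (induction t)
  case (Node j l r)
  let ?A = "set (leaves l)" and ?B = "set (leaves r)"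
  have m: "Min (?A \<union> ?B) \<in> ?A" using Node.prems by simp
  have "Min ?A = Min (?A \<union> ?B)"
    by (rule Min_eqI) (use m in auto)
  then show ?case using Node by simp
qed simp

lemma lie_expand_comb:
  assumes "normalized t" "comb_colored t" "distinct (leaves t)"
    and "\<And>x. comb_colored x \<Longrightarrow> set (leaves x) =
        set (leaves t) \<Longrightarrow> length (leaves x) = length (leaves t) \<Longrightarrow>
      leaves x > leaves t \<Longrightarrow> f x = 0"
  shows "lie_expand t f = f t"
  using assms
proof (induction t arbitrary: f)
  case (Node j l r)
  let ?h = "hd (leaves l)"
  have nl: "normalized l" "normalized r" "comb_colored l" "comb_colored r"
    "distinct (leaves l)" "distinct (leaves r)"
    using Node.prems by auto
  have hd: "?h = Min (set (leaves (Node j l r)))"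
    using hd_leaves_comb[OF Node.prems(1)] by simp
  have less: "?h < y" if "y \<in> set (leaves r)" for y
  proof -
    have "?h \<le> y" unfolding hd using that by (intro Min_le) auto
    moreover have "?h \<in> set (leaves l)" by simp
    moreover have "set (leaves l) \<inter> set (leaves r) = {}" using Node.prems(3) by simp
    ultimately show ?thesis using that by (metis disjoint_iff le_less)
  qed
  have lexI: "p @ q > leaves (Node j l r)"
    if "p > leaves l" "length p = length (leaves l)" for p q
    using lexord_sufI[OF that(1)[unfolded list_less_def]] that(2) by (simp add: list_less_def)
  have lexI2: "leaves l @ q > leaves (Node j l r)"
    if "q > leaves r" for q
    using lexord_append_leftI[OF that[unfolded list_less_def]] by (simp add: list_less_def)
  \<comment> \<open>A word starting with leaves of \<open>r\<close> is larger already at its first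
    letter, as \<open>l\<close> begins with the smallest label. This removes the reversed product of
    each commutator.\<close>
  have lexI3: "q @ p > leaves (Node j l r)"
    if sq: "set q = set (leaves r)" and ne: "q \<noteq> []" for p q
  proof -
    obtain y q' where q: "q = y # q'" using ne by (meson neq_Nil_conv)
    obtain h l' where l: "leaves l = h # l'" using leaves_nonempty by (meson neq_Nil_conv)
    have "h < y" using less[of y] q sq l by auto
    then show ?thesis by (simp add: l q)
  qed
  have 1: "cprod j b a f = 0"
    if "comb_colored a" "set (leaves a) = set (leaves l)" "length (leaves a) = length (leaves l)"
      "comb_colored b" "set (leaves b) = set (leaves r)" "length (leaves b) = length (leaves r)" for a b
  proof -
    have "cprod j b a f = cprod j b a (\<lambda>x. 0)"
    proof (rule cprod_cong)
      fix x assume x: "leaves x = leaves b @ leaves a" and y: "comb_colored x"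
      then show "f x = 0"
        using that x lexI3[of "leaves b" "leaves a"] y by (intro Node.prems(4)) auto
    qed (use that in auto)
    then show ?thesis using cprod_mult[of j b a 0 "\<lambda>x. 0"] by simp
  qed
  have 2: "cprod j a b f = 0"
    if "comb_colored a" "set (leaves a) = set (leaves l)" "length (leaves a) = length (leaves l)"
      "comb_colored b" "set (leaves b) = set (leaves r)" "length (leaves b) = length (leaves r)"
      "leaves a @ leaves b > leaves (Node j l r)" for a b
  proof -
    have "cprod j a b f = cprod j a b (\<lambda>x. 0)"
      by (rule cprod_cong) (use that in \<open>auto intro: Node.prems(4)\<close>)
    then show ?thesis using cprod_mult[of j a b 0 "\<lambda>x. 0"] by simp
  qed
  have "lie_expand (Node j l r) f = lie_expand l (\<lambda>a. lie_expand r (\<lambda>b. cprod j a b f))"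
    unfolding lie_expand.simps
    by (intro lie_expand_cong) (simp add: 1)
  also have "\<dots> = lie_expand r (\<lambda>b. cprod j l b f)"
  proof (rule Node.IH(1))
    fix a assume a: "comb_colored a" "set (leaves a) = set (leaves l)" "length (leaves a) = length (leaves l)"
      "leaves l < leaves a"
    have "lie_expand r (\<lambda>b. cprod j a b f) = lie_expand r (\<lambda>b. 0)"
      by (rule lie_expand_cong) (use a lexI in \<open>auto intro!: 2\<close>)
    then show "lie_expand r (\<lambda>b. cprod j a b f) = 0" by (simp add: lie_expand_zero)
  qed (use nl in auto)
  also have "\<dots> = cprod j l r f"
  proof (rule Node.IH(2))
    fix b assume b: "comb_colored b" "set (leaves b) = set (leaves r)" "length (leaves b) = length (leaves r)"
      "leaves r < leaves b"
    show "cprod j l b f = 0"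
      by (rule 2) (use b nl lexI2 in auto)
  qed (use nl in auto)
  \<comment> \<open>The color condition on combs makes this product a single tree, so no other tree
    with the same leaf word arises.\<close>
  also have "\<dots> = f (Node j l r)"
    using Node.prems(2) by (intro cprod_normal) auto
  finally show ?case .
qed simp

section \<open>Straightening\<close>

lemma ctx_leaves_colors:
  assumes "ctx K"
  shows "\<exists>p q p' q'. \<forall>t. leaves (K t) = p @ leaves t @ q \<and>
      colors (K t) = p' @ colors t @ q'"
  using assms
proof induction
  case hole
  show ?case by (intro exI[of _ "[]"]) simp
next
  case (left K j r)
  then obtain p q p' q' where "\<forall>t. leaves (K t) = p @ leaves t @ q \<and>
      colors (K t) = p' @ colors t @ q'"
    by blast
  then show ?case
    by (intro exI[of _ p] exI[of _ "leaves r @ q"] exI[of _ p'] exI[of _ "colors r @ [j] @ q'"]) simp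
next
  case (right K j l)
  then obtain p q p' q' where "\<forall>t. leaves (K t) = p @ leaves t @ q \<and>
      colors (K t) = p' @ colors t @ q'"
    by blast
  then show ?case
    by (intro exI[of _ "p @ leaves l"] exI[of _ q] exI[of _ "p' @ colors l"] exI[of _ "[j] @ q'"]) simp
qed

lemma labeled_trees_of_type_mset_cong:
  assumes "t \<in> labeled_trees_of_type n \<mu>" "mset (leaves t') = mset (leaves t)"
    "mset (colors t') = mset (colors t)"
  shows "t' \<in> labeled_trees_of_type n \<mu>"
proof -
  have "distinct (leaves t') = distinct (leaves t)"
    by (rule mset_eq_imp_distinct_iff[OF assms(2)])
  moreover have "set (leaves t') = set (leaves t)" by (rule mset_eq_setD[OF assms(2)])
  moreover have "set (colors t') = set (colors t)" by (rule mset_eq_setD[OF assms(3)])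
  moreover have "count_list (colors t') j = count_list (colors t) j" for j
    using arg_cong[OF assms(3), of "\<lambda>M. count M j"] by (simp add: count_mset)
  ultimately show ?thesis using assms(1) by (simp add: labeled_trees_of_type_def labeled_trees_def)
qed

lemma ctx_labeled_cong:
  assumes "ctx K" "K t \<in> labeled_trees_of_type n \<mu>" "mset (leaves t') = mset (leaves t)"
    "mset (colors t') = mset (colors t)"
  shows "K t' \<in> labeled_trees_of_type n \<mu>"
proof -
  obtain p q p' q' where "\<forall>t. leaves (K t) = p @ leaves t @ q \<and>
      colors (K t) = p' @ colors t @ q'"
    using ctx_leaves_colors[OF assms(1)] by blast
  then show ?thesis
    by (intro labeled_trees_of_type_mset_cong[OF assms(2)]) (simp_all add: assms(3,4))
qed

lemma ctx_labeled_sub: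
  assumes "ctx K" "K t \<in> labeled_trees_of_type n \<mu>"
  shows "distinct (leaves t)" "set (leaves t) \<subseteq> {1..n}" "set (colors t) \<subseteq> supp \<mu>"
    "set (colors t) \<subseteq> {1..}"
proof -
  obtain p q p' q' where K: "\<forall>t. leaves (K t) = p @ leaves t @ q \<and>
      colors (K t) = p' @ colors t @ q'"
    using ctx_leaves_colors[OF assms(1)] by blast
  have sub: "set (leaves t) \<subseteq> set (leaves (K t))" "set (colors t) \<subseteq> set (colors (K t))"
    and dist: "distinct (leaves (K t)) \<Longrightarrow> distinct (leaves t)"
    using K[rule_format, of t] by auto
  have Kt: "distinct (leaves (K t))" "set (leaves (K t)) = {1..n}" "set (colors (K t)) \<subseteq> {1..}"
    "\<And>j. count_list (colors (K t)) j = \<mu> j"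
    using assms(2) by (simp_all add: labeled_trees_of_type_def labeled_trees_def)
  show "distinct (leaves t)" "set (leaves t) \<subseteq> {1..n}" "set (colors t) \<subseteq> {1..}"
    using sub dist Kt(1-3) by blast+
  show "set (colors t) \<subseteq> supp \<mu>"
  proof
    fix j assume "j \<in> set (colors t)"
    then have "count_list (colors (K t)) j \<noteq> 0" using sub(2) by (auto simp: count_list_0_iff)
    then show "j \<in> supp \<mu>" using Kt(4)[of j] by (simp add: supp_def)
  qed
qed

text \<open>\<open>\<phi>\<close> stands for a bracketed tree or for the signed chain of a tree, and
  \<open>U\<close> for the vectors whose class lies in the span of the combs. All relations have
  coefficients 1, so closure as an additive subgroup suffices. The color bound \<open>m\<close>
  makes the induction on increasing color terminate.\<close>

locale straightening =
  fixes \<phi> :: "ctree \<Rightarrow> 'v::ab_group_add" and U :: "'v set"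
      and n m :: nat and \<mu> :: "nat \<Rightarrow> nat"
  assumes zero_U: "0 \<in> U" and add_U: "u \<in> U \<Longrightarrow> v \<in> U \<Longrightarrow>
      u + v \<in> U"
    and neg_U: "u \<in> U \<Longrightarrow> - u \<in> U"
    and color_bound: "supp \<mu> \<subseteq> {..m}"
    and rel: "R \<in> lie_rels \<Longrightarrow> ctx K \<Longrightarrow>
        (\<And>t. t \<in> set R \<Longrightarrow> K t
        \<in> labeled_trees_of_type n \<mu>) \<Longrightarrow>
      (\<Sum>t\<leftarrow>R. \<phi> (K t)) \<in> U"
begin

abbreviation "T \<equiv> labeled_trees_of_type n \<mu>"

lemma cancel_U: "u + v \<in> U \<Longrightarrow> v \<in> U \<Longrightarrow> u \<in> U"
  using add_U[of "u + v" "- v"] neg_U[of v] by simp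

lemma flip_U:
  assumes "ctx K" "K (Node j x y) \<in> T" "\<phi> (K (Node j x y)) \<in> U"
  shows "\<phi> (K (Node j y x)) \<in> U"
proof -
  have "K (Node j y x) \<in> T"
    by (rule ctx_labeled_cong[OF assms(1,2)]) (simp_all add: ac_simps)
  then have "\<phi> (K (Node j y x)) + \<phi> (K (Node j x y)) \<in> U"
    using rel[OF lie_rels.anti[of j y x] assms(1)] assms(2) by auto
  then show ?thesis using assms(3) cancel_U by blast
qed

text \<open>The hypothesis on combs, localized at the hole of \<open>K\<close>, because the
  induction straightens a subtree inside the context formed by the rest of the tree.\<close>

definition combs_in_U :: "(ctree \<Rightarrow> ctree) \<Rightarrow> nat set \<Rightarrow> bool" where
  "combs_in_U K S \<longleftrightarrow> (\<forall>c. normalized c \<longrightarrow> comb_colored c \<longrightarrow> set (leaves c) = S \<longrightarrow>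
     K c \<in> T \<longrightarrow> \<phi> (K c) \<in> U)"

lemma comb_product:
  assumes "ctx K" "normalized l" "comb_colored l" "normalized r" "comb_colored r"
    "Min (set (leaves l) \<union> set (leaves r)) \<in> set (leaves l)" "K (Node j l r) \<in> T"
    "combs_in_U K (set (leaves l) \<union> set (leaves r))"
  shows "\<phi> (K (Node j l r)) \<in> U"
  using assms
\<comment> \<open>Since \<open>m - j\<close> is at most \<open>m\<close>, the factor
  \<open>Suc m\<close> encodes a lexicographic order: first fewer leaves on the right, then a larger
  color.\<close>
proof (induction "length (leaves r) * Suc m + (m - j)" arbitrary: K l r j rule: less_induct)
  case less
  note K = less.prems(1) and inT = less.prems(7)
  show ?case
  proof (cases "is_Leaf r \<or> rcolor r < j")
    case True
    then show ?thesis using less.prems unfolding combs_in_U_def by auto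
  next
    case False
    then obtain i b c where r: "r = Node i b c" "j \<le> i" by (cases r) auto
    have b: "normalized b" "comb_colored b" and c: "normalized c" "comb_colored c"
      and minb: "Min (set (leaves b) \<union> set (leaves c)) \<in> set (leaves b)"
      using less.prems(4,5) r by auto
    have "i \<in> supp \<mu>" using ctx_labeled_sub(3)[OF K inT] r by auto
    then have im: "i \<le> m" using color_bound by auto
    have small: "length (leaves b') * Suc m + (m - j') < length (leaves r) * Suc m + (m - j)"
      if "b' = b \<or> b' = c" for b' j'
    proof -
      have "Suc (length (leaves b')) \<le> length (leaves r)"
        using that r leaves_nonempty[of b] leaves_nonempty[of c] by (auto simp: Suc_le_eq)
      then have "Suc (length (leaves b')) * Suc m \<le> length (leaves r) * Suc m"
        by (rule mult_le_mono1)
      then show ?thesis by simp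
    qed
    have in_T: "K t \<in> T" if "{#i', j'#} = {#i, j#}"
        "mset (leaves t) = mset (leaves l) + mset (leaves b) + mset (leaves c)"
      "mset (colors t) = mset (colors l) + mset (colors b) + mset (colors c) + {#i', j'#}" for t i' j'
      by (rule ctx_labeled_cong[OF K inT]) (simp_all add: that r del: add_mset_add_single)
    \<comment> \<open>Both right factors \<open>b'\<close> and \<open>c'\<close> are smaller than
      \<open>r\<close>. The inner product is straightened first, and each comb replacing it then
      multiplies the other factor. As the smallest label lies in \<open>l\<close>, the minimum
      condition holds at both nodes.\<close>
    have H: "\<phi> (K (Node j' (Node i' l b') c')) \<in> U"
      if bc: "(b' = b \<and> c' = c) \<or> (b' = c \<and> c' = b)"
          and ij: "{#i', j'#} = {#i, j#}" for b' c' i' j'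
    proof -
      have nb: "normalized b'" "comb_colored b'" "normalized c'" "comb_colored c'"
        using bc b c by auto
      have S: "set (leaves l) \<union> set (leaves r) =
          set (leaves l) \<union> set (leaves b') \<union> set (leaves c')"
        using r bc by auto
      have minl: "Min (set (leaves l) \<union> set (leaves b') \<union> set (leaves c')) \<in> set (leaves l)"
        using less.prems(6) S by simp
      have T': "K (Node j' (Node i' l b') c') \<in> T"
        by (rule in_T[OF ij]) (use bc in auto)
      have b': "b' = b \<or> b' = c" and c': "c' = b \<or> c' = c" using bc by auto
      have ctx': "ctx (\<lambda>t. K (Node j' t c'))" by (rule ctx.left[OF K])
      have "Min (set (leaves l) \<union> set (leaves b')) =
          Min (set (leaves l) \<union> set (leaves b') \<union> set (leaves c'))"
        by (rule Min_eqI) (use minl in auto)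
      then have min': "Min (set (leaves l) \<union> set (leaves b')) \<in> set (leaves l)" using minl by simp
      have "combs_in_U (\<lambda>t. K (Node j' t c')) (set (leaves l) \<union> set (leaves b'))"
        unfolding combs_in_U_def
      proof (intro allI impI)
        fix x assume x: "normalized x" "comb_colored x"
          "set (leaves x) = set (leaves l) \<union> set (leaves b')" "K (Node j' x c') \<in> T"
        have "Min (set (leaves x) \<union> set (leaves c')) \<in> set (leaves x)"
          using minl x(3) by simp
        moreover have "combs_in_U K (set (leaves x) \<union> set (leaves c'))"
          using less.prems(8) S x(3) by simp
        ultimately show "\<phi> (K (Node j' x c')) \<in> U"
          by (intro less.hyps[OF small[OF c'] K x(1,2) nb(3,4) _ x(4)])
      qed
      then show ?thesis
        by (rule less.hyps[OF small[OF b'] ctx' less.prems(2,3) nb(1,2) min' T'])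
    qed
    \<comment> \<open>Antisymmetry brings the other terms of a relation into the form covered by
      \<open>H\<close>.\<close>
    have Ha: "\<phi> (K (Node j' c (Node i' l b))) \<in> U" if ij: "{#i', j'#} = {#i, j#}" for i' j'
    proof (rule flip_U[OF K])
      show "K (Node j' (Node i' l b) c) \<in> T" by (rule in_T[OF ij]) auto
      show "\<phi> (K (Node j' (Node i' l b) c)) \<in> U" by (rule H[OF _ ij]) simp
    qed
    have Hb: "\<phi> (K (Node j' b (Node i' c l))) \<in> U" if ij: "{#i', j'#} = {#i, j#}" for i' j'
    proof (rule flip_U[OF K])
      show "K (Node j' (Node i' c l) b) \<in> T" by (rule in_T[OF ij]) auto
      show "\<phi> (K (Node j' (Node i' c l) b)) \<in> U"
      proof (rule flip_U[OF ctx.left[OF K]])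
        show "K (Node j' (Node i' l c) b) \<in> T" by (rule in_T[OF ij]) auto
        show "\<phi> (K (Node j' (Node i' l c) b)) \<in> U" by (rule H[OF _ ij]) simp
      qed
    qed
    show ?thesis
    proof (cases "i = j")
      case True
      have "(\<Sum>t\<leftarrow>[Node j l (Node j b c), Node j c (Node j l b),
          Node j b (Node j c l)]. \<phi> (K t)) \<in> U"
        by (rule rel[OF lie_rels.jac K]) (use True in \<open>auto intro!: in_T[OF refl]\<close>)
      then have sum: "\<phi> (K (Node j l r)) + (\<phi> (K (Node j c (Node j l b))) +
          \<phi> (K (Node j b (Node j c l)))) \<in> U"
        using r True by (simp add: add.assoc)
      have 1: "\<phi> (K (Node j c (Node j l b))) \<in> U" by (rule Ha) (simp add: True)
      have 2: "\<phi> (K (Node j b (Node j c l))) \<in> U" by (rule Hb) (simp add: True)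
      show ?thesis by (rule cancel_U[OF sum add_U[OF 1 2]])
    next
      case False
      then have ji: "j < i" using r by simp
      have T': "K (Node i l (Node j b c)) \<in> T" by (rule in_T[OF refl]) auto
      have "(\<Sum>t\<leftarrow>[Node j l (Node i b c), Node j c (Node i l b), Node j b (Node i c l),
          Node i l (Node j b c), Node i c (Node j l b), Node i b (Node j c l)]. \<phi> (K t)) \<in> U"
        by (rule rel[OF lie_rels.comp K]) (use False in \<open>auto intro!: in_T[OF refl]\<close>)
      then have sum: "\<phi> (K (Node j l r)) + (\<phi> (K (Node j c (Node i l b))) +
          \<phi> (K (Node j b (Node i c l)))
          + \<phi> (K (Node i l (Node j b c)))
          + (\<phi> (K (Node i c (Node j l b))) + \<phi> (K (Node i b (Node j c l))))) \<in> U"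
        using r by (simp add: add.assoc)
      have 1: "\<phi> (K (Node j c (Node i l b))) \<in> U" "\<phi> (K (Node i c (Node j l b))) \<in> U"
        by (rule Ha; simp add: add_mset_commute)+
      have 2: "\<phi> (K (Node j b (Node i c l))) \<in> U" "\<phi> (K (Node i b (Node j c l))) \<in> U"
        by (rule Hb; simp add: add_mset_commute)+
      \<comment> \<open>Here the right subtree keeps its leaves and the color rises from
        \<open>j\<close> to \<open>i\<close>. The subtree is first straightened into combs
        \<open>y\<close> on the same labels, so the size is unchanged and the second component of
        the measure decreases.\<close>
      have 3: "\<phi> (K (Node i l (Node j b c))) \<in> U"
      proof (rule less.hyps[OF small ctx.right[OF K] b c minb T'])
        show "combs_in_U (\<lambda>t. K (Node i l t)) (set (leaves b) \<union> set (leaves c))"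
          unfolding combs_in_U_def
        proof (intro allI impI)
          fix y assume y: "normalized y" "comb_colored y"
            "set (leaves y) = set (leaves b) \<union> set (leaves c)" "K (Node i l y) \<in> T"
          have "distinct (leaves y)" "distinct (leaves r)"
            using ctx_labeled_sub(1)[OF K y(4)] ctx_labeled_sub(1)[OF K inT] by auto
          moreover have S: "set (leaves y) = set (leaves r)" using y r by simp
          ultimately have "length (leaves y) = length (leaves r)"
            by (metis distinct_card)
          then have "length (leaves y) * Suc m + (m - i) < length (leaves r) * Suc m + (m - j)"
            using ji im by simp
          then show "\<phi> (K (Node i l y)) \<in> U"
            using less.prems(6,8) S by (intro less.hyps[OF _ K less.prems(2,3) y(1,2) _ y(4)]) simp_all
        qed
      qed simp
      show ?thesis
        by (rule cancel_U[OF sum add_U[OF add_U[OF add_U[OF 1(1) 2(1)] 3] add_U[OF 1(2) 2(2)]]])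
    qed
  qed
qed

text \<open>Each child in turn is replaced by combs inside the context formed by the rest of the
  tree; for two comb children \<open>comb_product\<close> applies, after antisymmetry if the
  smallest label lies on the right.\<close>

lemma straighten:
  assumes "ctx K" "K t \<in> T" "combs_in_U K (set (leaves t))"
  shows "\<phi> (K t) \<in> U"
  using assms
proof (induction t arbitrary: K)
  case (Leaf i)
  then show ?case by (simp add: combs_in_U_def)
next
  case (Node j l r)
  note K = Node.prems(1)
  show ?case
  proof (rule Node.IH(1)[OF ctx.left[OF K] Node.prems(2)], unfold combs_in_U_def, intro allI impI)
    fix c assume c: "normalized c" "comb_colored c" "set (leaves c) = set (leaves l)" "K (Node j c r) \<in> T"
    show "\<phi> (K (Node j c r)) \<in> U"
    proof (rule Node.IH(2)[OF ctx.right[OF K] c(4)], unfold combs_in_U_def, intro allI impI)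
      fix d assume d: "normalized d" "comb_colored d" "set (leaves d) = set (leaves r)"
          "K (Node j c d) \<in> T"
      have S: "combs_in_U K (set (leaves c) \<union> set (leaves d))"
        "combs_in_U K (set (leaves d) \<union> set (leaves c))"
        using Node.prems(3) c d by (simp_all add: Un_commute)
      have "Min (set (leaves c) \<union> set (leaves d)) \<in> set (leaves c) \<union> set (leaves d)"
        by (rule Min_in) auto
      then consider "Min (set (leaves c) \<union> set (leaves d)) \<in> set (leaves c)"
        | "Min (set (leaves d) \<union> set (leaves c)) \<in> set (leaves d)" by (auto simp: Un_commute)
      then show "\<phi> (K (Node j c d)) \<in> U"
      proof cases
        case 1
        then show ?thesis using c d S K by (intro comb_product) auto
      next
        case 2
        have T': "K (Node j d c) \<in> T"
          by (rule ctx_labeled_cong[OF K d(4)]) (simp_all add: ac_simps)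
        have "\<phi> (K (Node j d c)) \<in> U"
          using c d S K 2 T' by (intro comb_product) auto
        then show ?thesis using flip_U[OF K T'] by simp
      qed
    qed
  qed
qed

corollary straighten_all:
  assumes "\<And>c. c \<in> Comb n \<mu> \<Longrightarrow> \<phi> c \<in> U" "t \<in> T"
  shows "\<phi> t \<in> U"
  using straighten[OF ctx.hole, of t] assms by (auto simp: combs_in_U_def Comb_def)

end

section \<open>Quotients of function spaces\<close>

locale function_quotient =
  fixes C W :: "('x \<Rightarrow> 'a::field) set"
  assumes zero_C: "(\<lambda>x. 0) \<in> C"
    and add_C: "\<And>u v. u \<in> C \<Longrightarrow> v \<in> C \<Longrightarrow>
        (\<lambda>x. u x + v x) \<in> C"
    and smult_C: "\<And>a u. u \<in> C \<Longrightarrow> (\<lambda>x. a * u x) \<in> C"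
    and sub_W: "W \<subseteq> C"
    and zero_W: "(\<lambda>x. 0) \<in> W"
    and add_W: "\<And>u v. u \<in> W \<Longrightarrow> v \<in> W \<Longrightarrow>
        (\<lambda>x. u x + v x) \<in> W"
    and smult_W: "\<And>a u. u \<in> W \<Longrightarrow> (\<lambda>x. a * u x) \<in> W"
begin

abbreviation "V \<equiv> quot_module (fun_module C) W"

definition coset :: "('x \<Rightarrow> 'a) \<Rightarrow> ('x \<Rightarrow> 'a) set" where
  "coset v = W +>\<^bsub>fun_module C\<^esub> v"

lemma vectorspace_V: "vectorspace class_ring V"
  by (rule vectorspace_quot_module) (fact zero_C add_C smult_C sub_W zero_W add_W smult_W)+

sublocale vectorspace class_ring V
  by (rule vectorspace_V)

lemma mem_coset: "f \<in> coset v \<longleftrightarrow> (\<lambda>x. f x - v x) \<in> W"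
proof
  assume "f \<in> coset v"
  then show "(\<lambda>x. f x - v x) \<in> W" by (auto simp: coset_def fun_module_coset)
next
  assume "(\<lambda>x. f x - v x) \<in> W"
  then show "f \<in> coset v"
    unfolding coset_def fun_module_coset by (intro CollectI exI[of _ "\<lambda>x. f x - v x"]) auto
qed

lemma coset_eqI: "(\<lambda>x. u x - v x) \<in> W \<Longrightarrow> coset u = coset v"
proof (rule Set.set_eqI)
  fix f assume uv: "(\<lambda>x. u x - v x) \<in> W"
  show "f \<in> coset u \<longleftrightarrow> f \<in> coset v"
    unfolding mem_coset
    using add_W[OF uv, of "\<lambda>x. f x - u x"] add_W[OF smult_W[OF uv, of "-1"],
        of "\<lambda>x. f x - v x"]
    by auto
qed

lemma coset_zeroD: "coset u = \<zero>\<^bsub>V\<^esub> \<Longrightarrow> u \<in> W"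
  using mem_coset[of u u] zero_W by (simp add: quot_module_def)

lemma coset_zero: "coset (\<lambda>x. 0) = \<zero>\<^bsub>V\<^esub>"
  by (auto simp: mem_coset quot_module_def)

lemma carrier_V: "carrier V = coset ` C"
  by (auto simp: quot_module_def A_RCOSETS_def' coset_def) (auto simp: fun_module_def)

lemma coset_carrier: "v \<in> C \<Longrightarrow> coset v \<in> carrier V"
  by (simp add: carrier_V)

lemma coset_add: "coset u \<oplus>\<^bsub>V\<^esub> coset v = coset (\<lambda>x. u x + v x)"
proof (intro Set.set_eqI iffI)
  fix f assume "f \<in> coset u \<oplus>\<^bsub>V\<^esub> coset v"
  then obtain p q where pq: "p \<in> coset u" "q \<in> coset v" "f = (\<lambda>x. p x + q x)"
    by (auto simp: quot_module_def set_add_def set_mult_def fun_module_def)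
  then show "f \<in> coset (\<lambda>x. u x + v x)"
    using add_W[of "\<lambda>x. p x - u x" "\<lambda>x. q x - v x"] by (simp add: mem_coset algebra_simps)
next
  fix f assume "f \<in> coset (\<lambda>x. u x + v x)"
  then have "(\<lambda>x. f x - v x) \<in> coset u" "v \<in> coset v"
    using zero_W by (simp_all add: mem_coset algebra_simps)
  then have "\<exists>p\<in>coset u. \<exists>q\<in>coset v. f = (\<lambda>x. p x + q x)"
    by (intro bexI[of _ v] bexI[of _ "\<lambda>x. f x - v x"]) simp_all
  then show "f \<in> coset u \<oplus>\<^bsub>V\<^esub> coset v"
    by (auto simp: quot_module_def set_add_def set_mult_def fun_module_def)
qed

lemma coset_smult: "a \<odot>\<^bsub>V\<^esub> coset u = coset (\<lambda>x. a * u x)"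
proof (intro Set.set_eqI iffI)
  fix f assume "f \<in> a \<odot>\<^bsub>V\<^esub> coset u"
  then obtain w p where wp: "w \<in> W" "p \<in> coset u" "f = (\<lambda>x. w x + a * p x)"
    by (auto simp: quot_module_def set_add_def set_mult_def fun_module_def)
  then show "f \<in> coset (\<lambda>x. a * u x)"
    using add_W[OF wp(1) smult_W[of "\<lambda>x. p x - u x" a]] by (simp add: mem_coset algebra_simps)
next
  fix f assume "f \<in> coset (\<lambda>x. a * u x)"
  then have "(\<lambda>x. f x - a * u x) \<in> W" "u \<in> coset u"
    using zero_W by (simp_all add: mem_coset)
  then have "\<exists>w\<in>W. \<exists>p\<in>coset u. f = (\<lambda>x. w x + a * p x)"
    by (intro bexI[of _ u] bexI[of _ "\<lambda>x. f x - a * u x"]) simp_all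
  then show "f \<in> a \<odot>\<^bsub>V\<^esub> coset u"
    by (auto simp: quot_module_def set_add_def set_mult_def fun_module_def)
qed

lemma finsum_coset:
  assumes "finite J" "\<And>t. t \<in> J \<Longrightarrow> v t \<in> C"
  shows "(\<Oplus>\<^bsub>V\<^esub>t\<in>J. \<alpha> t \<odot>\<^bsub>V\<^esub> coset (v t)) =
      coset (\<lambda>x. \<Sum>t\<in>J. \<alpha> t * v t x)"
  using assms
proof (induction J rule: finite_induct)
  case empty
  show ?case by (simp add: coset_zero)
next
  case (insert t J)
  then show ?case
    by (subst finsum_insert) (auto simp: coset_smult coset_add intro!: coset_carrier smult_C)
qed

lemma coset_lin_indpt:
  assumes "\<And>t. t \<in> I \<Longrightarrow> v t \<in> C"
    and ind: "\<And>J \<alpha> t. finite J \<Longrightarrow> J \<subseteq> I \<Longrightarrow>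
        (\<lambda>x. \<Sum>t\<in>J. \<alpha> t * v t x) \<in> W \<Longrightarrow>
        t \<in> J \<Longrightarrow> \<alpha> t = 0"
  shows "lin_indpt ((\<lambda>t. coset (v t)) ` I)"
proof
  assume "lin_dep ((\<lambda>t. coset (v t)) ` I)"
  then obtain A a u where A: "finite A" "A \<subseteq> (\<lambda>t. coset (v t)) ` I"
      "lincomb a A = \<zero>\<^bsub>V\<^esub>"
      "u \<in> A" "a u \<noteq> 0"
    unfolding lin_dep_def by simp blast
  \<comment> \<open>Independence concerns a set of cosets, and different indices might give the same
    coset; \<open>J\<close> picks one index for each coset.\<close>
  obtain J where J: "J \<subseteq> I" "inj_on (\<lambda>t. coset (v t)) J" "A = (\<lambda>t. coset (v t)) ` J"
    using A(2) unfolding subset_image_inj by blast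
  then have fin: "finite J" using A(1) finite_image_iff by blast
  have car: "\<And>t. t \<in> J \<Longrightarrow> v t \<in> C" using J assms(1) by auto
  have "lincomb a A = (\<Oplus>\<^bsub>V\<^esub>t\<in>J. a (coset (v t))
      \<odot>\<^bsub>V\<^esub> coset (v t))"
    unfolding lincomb_def J(3)
    by (rule finsum_reindex) (use J car in \<open>auto simp: coset_smult intro!: coset_carrier smult_C\<close>)
  also have "\<dots> = coset (\<lambda>x. \<Sum>t\<in>J. a (coset (v t)) * v t x)"
    by (rule finsum_coset[OF fin car])
  finally have "(\<lambda>x. \<Sum>t\<in>J. a (coset (v t)) * v t x) \<in> W"
    using A(3) coset_zeroD by simp
  moreover obtain t where t: "t \<in> J" "u = coset (v t)" using A(4) J(3) by blast
  ultimately have "a (coset (v t)) = 0"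
    using ind[OF fin J(1), of "\<lambda>t. a (coset (v t))" t] by blast
  then show False using A(5) t by simp
qed

lemma coset_in_span:
  assumes "\<And>t. t \<in> I \<Longrightarrow> v t \<in> C" "finite J" "J \<subseteq> I"
    and "(\<lambda>x. u x - (\<Sum>t\<in>J. \<alpha> t * v t x)) \<in> W"
  shows "coset u \<in> span ((\<lambda>t. coset (v t)) ` I)"
proof -
  let ?S = "(\<lambda>t. coset (v t)) ` I"
  have S: "?S \<subseteq> carrier V" using assms(1) by (auto intro: coset_carrier)
  interpret sp: LinearCombinations.submodule class_ring "span ?S" V by (rule span_is_submodule[OF S])
  have "coset (\<lambda>x. \<Sum>t\<in>J. \<alpha> t * v t x) \<in> span ?S"
    using assms(2,3)
  proof (induction J rule: finite_induct)
    case empty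
    show ?case using sp.zero_closed by (simp add: coset_zero)
  next
    case (insert t J)
    have "coset (v t) \<in> span ?S" using insert.prems in_own_span[OF S] by auto
    then have "\<alpha> t \<odot>\<^bsub>V\<^esub> coset (v t) \<in> span ?S" by (intro sp.smult_closed) auto
    from sp.m_closed[OF this insert.IH] insert show ?case by (simp add: coset_smult coset_add)
  qed
  then show ?thesis using coset_eqI[OF assms(4)] by simp
qed

text \<open>This has the form of \<open>Lie\<close>, whose carrier is the span of all bracketed
  trees while its operations come from the whole free Lie algebra.\<close>

lemma basis_of_span:
  assumes "lin_indpt A" "A \<subseteq> B" "B \<subseteq> carrier V" "B \<subseteq> span A"
  shows "vectorspace.basis class_ring (V\<lparr>carrier := span B\<rparr>) A"
proof -
  have AV: "A \<subseteq> carrier V" using assms by blast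
  have subB: "LinearCombinations.submodule class_ring (span B) V" by (rule span_is_submodule[OF assms(3)])
  have vs: "vectorspace class_ring (V\<lparr>carrier := span B\<rparr>)"
    using submodule_is_module[OF subB] by (simp add: vectorspace_def class_field.field_axioms)
  have AB: "A \<subseteq> span B" using assms in_own_span by blast
  have "span B \<subseteq> span A"
    by (rule span_is_subset[OF assms(4) span_is_submodule[OF AV]])
  moreover have "span A \<subseteq> span B" by (rule span_is_monotone[OF assms(2)])
  ultimately show ?thesis
    unfolding vectorspace.basis_def[OF vs]
    using span_li_not_depend[OF AB subB] assms(1) AB by auto
qed

lemma straighten_span:
  assumes \<phi>: "\<And>t. t \<in> labeled_trees_of_type n \<mu> \<Longrightarrow>
      \<phi> t \<in> C" and \<mu>: "supp \<mu> \<subseteq> {..m}"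
    and rel: "\<And>R K. R \<in> lie_rels \<Longrightarrow> ctx K \<Longrightarrow>
        (\<And>t. t \<in> set R \<Longrightarrow> K t
        \<in> labeled_trees_of_type n \<mu>) \<Longrightarrow>
      (\<lambda>x. \<Sum>t\<leftarrow>R. \<phi> (K t) x) \<in> W"
    and t: "t \<in> labeled_trees_of_type n \<mu>"
  shows "coset (\<phi> t) \<in> span ((\<lambda>c. coset (\<phi> c)) ` Comb n \<mu>)"
proof -
  let ?S = "(\<lambda>c. coset (\<phi> c)) ` Comb n \<mu>"
  have S: "?S \<subseteq> carrier V" using \<phi> by (auto simp: Comb_def intro: coset_carrier)
  interpret sp: LinearCombinations.submodule class_ring "span ?S" V by (rule span_is_submodule[OF S])
  define U where "U = {u \<in> C. coset u \<in> span ?S}"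
  interpret straightening \<phi> U n m \<mu>
  proof
    show "0 \<in> U" using sp.zero_closed zero_C by (simp add: U_def coset_zero func_zero)
    show "u + v \<in> U" if "u \<in> U" "v \<in> U" for u v
      using that sp.m_closed[of "coset u" "coset v"] add_C[of u v]
      by (simp add: U_def coset_add plus_fun_def)
    show "- u \<in> U" if "u \<in> U" for u
      using that sp.smult_closed[of "-1" "coset u"] smult_C[of u "-1"]
      by (simp add: U_def coset_smult fun_Compl_def)
    show "supp \<mu> \<subseteq> {..m}" by (rule \<mu>)
    show "(\<Sum>t\<leftarrow>R. \<phi> (K t)) \<in> U"
      if "R \<in> lie_rels" "ctx K" "\<And>t. t \<in> set R \<Longrightarrow>
          K t \<in> labeled_trees_of_type n \<mu>" for R K
    proof -
      have eq: "(\<Sum>t\<leftarrow>R. \<phi> (K t)) =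
          (\<lambda>x. \<Sum>t\<leftarrow>R. \<phi> (K t) x)" for R
        by (induction R) (simp_all add: func_zero plus_fun_def)
      have W: "(\<lambda>x. \<Sum>t\<leftarrow>R. \<phi> (K t) x) \<in> W" by (rule rel) (use that in auto)
      then have "coset (\<lambda>x. \<Sum>t\<leftarrow>R. \<phi> (K t) x) =
          coset (\<lambda>x. 0)" by (intro coset_eqI) simp
      then show ?thesis using W sub_W sp.zero_closed by (auto simp: U_def eq coset_zero)
    qed
  qed
  have "\<phi> c \<in> U" if "c \<in> Comb n \<mu>" for c
    using that in_own_span[OF S] \<phi> by (auto simp: U_def Comb_def)
  then have "\<phi> t \<in> U" using straighten_all t by blast
  then show ?thesis by (simp add: U_def)
qed

end

section \<open>The basis of the multilinear component\<close>

text \<open>Among the combs with nonzero coefficient choose one, \<open>d\<close>, with the smallest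
  leaf word, and test against the indicator of \<open>d\<close>. Another comb contributes only
  itself and trees with larger words than its own, so neither a comb with a larger word nor a
  different comb with the same word contributes \<open>d\<close>.\<close>

lemma comb_expansions_independent:
  fixes \<alpha> :: "ctree \<Rightarrow> 'a::comm_ring_1"
  assumes J: "finite J" "J \<subseteq> Comb n \<mu>"
      and sum: "\<And>f. (\<Sum>c\<in>J. \<alpha> c * lie_expand c f) = 0"
    and t: "t \<in> J"
  shows "\<alpha> t = 0"
proof (rule ccontr)
  assume "\<alpha> t \<noteq> 0"
  define X where "X = {c \<in> J. \<alpha> c \<noteq> 0}"
  have X: "finite X" "X \<noteq> {}" using J t \<open>\<alpha> t \<noteq> 0\<close> by (auto simp: X_def)
  define w where "w = Min (leaves ` X)"
  have "w \<in> leaves ` X" unfolding w_def by (rule Min_in) (use X in auto)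
  then obtain d where d: "d \<in> X" "leaves d = w" by auto
  have le: "leaves d \<le> leaves c" if "c \<in> X" for c
    unfolding d(2) w_def by (rule Min_le) (use X that in auto)
  have "lie_expand c (\<lambda>x. if x = d then 1 else 0) = (if c =
      d then 1 else 0 :: 'a)" if "c \<in> X" for c
  proof -
    have "c \<in> Comb n \<mu>" using that J by (auto simp: X_def)
    then have "normalized c" "comb_colored c" "distinct (leaves c)"
      by (auto simp: Comb_def labeled_trees_of_type_def labeled_trees_def)
    then show ?thesis using le[OF that] by (intro lie_expand_comb) auto
  qed
  moreover have "(\<Sum>c\<in>J. \<alpha> c * lie_expand c (\<lambda>x. if x = d then 1 else 0)) =
      (\<Sum>c\<in>X. \<alpha> c * lie_expand c (\<lambda>x. if x = d then 1 else 0))"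
    by (rule sum.mono_neutral_right) (use J in \<open>auto simp: X_def\<close>)
  moreover have "\<dots> = (\<Sum>c\<in>X. if c = d then \<alpha> c else 0)"
    by (rule sum.cong) (use calculation(1) in auto)
  ultimately have "(\<Sum>c\<in>J. \<alpha> c * lie_expand c (\<lambda>x. if x =
      d then 1 else 0)) = \<alpha> d"
    using X d by simp
  then show False using sum d by (simp add: X_def)
qed

section \<open>Expansions on the free nonassociative algebra\<close>

lemma bracketed_eq: "bracketed t s = (if s = t then 1 else 0)"
  by (induction t arbitrary: s) (simp, case_tac s, auto)

definition expansion :: "(ctree \<Rightarrow> 'a) \<Rightarrow> (ctree \<Rightarrow> 'a)
    \<Rightarrow> 'a::field" where
  "expansion f u = (\<Sum>t | u t \<noteq> 0. u t * lie_expand t f)"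

lemma expansion_superset:
  "finite S \<Longrightarrow> {t. u t \<noteq> 0} \<subseteq> S \<Longrightarrow>
      expansion f u = (\<Sum>t\<in>S. u t * lie_expand t f)"
  unfolding expansion_def by (rule sum.mono_neutral_left) auto

lemma free_nonassoc_finite: "x \<in> free_nonassoc n \<Longrightarrow> finite {t. x t \<noteq> 0}"
  by (simp add: free_nonassoc_def)

lemma expansion_add:
  assumes "x \<in> free_nonassoc n" "y \<in> free_nonassoc n"
  shows "expansion f (\<lambda>t. x t + y t) = expansion f x + expansion f y"
proof -
  let ?S = "{t. x t \<noteq> 0} \<union> {t. y t \<noteq> 0}"
  have S: "finite ?S" using assms by (simp add: free_nonassoc_finite)
  show ?thesis
    using expansion_superset[OF S, of "\<lambda>t. x t + y t" f] expansion_superset[OF S, of x f]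
      expansion_superset[OF S, of y f]
    by (subst expansion_superset[OF S]) (auto simp: distrib_right sum.distrib)
qed

lemma expansion_smult:
  assumes "x \<in> free_nonassoc n"
  shows "expansion f (\<lambda>t. a * x t) = a * expansion f x"
  using expansion_superset[OF free_nonassoc_finite[OF assms], of "\<lambda>t. a * x t" f]
  by (auto simp: expansion_def sum_distrib_left mult.assoc)

lemma expansion_bracket:
  assumes "x \<in> free_nonassoc n" "y \<in> free_nonassoc n"
  shows "expansion f (bracket j x y) =
    (\<Sum>a | x a \<noteq> 0. \<Sum>b | y b \<noteq> 0. x a * y b * lie_expand (Node j a b) f)"
proof -
  let ?P = "{a. x a \<noteq> 0} \<times> {b. y b \<noteq> 0}"
  have fin: "finite ?P" using assms by (simp add: free_nonassoc_finite)
  have sub: "{t. bracket j x y t \<noteq> 0} \<subseteq> (\<lambda>(a, b). Node j a b) ` ?P"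
  proof
    fix t assume "t \<in> {t. bracket j x y t \<noteq> 0}"
    then show "t \<in> (\<lambda>(a, b). Node j a b) ` ?P" by (cases t) (auto split: if_splits)
  qed
  have "expansion f (bracket j x y) =
      (\<Sum>t\<in>(\<lambda>(a, b). Node j a b) ` ?P. bracket j x y t * lie_expand t f)"
    by (rule expansion_superset[OF _ sub]) (use fin in simp)
  also have "\<dots> = (\<Sum>(a, b)\<in>?P. x a * y b * lie_expand (Node j a b) f)"
    by (subst sum.reindex) (auto simp: inj_on_def case_prod_beta)
  finally show ?thesis by (simp add: sum.cartesian_product)
qed

text \<open>One factor is expanded under a test function that depends on the other. If that factor
  lies in the ideal, the inner expansion vanishes by the induction hypothesis of
  \<open>expansion_lie_ideal\<close>, whose test function is therefore arbitrary.\<close>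

lemma expansion_bracket_right:
  assumes "x \<in> free_nonassoc n" "y \<in> free_nonassoc n"
  shows "expansion f (bracket j x y) =
    (\<Sum>a | x a \<noteq> 0. x a * lie_expand a (\<lambda>u. expansion (\<lambda>v. cprod j u v f - cprod j v u f) y))"
  unfolding expansion_bracket[OF assms] expansion_def[of _ y]
  by (simp add: lie_expand_sum lie_expand_mult sum_distrib_left mult.assoc)

lemma expansion_bracket_left:
  assumes "x \<in> free_nonassoc n" "y \<in> free_nonassoc n"
  shows "expansion f (bracket j x y) =
    (\<Sum>b | y b \<noteq> 0. y b * lie_expand b (\<lambda>v. expansion (\<lambda>u. cprod j u v f - cprod j v u f) x))"
proof -
  have "lie_expand (Node j a b) f =
      lie_expand b (\<lambda>v. lie_expand a (\<lambda>u. cprod j u v f - cprod j v u f))" for a b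
    unfolding lie_expand.simps by (rule lie_expand_swap)
  then show ?thesis
    unfolding expansion_bracket[OF assms] expansion_def[of _ x]
    by (subst sum.swap)
      (simp add: lie_expand_sum lie_expand_mult sum_distrib_left mult.left_commute mult.assoc
        del: lie_expand.simps)
qed

lemma expansion_bracket2:
  assumes "x \<in> free_nonassoc n" "y \<in> free_nonassoc n" "z \<in> free_nonassoc n" "j \<ge> 1"
  shows "expansion f (bracket i x (bracket j y z)) =
    (\<Sum>a | x a \<noteq> 0. \<Sum>b | y b \<noteq> 0. \<Sum>c | z c \<noteq> 0.
       x a * y b * z c * lie_expand (Node i a (Node j b c)) f)"
  unfolding expansion_bracket_right[OF assms(1) bracket_free[OF assms(2,3,4)]]
    expansion_bracket[OF assms(2,3)]
  by (simp add: lie_expand_sum lie_expand_mult sum_distrib_left mult.assoc)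

lemma sum_rotate:
  "(\<Sum>c\<in>Z. \<Sum>a\<in>X. \<Sum>b\<in>Y. g a b c) =
      (\<Sum>a\<in>X. \<Sum>b\<in>Y. \<Sum>c\<in>Z. g a b c)"
  by (subst sum.swap, rule sum.cong[OF refl], rule sum.swap)

text \<open>By multilinearity each defining relation reduces to the same relation between trees; the
  sums are brought into a common order so that \<open>lie_expand_rels\<close> applies
  termwise.\<close>

lemma expansion_lie_ideal:
  assumes "u \<in> lie_ideal n"
  shows "expansion f u = 0"
  using assms
proof (induction arbitrary: f)
  case (antisymmetry x y j)
  have "x a * y b * lie_expand (Node j a b) f + y b * x a * lie_expand (Node j b a) f = 0" for a b
    using lie_expand_rels[OF lie_rels.anti[of j a b], of f]
    by (simp add: mult.commute[of "y b"] flip: distrib_left)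
  then have "(\<Sum>a | x a \<noteq> 0. \<Sum>b | y b \<noteq> 0. x a * y b * lie_expand (Node j a b) f)
     + (\<Sum>a | x a \<noteq> 0. \<Sum>b | y b \<noteq> 0. y b * x a * lie_expand (Node j b a) f) = 0"
    by (simp only: sum.distrib[symmetric]) simp
  then show ?case
    unfolding expansion_add[OF bracket_free[OF antisymmetry] bracket_free[OF antisymmetry(2,1,3)]]
      expansion_bracket[OF antisymmetry(1,2)] expansion_bracket[OF antisymmetry(2,1)]
    by (subst (2) sum.swap)
next
  case (jacobi x y z j)
  note fr = jacobi(1-3)
  have br: "bracket j x (bracket j y z) \<in> free_nonassoc n" if "x \<in> free_nonassoc n"
    "y \<in> free_nonassoc n" "z \<in> free_nonassoc n" for x y z :: "ctree \<Rightarrow> 'a"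
    using that jacobi(4) by (intro bracket_free) auto
  let ?L = "\<lambda>a b c. lie_expand (Node j a (Node j b c)) f"
  have e: "x a * y b * z c * ?L a b c + z c * x a * y b * ?L c a b + y b * z c * x a * ?L b c a = 0" for a b c
  proof -
    have "x a * y b * z c * ?L a b c + z c * x a * y b * ?L c a b + y b * z c * x a * ?L b c a
      = x a * y b * z c * (?L a b c + (?L c a b + ?L b c a))" by (simp add: algebra_simps)
    then show ?thesis using lie_expand_rels[OF lie_rels.jac[of j a b c], of f] by simp
  qed
  have 2: "expansion f (bracket j z (bracket j x y)) =
      (\<Sum>a | x a \<noteq> 0. \<Sum>b | y b \<noteq> 0. \<Sum>c | z c \<noteq> 0.
      z c * x a * y b * ?L c a b)"
    unfolding expansion_bracket2[OF fr(3,1,2) jacobi(4)] by (rule sum_rotate)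
  have 3: "expansion f (bracket j y (bracket j z x)) =
      (\<Sum>a | x a \<noteq> 0. \<Sum>b | y b \<noteq> 0. \<Sum>c | z c \<noteq> 0.
      y b * z c * x a * ?L b c a)"
    unfolding expansion_bracket2[OF fr(2,3,1) jacobi(4)] by (rule sum_rotate[symmetric])
  show ?case
    unfolding expansion_add[OF add_free[OF br[OF fr] br[OF fr(3,1,2)]] br[OF fr(2,3,1)]]
      expansion_add[OF br[OF fr] br[OF fr(3,1,2)]]
      expansion_bracket2[OF fr jacobi(4)] 2 3 sum.distrib[symmetric] e
    by simp
next
  case (compatibility x y z i j)
  note fr = compatibility(1-3) and ij = compatibility(4-6)
  let ?L = "\<lambda>i j a b c. lie_expand (Node i a (Node j b c)) f"
  have half: "expansion f (\<lambda>t. bracket i x (bracket j y z) t + bracket i z (bracket j x y) t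
        + bracket i y (bracket j z x) t) = (\<Sum>a | x a \<noteq> 0. \<Sum>b | y b \<noteq> 0. \<Sum>c | z c \<noteq> 0.
        x a * y b * z c * (?L i j a b c + ?L i j c a b + ?L i j b c a))"
      and half_free: "(\<lambda>t. bracket i x (bracket j y z) t + bracket i z (bracket j x y) t
        + bracket i y (bracket j z x) t) \<in> free_nonassoc n"
    if ij: "i \<ge> 1" "j \<ge> 1" for i j
  proof -
    have br: "bracket i x (bracket j y z) \<in> free_nonassoc n" if "x \<in> free_nonassoc n"
      "y \<in> free_nonassoc n" "z \<in> free_nonassoc n" for x y z :: "ctree \<Rightarrow> 'a"
      using that ij by (intro bracket_free) auto
    have 2: "expansion f (bracket i z (bracket j x y)) =
        (\<Sum>a | x a \<noteq> 0. \<Sum>b | y b \<noteq> 0. \<Sum>c | z c \<noteq> 0.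
        z c * x a * y b * ?L i j c a b)"
      unfolding expansion_bracket2[OF fr(3,1,2) ij(2)] by (rule sum_rotate)
    have 3: "expansion f (bracket i y (bracket j z x)) =
        (\<Sum>a | x a \<noteq> 0. \<Sum>b | y b \<noteq> 0. \<Sum>c | z c \<noteq> 0.
        y b * z c * x a * ?L i j b c a)"
      unfolding expansion_bracket2[OF fr(2,3,1) ij(2)] by (rule sum_rotate[symmetric])
    show "expansion f (\<lambda>t. bracket i x (bracket j y z) t + bracket i z (bracket j x y) t
        + bracket i y (bracket j z x) t) = (\<Sum>a | x a \<noteq> 0. \<Sum>b | y b \<noteq> 0. \<Sum>c | z c \<noteq> 0.
        x a * y b * z c * (?L i j a b c + ?L i j c a b + ?L i j b c a))"
      unfolding expansion_add[OF add_free[OF br[OF fr] br[OF fr(3,1,2)]] br[OF fr(2,3,1)]]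
        expansion_add[OF br[OF fr] br[OF fr(3,1,2)]]
        expansion_bracket2[OF fr ij(2)] 2 3 sum.distrib[symmetric]
      by (simp add: algebra_simps)
    show "(\<lambda>t. bracket i x (bracket j y z) t + bracket i z (bracket j x y) t
        + bracket i y (bracket j z x) t) \<in> free_nonassoc n"
      by (intro add_free br fr)
  qed
  have e: "x a * y b * z c * (?L i j a b c + ?L i j c a b + ?L i j b c a)
      + x a * y b * z c * (?L j i a b c + ?L j i c a b + ?L j i b c a) = 0" for a b c
    unfolding distrib_left[symmetric]
    using lie_expand_rels[OF lie_rels.comp[OF ij(3), of a b c], of f] by (simp add: add.assoc)
  have "expansion f (\<lambda>t. (bracket i x (bracket j y z) t + bracket i z (bracket j x y) t
        + bracket i y (bracket j z x) t) + (bracket j x (bracket i y z) t + bracket j z (bracket i x y) t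
        + bracket j y (bracket i z x) t)) = 0"
    unfolding expansion_add[OF half_free[OF ij(1,2)] half_free[OF ij(2,1)]]
      half[OF ij(1,2)] half[OF ij(2,1)] sum.distrib[symmetric] e by simp
  then show ?case by (simp add: add.assoc)
next
  case zero
  show ?case by (simp add: expansion_def)
next
  case (add u v)
  show ?case
    unfolding expansion_add[OF lie_ideal_free[OF add.hyps(1)] lie_ideal_free[OF add.hyps(2)]]
    by (simp add: add.IH)
next
  case (smult u a)
  show ?case
    unfolding expansion_smult[OF lie_ideal_free[OF smult.hyps]] by (simp add: smult.IH)
next
  case (bracket_left x u j)
  show ?case
    unfolding expansion_bracket_right[OF bracket_left.hyps(1) lie_ideal_free[OF bracket_left.hyps(2)]]
    by (simp add: bracket_left.IH lie_expand_zero)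
next
  case (bracket_right u x j)
  show ?case
    unfolding expansion_bracket_left[OF lie_ideal_free[OF bracket_right.hyps(1)] bracket_right.hyps(2)]
    by (simp add: bracket_right.IH lie_expand_zero)
qed

section \<open>Tree relations in the ideal\<close>

lemma bracketed_free:
  "set (leaves t) \<subseteq> {1..n} \<Longrightarrow> set (colors t)
      \<subseteq> {1..} \<Longrightarrow> bracketed t \<in> free_nonassoc n"
  by (auto simp: free_nonassoc_def bracketed_eq)

lemma bracket_sum_list_left:
  "bracket j (\<lambda>s. \<Sum>t\<leftarrow>R. f t s) g =
      (\<lambda>s. \<Sum>t\<leftarrow>R. bracket j (f t) g s)"
proof
  show "bracket j (\<lambda>s. \<Sum>t\<leftarrow>R. f t s) g s =
      (\<Sum>t\<leftarrow>R. bracket j (f t) g s)" for s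
    by (cases s) (auto simp: sum_list_mult_const)
qed

lemma bracket_sum_list_right:
  "bracket j g (\<lambda>s. \<Sum>t\<leftarrow>R. f t s) =
      (\<lambda>s. \<Sum>t\<leftarrow>R. bracket j g (f t) s)"
proof
  show "bracket j g (\<lambda>s. \<Sum>t\<leftarrow>R. f t s) s =
      (\<Sum>t\<leftarrow>R. bracket j g (f t) s)" for s
    by (cases s) (auto simp: sum_list_const_mult)
qed

lemma bracketed_ctx_lie_ideal:
  assumes "ctx K" "R \<noteq> []" "\<And>t. t \<in> set R \<Longrightarrow>
      K (G t) \<in> labeled_trees_of_type n \<mu>"
    "(\<lambda>s. \<Sum>t\<leftarrow>R. bracketed (G t) s :: 'a::field) \<in> lie_ideal n"
  shows "(\<lambda>s. \<Sum>t\<leftarrow>R. bracketed (K (G t)) s :: 'a) \<in> lie_ideal n"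
  using assms
proof (induction arbitrary: G)
  case hole
  then show ?case by simp
next
  case (left K j r)
  \<comment> \<open>Any one tree of the list shows that the labels of \<open>r\<close> and the color
    \<open>j\<close> are admissible, so that bracketing with \<open>r\<close> stays in the ideal;
    hence the list must be nonempty.\<close>
  have "K (Node j (G (hd R)) r) \<in> labeled_trees_of_type n \<mu>" using left.prems by simp
  note sub = ctx_labeled_sub[OF left.hyps this]
  have "(bracketed r :: ctree \<Rightarrow> 'a) \<in> free_nonassoc n" "j \<ge> 1"
    using sub by (auto intro!: bracketed_free)
  then have "bracket j (\<lambda>s. \<Sum>t\<leftarrow>R. bracketed (G t) s :: 'a) (bracketed r)
      \<in> lie_ideal n"
    using left.prems(3) by (intro lie_ideal.bracket_right)
  then have "(\<lambda>s. \<Sum>t\<leftarrow>R. bracketed (Node j (G t) r) s :: 'a) \<in> lie_ideal n"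
    by (simp add: bracket_sum_list_left)
  from left.IH[OF left.prems(1) _ this] left.prems(2) show ?case by simp
next
  case (right K j l)
  have "K (Node j l (G (hd R))) \<in> labeled_trees_of_type n \<mu>" using right.prems by simp
  note sub = ctx_labeled_sub[OF right.hyps this]
  have "(bracketed l :: ctree \<Rightarrow> 'a) \<in> free_nonassoc n" "j \<ge> 1"
    using sub by (auto intro!: bracketed_free)
  then have "bracket j (bracketed l) (\<lambda>s. \<Sum>t\<leftarrow>R. bracketed (G t) s :: 'a)
      \<in> lie_ideal n"
    using right.prems(3) by (intro lie_ideal.bracket_left)
  then have "(\<lambda>s. \<Sum>t\<leftarrow>R. bracketed (Node j l (G t)) s :: 'a) \<in> lie_ideal n"
    by (simp add: bracket_sum_list_right)
  from right.IH[OF right.prems(1) _ this] right.prems(2) show ?case by simp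
qed

lemma bracketed_rel_lie_ideal:
  assumes "R \<in> lie_rels" "\<And>t. t \<in> set R \<Longrightarrow>
      set (leaves t) \<subseteq> {1..n} \<and> set (colors t) \<subseteq> {1..}"
  shows "(\<lambda>s. \<Sum>t\<leftarrow>R. bracketed t s :: 'a::field) \<in> lie_ideal n"
  using assms(1)
proof cases
  case (anti j x y)
  have "(bracketed x :: ctree \<Rightarrow> 'a) \<in> free_nonassoc n"
      "(bracketed y :: ctree \<Rightarrow> 'a) \<in> free_nonassoc n" "j \<ge> 1"
    using assms(2)[of "Node j x y"] anti by (auto intro!: bracketed_free)
  from lie_ideal.antisymmetry[OF this] show ?thesis using anti by simp
next
  case (jac j x y z)
  have "(bracketed x :: ctree \<Rightarrow> 'a) \<in> free_nonassoc n"
      "(bracketed y :: ctree \<Rightarrow> 'a) \<in> free_nonassoc n"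
      "(bracketed z :: ctree \<Rightarrow> 'a) \<in> free_nonassoc n" "j \<ge> 1"
    using assms(2)[of "Node j x (Node j y z)"] jac by (auto intro!: bracketed_free)
  from lie_ideal.jacobi[OF this] show ?thesis using jac by (simp add: add.assoc)
next
  case (comp i j x y z)
  have "(bracketed x :: ctree \<Rightarrow> 'a) \<in> free_nonassoc n"
      "(bracketed y :: ctree \<Rightarrow> 'a) \<in> free_nonassoc n"
      "(bracketed z :: ctree \<Rightarrow> 'a) \<in> free_nonassoc n"
    "i \<ge> 1" "j \<ge> 1"
    using assms(2)[of "Node i x (Node j y z)"] comp by (auto intro!: bracketed_free)
  from lie_ideal.compatibility[OF this comp(2)] show ?thesis using comp by (simp add: add.assoc)
qed

interpretation free_lie: function_quotient "free_nonassoc n" "lie_ideal n" for n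
  by unfold_locales
    (auto intro: add_free smult_free zero_free lie_ideal_free lie_ideal.zero lie_ideal.add
      lie_ideal.smult)

lemma lie_class_eq: "lie_class n t = free_lie.coset n (bracketed t)"
  by (simp add: lie_class_def free_lie.coset_def)

lemma supp_bounded: "\<mu> \<in> wcomp m \<Longrightarrow> \<exists>b. supp \<mu> \<subseteq> {..b}"
  using finite_nat_iff_bounded_le[of "supp \<mu>"] by (simp add: wcomp_def)

theorem basis_Lie:
  assumes "\<mu> \<in> wcomp (n - 1)"
  shows "vectorspace.basis class_ring (Lie n \<mu> :: ('a::field, (ctree \<Rightarrow> 'a) set) module)
    (lie_class n ` Comb n \<mu>)"
proof -
  let ?T = "labeled_trees_of_type n \<mu>"
  let ?b = "bracketed :: ctree \<Rightarrow> ctree \<Rightarrow> 'a"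
  obtain m where m: "supp \<mu> \<subseteq> {..m}" using supp_bounded[OF assms] by blast
  have free: "?b t \<in> free_nonassoc n" if "t \<in> ?T" for t
    using that by (intro bracketed_free) (auto simp: labeled_trees_of_type_def labeled_trees_def)
  have CT: "Comb n \<mu> \<subseteq> ?T" by (auto simp: Comb_def)
  have img: "lie_class n ` S = (\<lambda>t. free_lie.coset n (?b t)) ` S" for S
    by (simp add: lie_class_eq)
  have span: "free_lie.coset n (?b t) \<in> free_lie.span n ((\<lambda>t. free_lie.coset n (?b t))
      ` Comb n \<mu>)"
    if "t \<in> ?T" for t
  proof (rule free_lie.straighten_span[OF free m _ that])
    fix R K assume R: "R \<in> lie_rels" "ctx K" "\<And>t. t \<in> set R \<Longrightarrow> K t \<in> ?T"
    have "R \<noteq> []" using R(1) by cases auto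
    moreover have "set (leaves t) \<subseteq> {1..n} \<and>
        set (colors t) \<subseteq> {1..}" if "t \<in> set R" for t
      using ctx_labeled_sub[OF R(2) R(3)[OF that]] by simp
    ultimately show "(\<lambda>s. \<Sum>t\<leftarrow>R. ?b (K t) s) \<in> lie_ideal n"
      by (intro bracketed_ctx_lie_ideal[where G = "\<lambda>t. t", OF R(2) _ R(3)]
          bracketed_rel_lie_ideal[OF R(1)]) auto
  qed
  have indpt: "free_lie.lin_indpt n ((\<lambda>t. free_lie.coset n (?b t)) ` Comb n \<mu>)"
  proof (rule free_lie.coset_lin_indpt)
    show "?b t \<in> free_nonassoc n" if "t \<in> Comb n \<mu>" for t using that CT free by auto
    fix J and \<alpha> :: "ctree \<Rightarrow> 'a" and t
    assume J: "finite J" "J \<subseteq> Comb n \<mu>"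
        "(\<lambda>x. \<Sum>t\<in>J. \<alpha> t * ?b t x) \<in> lie_ideal n" "t \<in> J"
    have eq: "(\<Sum>t\<in>J. \<alpha> t * ?b t x) = (if x \<in> J then \<alpha> x else 0)" for x
      using J(1) by (simp add: bracketed_eq if_distrib cong: if_cong)
    have "(\<Sum>c\<in>J. \<alpha> c * lie_expand c f) = 0" for f
    proof -
      have "expansion f (\<lambda>x. \<Sum>t\<in>J. \<alpha> t * ?b t x) =
          (\<Sum>c\<in>J. (\<Sum>t\<in>J. \<alpha> t * ?b t c) * lie_expand c f)"
        by (rule expansion_superset[OF J(1)]) (auto simp: eq split: if_splits)
      then show ?thesis using expansion_lie_ideal[OF J(3)] by (simp add: eq)
    qed
    then show "\<alpha> t = 0" by (rule comb_expansions_independent[OF J(1,2) _ J(4)])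
  qed
  have "vectorspace.basis class_ring
      ((free_lie.V n)\<lparr>carrier := free_lie.span n ((\<lambda>t. free_lie.coset n (?b t)) ` ?T)\<rparr>)
      ((\<lambda>t. free_lie.coset n (?b t)) ` Comb n \<mu>)"
    by (rule free_lie.basis_of_span[OF indpt])
        (use CT free span in \<open>auto intro: free_lie.coset_carrier\<close>)
  then show ?thesis by (simp add: Lie_def free_lie_def img)
qed

section \<open>Merging blocks of weighted partitions\<close>

type_synonym move = "nat \<times> nat set \<times> nat set"

text \<open>A merge is written with the block of smaller minimum first, so that a covering relation
  corresponds to exactly one move.\<close>

definition step_ok :: "nat \<Rightarrow> wpart \<Rightarrow> move \<Rightarrow> bool" where
  "step_ok k \<pi> = (\<lambda>(r, A, B). A \<in> fst ` \<pi> \<and> B \<in> fst ` \<pi> \<and>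
      Min A < Min B \<and> r \<in> {1..k})"

lemma step_okE:
  assumes "step_ok k \<pi> m"
  obtains r A B a b where "m = (r, A, B)" "(A, a) \<in> \<pi>" "(B, b) \<in> \<pi>"
      "Min A < Min B" "r \<in> {1..k}"
  using assms by (cases m) (auto simp: step_ok_def)

lemma step_okI:
  "(A, a) \<in> \<pi> \<Longrightarrow> (B, b) \<in> \<pi> \<Longrightarrow>
      Min A < Min B \<Longrightarrow> r \<in> {1..k} \<Longrightarrow> step_ok k \<pi> (r, A, B)"
  by (force simp: step_ok_def)

lemma in_fst_image: "C \<in> fst ` \<pi> \<longleftrightarrow> (\<exists>c. (C, c) \<in> \<pi>)"
  by force

lemma wpart_blockD:
  assumes "\<pi> \<in> wpartitions n k" "(A, a) \<in> \<pi>"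
  shows "A \<subseteq> {1..n}" "A \<noteq> {}" "finite A" "a \<in> wcomp (card A - 1)"
      "supp a \<subseteq> {1..k}"
proof -
  have "A \<in> fst ` \<pi>" using assms(2) by force
  then show "A \<subseteq> {1..n}" "A \<noteq> {}"
    using assms(1) by (auto simp: wpartitions_def partition_on_def)
  then show "finite A" using finite_subset by blast
  show "a \<in> wcomp (card A - 1)" "supp a \<subseteq> {1..k}"
    using assms by (auto simp: wpartitions_def)
qed

lemma wpart_weight_unique:
  "\<pi> \<in> wpartitions n k \<Longrightarrow> (A, a) \<in> \<pi> \<Longrightarrow>
      (A, b) \<in> \<pi> \<Longrightarrow> a = b"
  using inj_onD[of fst \<pi> "(A, a)" "(A, b)"] by (auto simp: wpartitions_def)

lemma wpart_disjoint:
  assumes "\<pi> \<in> wpartitions n k" "(A, a) \<in> \<pi>" "(B, b) \<in> \<pi>" "A \<noteq> B"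
  shows "A \<inter> B = {}"
proof -
  have "A \<in> fst ` \<pi>" "B \<in> fst ` \<pi>" using assms by force+
  then show ?thesis using assms(1,4)
    by (auto simp: wpartitions_def partition_on_def disjoint_def)
qed

lemma wpart_Min_neq:
  assumes "\<pi> \<in> wpartitions n k" "(A, a) \<in> \<pi>" "(B, b) \<in> \<pi>" "A \<noteq> B"
  shows "Min A \<noteq> Min B"
  using wpart_disjoint[OF assms] wpart_blockD(2,3)[OF assms(1,2)] wpart_blockD(2,3)[OF assms(1,3)]
    Min_in[of A] Min_in[of B] by (metis disjoint_iff)

lemma finite_wpart: "\<pi> \<in> wpartitions n k \<Longrightarrow> finite \<pi>"
  by (auto simp: wpartitions_def intro: finite_imageD[OF finite_elements])

lemma wcomp_iff:
  assumes "supp \<mu> \<subseteq> {1..k}"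
  shows "\<mu> \<in> wcomp m \<longleftrightarrow> (\<Sum>j\<in>{1..k}. \<mu> j) = m"
proof -
  have "finite (supp \<mu>)" using assms finite_subset by blast
  moreover have "\<mu> 0 = 0" using assms by (auto simp: supp_def)
  moreover have "(\<Sum>j\<in>supp \<mu>. \<mu> j) = (\<Sum>j\<in>{1..k}. \<mu> j)"
    by (rule sum.mono_neutral_left) (use assms in \<open>auto simp: supp_def\<close>)
  ultimately show ?thesis by (simp add: wcomp_def)
qed

lemma merged_weight_commute: "merged_weight a b r = merged_weight b a r"
  by (auto simp: merged_weight_def)

lemma merge_eq:
  assumes "\<pi> \<in> wpartitions n k" "(A, a) \<in> \<pi>" "(B, b) \<in> \<pi>"
  shows "merge (r, A, B) \<pi> = \<pi> - {(A, a), (B, b)} \<union> {(A \<union> B, merged_weight a b r)}"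
proof -
  have *: "(A, x) \<in> \<pi> \<longleftrightarrow> x = a"
      "(B, y) \<in> \<pi> \<longleftrightarrow> y = b" for x y
    using wpart_weight_unique[OF assms(1)] assms(2,3) by blast+
  have "{p \<in> \<pi>. fst p \<noteq> A \<and> fst p \<noteq> B} = \<pi> - {(A, a), (B, b)}"
    using * by auto
  then show ?thesis by (simp add: merge_def *)
qed

lemma merge_commute: "merge (r, A, B) = merge (r, B, A)"
  by (rule ext) (auto simp: merge_def Un_commute merged_weight_commute)

lemma merge_wpart:
  assumes \<pi>: "\<pi> \<in> wpartitions n k" and A: "(A, a) \<in> \<pi>"
      and B: "(B, b) \<in> \<pi>" and AB: "A \<noteq> B"
    and r: "r \<in> {1..k}"
  shows "merge (r, A, B) \<pi> \<in> wpartitions n k" "wcovers n k \<pi> (merge (r, A, B) \<pi>)"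
    "card \<pi> = Suc (card (merge (r, A, B) \<pi>))"
proof -
  let ?p = "(A \<union> B, merged_weight a b r)" and ?\<pi> = "merge (r, A, B) \<pi>"
  note eq = merge_eq[OF \<pi> A B, of r]
  note dA = wpart_blockD[OF \<pi> A] and dB = wpart_blockD[OF \<pi> B]
  have disj: "A \<inter> B = {}" by (rule wpart_disjoint[OF \<pi> A B AB])
  have rest: "C \<inter> (A \<union> B) = {} \<and>
      C \<noteq> A \<union> B" if "(C, c) \<in> \<pi>" "(C, c) \<noteq> (A, a)"
      "(C, c) \<noteq> (B, b)" for C c
  proof -
    have "C \<noteq> A" "C \<noteq> B" using that wpart_weight_unique[OF \<pi>] A B by auto
    then have "C \<inter> A = {}" "C \<inter> B = {}" using wpart_disjoint[OF \<pi> that(1)] A B by auto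
    then show ?thesis using wpart_blockD(2)[OF \<pi> that(1)] by auto
  qed
  have inj: "inj_on fst \<pi>" and part: "partition_on {1..n} (fst ` \<pi>)"
      using \<pi> by (auto simp: wpartitions_def)
  have "?p \<notin> \<pi>"
  proof
    assume "?p \<in> \<pi>"
    with rest[OF this] have "A \<union> B = A \<or> A \<union> B = B" by auto
    then show False using disj dA(2) dB(2) by auto
  qed
  then have "card ?\<pi> = Suc (card (\<pi> - {(A, a), (B, b)}))"
    unfolding eq using finite_wpart[OF \<pi>] by simp
  moreover have "card (\<pi> - {(A, a), (B, b)}) = card \<pi> - 2"
    using A B AB finite_wpart[OF \<pi>] by (subst card_Diff_subset) auto
  moreover have "card {(A, a), (B, b)} \<le> card \<pi>"
    using A B finite_wpart[OF \<pi>] by (intro card_mono) auto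
  ultimately show "card \<pi> = Suc (card ?\<pi>)" using AB by simp
  have weight: "merged_weight a b r \<in> wcomp (card (A \<union> B) - 1) \<and>
      supp (merged_weight a b r) \<subseteq> {1..k}"
  proof -
    have s: "supp (merged_weight a b r) \<subseteq> {1..k}"
      using dA(5) dB(5) r by (auto simp: supp_def merged_weight_def split: if_splits)
    have "(\<Sum>j\<in>{1..k}. merged_weight a b r j) = (\<Sum>j\<in>{1..k}. a j) +
        (\<Sum>j\<in>{1..k}. b j) + 1"
      using r by (simp add: merged_weight_def sum.distrib)
    also have "\<dots> = (card A - 1) + (card B - 1) + 1"
      using dA(4) dB(4) wcomp_iff[OF dA(5)] wcomp_iff[OF dB(5)] by simp
    also have "\<dots> = card (A \<union> B) - 1"
    proof -
      have "card A > 0" "card B > 0" using dA dB by (auto simp: card_gt_0_iff)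
      then show ?thesis using disj dA(3) dB(3) by (simp add: card_Un_disjoint)
    qed
    finally show ?thesis using s wcomp_iff[OF s] by simp
  qed
  have fsts: "fst ` ?\<pi> = (fst ` \<pi> - {A, B}) \<union> {A \<union> B}"
  proof -
    have "fst ` (\<pi> - {(A, a), (B, b)}) = fst ` \<pi> - {A, B}"
    proof (intro equalityI subsetI)
      fix C assume "C \<in> fst ` \<pi> - {A, B}"
      then obtain c where "(C, c) \<in> \<pi>" "C \<noteq> A" "C \<noteq> B"
          unfolding Diff_iff in_fst_image by blast
      then show "C \<in> fst ` (\<pi> - {(A, a), (B, b)})" by (intro image_eqI[of _ _ "(C, c)"]) auto
    qed (use wpart_weight_unique[OF \<pi>] A B in auto)
    then show ?thesis by (simp add: eq)
  qed
  have AB_in: "A \<in> fst ` \<pi>" "B \<in> fst ` \<pi>" using A B by force+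
  have "partition_on {1..n} (fst ` ?\<pi>)"
  proof (rule partition_onI)
    have "\<Union> (fst ` \<pi>) = {1..n}" using part by (simp add: partition_on_def)
    then show "\<Union> (fst ` ?\<pi>) = {1..n}"
      unfolding fsts using AB_in by auto
    show "{} \<notin> fst ` ?\<pi>" unfolding fsts using part dA(2) by (auto simp: partition_on_def)
    fix p q assume pq: "p \<in> fst ` ?\<pi>" "q \<in> fst ` ?\<pi>" "p \<noteq> q"
    have d: "disjnt p q" if "p \<in> fst ` \<pi>" "q \<in> fst ` \<pi>" "p \<noteq> q" for p q
      using part that by (auto simp: partition_on_def disjoint_def disjnt_def)
    have dAB: "disjnt p (A \<union> B)" if "p \<in> fst ` \<pi> - {A, B}" for p
      unfolding disjnt_Un2 using that d[OF _ AB_in(1)] d[OF _ AB_in(2)] by blast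
    consider "p \<in> fst ` \<pi> - {A, B}" "q \<in> fst ` \<pi> - {A, B}"
      | "p \<in> fst ` \<pi> - {A, B}" "q = A \<union> B" | "p = A \<union> B" "q \<in> fst ` \<pi> - {A, B}"
      using pq unfolding fsts by blast
    then show "disjnt p q"
    proof cases
      case 1
      then show ?thesis using pq(3) d by simp
    next
      case 2
      then show ?thesis using dAB by simp
    next
      case 3
      then show ?thesis using disjnt_sym[OF dAB] by simp
    qed
  qed
  moreover have "inj_on fst ?\<pi>"
  proof -
    have "inj_on fst (\<pi> - {(A, a), (B, b)})" using inj by (rule inj_on_subset) auto
    moreover have "A \<union> B \<notin> fst ` (\<pi> - {(A, a), (B, b)})"
    proof
      assume "A \<union> B \<in> fst ` (\<pi> - {(A, a), (B, b)})"
      then obtain c where "(A \<union> B, c) \<in> \<pi> - {(A, a), (B, b)}" unfolding in_fst_image by blast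
      then show False using rest[of "A \<union> B" c] by auto
    qed
    ultimately show ?thesis unfolding eq by (simp add: image_iff)
  qed
  moreover have "\<forall>(C, c)\<in>?\<pi>. c \<in> wcomp (card C - 1) \<and> supp c \<subseteq> {1..k}"
    using \<pi> weight unfolding eq by (auto simp: wpartitions_def)
  ultimately show in_P: "?\<pi> \<in> wpartitions n k" by (simp add: wpartitions_def)
  show "wcovers n k \<pi> ?\<pi>"
    unfolding wcovers_def using \<pi> in_P A B AB r eq by blast
qed

lemma step_ok_merge:
  assumes "\<pi> \<in> wpartitions n k" "step_ok k \<pi> m"
  shows "merge m \<pi> \<in> wpartitions n k" "wcovers n k \<pi> (merge m \<pi>)"
      "card \<pi> = Suc (card (merge m \<pi>))"
proof -
  obtain r A B a b where m: "m = (r, A, B)" "(A, a) \<in> \<pi>" "(B, b) \<in> \<pi>"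
      "Min A < Min B" "r \<in> {1..k}"
    using step_okE[OF assms(2)] by metis
  then have "A \<noteq> B" by auto
  then show "merge m \<pi> \<in> wpartitions n k" "wcovers n k \<pi> (merge m \<pi>)"
      "card \<pi> = Suc (card (merge m \<pi>))"
    using merge_wpart[OF assms(1) m(2,3) _ m(5)] m(1) by auto
qed

lemma wcovers_step:
  assumes "wcovers n k \<pi> \<pi>'"
  shows "\<exists>m. step_ok k \<pi> m \<and> \<pi>' = merge m \<pi>"
proof -
  obtain A a B b r where \<pi>: "\<pi> \<in> wpartitions n k" and *: "(A, a) \<in> \<pi>"
      "(B, b) \<in> \<pi>" "A \<noteq> B" "r \<in> {1..k}"
      "\<pi>' = \<pi> - {(A, a), (B, b)} \<union> {(A \<union> B, merged_weight a b r)}"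
    using assms unfolding wcovers_def by blast
  then have eq: "\<pi>' = merge (r, A, B) \<pi>" using merge_eq[OF \<pi> *(1,2)] by simp
  consider "Min A < Min B" | "Min B < Min A" using wpart_Min_neq[OF \<pi> *(1,2,3)] by linarith
  then show ?thesis
  proof cases
    case 1
    then show ?thesis using step_okI[OF *(1,2) 1 *(4)] eq by blast
  next
    case 2
    then show ?thesis using step_okI[OF *(2,1) 2 *(4)] eq merge_commute by metis
  qed
qed

lemma merge_blocks:
  assumes "\<pi> \<in> wpartitions n k" "(A, a) \<in> \<pi>" "(B, b) \<in> \<pi>"
  shows "fst ` merge (r, A, B) \<pi> = fst ` \<pi> - {A, B} \<union> {A \<union> B}"
proof (intro Set.set_eqI)
  fix C
  have *: "(A, x) \<in> \<pi> \<longleftrightarrow> x = a"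
      "(B, y) \<in> \<pi> \<longleftrightarrow> y = b" for x y
    using wpart_weight_unique[OF assms(1)] assms(2,3) by blast+
  show "C \<in> fst ` merge (r, A, B) \<pi> \<longleftrightarrow>
      C \<in> fst ` \<pi> - {A, B} \<union> {A \<union> B}"
    unfolding merge_eq[OF assms] in_fst_image Diff_iff Un_iff by (auto simp: *)
qed

lemma mem_merge:
  assumes "\<pi> \<in> wpartitions n k" "(A, a) \<in> \<pi>" "(B, b) \<in> \<pi>"
  shows "p \<in> merge (r, A, B) \<pi> \<longleftrightarrow>
    p \<in> \<pi> \<and> fst p \<noteq> A \<and> fst p \<noteq> B \<or>
        p = (A \<union> B, merged_weight a b r)"
proof -
  have *: "(A, x) \<in> \<pi> \<longleftrightarrow> x = a"
      "(B, y) \<in> \<pi> \<longleftrightarrow> y = b" for x y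
    using wpart_weight_unique[OF assms(1)] assms(2,3) by blast+
  show ?thesis unfolding merge_eq[OF assms] by (cases p) (auto simp: *)
qed

lemma wpart_sub_eq:
  assumes "\<pi> \<in> wpartitions n k" "(A, a) \<in> \<pi>" "(B, b) \<in> \<pi>" "A \<subseteq> B"
  shows "A = B"
  using wpart_disjoint[OF assms(1-3)] wpart_blockD(2)[OF assms(1,2)] assms(4) by blast

lemma wpart_Un_notin:
  assumes "\<pi> \<in> wpartitions n k" "(A, a) \<in> \<pi>" "(B, b) \<in> \<pi>" "A \<noteq> B"
  shows "(A \<union> B, c) \<notin> \<pi>"
proof
  assume "(A \<union> B, c) \<in> \<pi>"
  then have "A = A \<union> B" "B = A \<union> B"
    using wpart_sub_eq[OF assms(1,2)] wpart_sub_eq[OF assms(1,3)] by blast+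
  then show False using assms(4) by blast
qed

lemma merged_weight_inj: "merged_weight a b r = merged_weight a b s \<Longrightarrow> r = s"
  by (drule fun_cong[of _ _ r]) (auto simp: merged_weight_def split: if_splits)

lemma Min_Un_less:
  fixes A B :: "nat set"
  assumes "finite A" "A \<noteq> {}" "finite B" "B \<noteq> {}" "Min A < Min B"
  shows "Min (A \<union> B) = Min A"
  using assms by (simp add: Min_Un)

section \<open>Intervals of length two\<close>

definition pairs :: "nat \<Rightarrow> wpart \<Rightarrow> wpart \<Rightarrow> (move \<times> move) set" where
  "pairs k \<pi> \<pi>'' =
     {(p, q). step_ok k \<pi> p \<and> step_ok k (merge p \<pi>) q \<and> merge q (merge p \<pi>) = \<pi>''}"

lemma step_blocks_disappear:
  assumes \<pi>: "\<pi> \<in> wpartitions n k" and ok: "step_ok k \<pi> (r, A, B)"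
  shows "A \<notin> fst ` merge (r, A, B) \<pi>" "B \<notin> fst ` merge (r, A, B) \<pi>"
proof -
  obtain a b where ab: "(A, a) \<in> \<pi>" "(B, b) \<in> \<pi>" "Min A < Min B"
    using ok by (auto elim: step_okE)
  then have "A \<noteq> B" by auto
  then have "A \<noteq> A \<union> B" "B \<noteq> A \<union> B"
    using wpart_disjoint[OF \<pi> ab(1,2)] wpart_blockD(2)[OF \<pi> ab(1)]
        wpart_blockD(2)[OF \<pi> ab(2)] by blast+
  then show "A \<notin> fst ` merge (r, A, B) \<pi>" "B \<notin> fst ` merge (r, A, B) \<pi>"
    unfolding merge_blocks[OF \<pi> ab(1,2)] by blast+
qed

lemma step_block_sub:
  assumes \<pi>: "\<pi> \<in> wpartitions n k" and ok: "step_ok k \<pi> m" and E: "E \<in> fst ` \<pi>"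
  shows "\<exists>Z\<in>fst ` merge m \<pi>. E \<subseteq> Z"
proof -
  obtain r A B a b where m: "m = (r, A, B)" and ab: "(A, a) \<in> \<pi>" "(B, b) \<in> \<pi>"
    using ok by (auto elim: step_okE)
  show ?thesis
  proof (cases "E = A \<or> E = B")
    case True
    then show ?thesis unfolding m merge_blocks[OF \<pi> ab] by (intro bexI[of _ "A \<union> B"]) auto
  next
    case False
    then show ?thesis unfolding m merge_blocks[OF \<pi> ab] using E by (intro bexI[of _ E]) auto
  qed
qed

text \<open>The union of the first two blocks lies in one block of \<open>\<pi>''\<close>, and
  blocks are disjoint, so neither of the two survives. Thus both moves use only blocks lost between
  \<open>\<pi>\<close> and \<open>\<pi>''\<close> and the union just created.\<close>

lemma pairs_blocks:
  assumes \<pi>: "\<pi> \<in> wpartitions n k" and pq: "((r, E, F), (s, G, H)) \<in> pairs k \<pi> \<pi>''"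
  shows "E \<in> fst ` \<pi> - fst ` \<pi>''" "F \<in> fst ` \<pi> - fst ` \<pi>''" "Min E < Min F"
    "\<exists>Z\<in>fst ` \<pi>''. E \<union> F \<subseteq> Z"
    "G \<in> (fst ` \<pi> - {E, F} \<union> {E \<union> F}) - fst ` \<pi>''"
        "H \<in> (fst ` \<pi> - {E, F} \<union> {E \<union> F}) - fst ` \<pi>''"
    "Min G < Min H"
proof -
  let ?\<pi>' = "merge (r, E, F) \<pi>"
  have ok: "step_ok k \<pi> (r, E, F)" "step_ok k ?\<pi>' (s, G, H)"
      and \<pi>'': "\<pi>'' = merge (s, G, H) ?\<pi>'"
    using pq by (auto simp: pairs_def)
  obtain e f where ef: "(E, e) \<in> \<pi>" "(F, f) \<in> \<pi>" using ok(1) by (auto elim: step_okE)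
  have \<pi>': "?\<pi>' \<in> wpartitions n k" by (rule step_ok_merge(1)[OF \<pi> ok(1)])
  have \<pi>''P: "\<pi>'' \<in> wpartitions n k" unfolding \<pi>'' by (rule step_ok_merge(1)[OF \<pi>' ok(2)])
  show mins: "Min E < Min F" "Min G < Min H" using ok by (auto simp: step_ok_def)
  have blocks: "fst ` ?\<pi>' = fst ` \<pi> - {E, F} \<union> {E \<union> F}"
      by (rule merge_blocks[OF \<pi> ef])
  show "G \<in> (fst ` \<pi> - {E, F} \<union> {E \<union> F}) - fst ` \<pi>''"
      "H \<in> (fst ` \<pi> - {E, F} \<union> {E \<union> F}) - fst ` \<pi>''"
    using step_blocks_disappear[OF \<pi>' ok(2)] ok(2) unfolding \<pi>'' blocks[symmetric]
    by (simp_all add: step_ok_def)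
  have "E \<union> F \<in> fst ` ?\<pi>'" unfolding blocks by simp
  then show Z: "\<exists>Z\<in>fst ` \<pi>''. E \<union> F \<subseteq> Z"
    unfolding \<pi>'' by (rule step_block_sub[OF \<pi>' ok(2)])
  then obtain Z z where Z: "(Z, z) \<in> \<pi>''" "E \<union> F \<subseteq> Z" unfolding in_fst_image by auto
  have no: "C \<notin> fst ` \<pi>''" if "C \<subseteq> E \<union> F" "C \<noteq> E \<union> F" for C
  proof
    assume "C \<in> fst ` \<pi>''"
    then obtain c where "(C, c) \<in> \<pi>''" unfolding in_fst_image by blast
    from wpart_sub_eq[OF \<pi>''P this Z(1)] that Z(2) show False by blast
  qed
  have "E \<noteq> F" using mins by auto
  then have "E \<inter> F = {}" "E \<noteq> {}" "F \<noteq> {}"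
    using wpart_disjoint[OF \<pi> ef] wpart_blockD(2)[OF \<pi> ef(1)] wpart_blockD(2)[OF \<pi> ef(2)] by auto
  then have "E \<noteq> E \<union> F" "F \<noteq> E \<union> F" by blast+
  then show "E \<in> fst ` \<pi> - fst ` \<pi>''" "F \<in> fst ` \<pi> - fst ` \<pi>''"
    using no ok(1) by (auto simp: step_ok_def)
qed

definition indep :: "move \<Rightarrow> move \<Rightarrow> bool" where
  "indep = (\<lambda>(r, A, B) (s, C, D). (A \<union> B) \<inter> (C \<union> D) = {})"

lemma step_ok_indep:
  assumes \<pi>: "\<pi> \<in> wpartitions n k" and m: "step_ok k \<pi> m" "step_ok k \<pi> m'" "indep m m'"
  shows "step_ok k (merge m \<pi>) m'" "merge m' (merge m \<pi>) = merge m (merge m' \<pi>)"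
proof -
  obtain r A B a b where mm: "m = (r, A, B)" and ab: "(A, a) \<in> \<pi>" "(B, b) \<in> \<pi>"
    using m(1) by (auto elim: step_okE)
  obtain s C D c d where mm': "m' = (s, C, D)" and cd: "(C, c) \<in> \<pi>" "(D, d) \<in> \<pi>"
      "Min C < Min D" "s \<in> {1..k}"
    using m(2) by (auto elim: step_okE)
  note ne = wpart_blockD(2)[OF \<pi> ab(1)] wpart_blockD(2)[OF \<pi> ab(2)] wpart_blockD(2)[OF \<pi> cd(1)]
    wpart_blockD(2)[OF \<pi> cd(2)]
  have dis: "(A \<union> B) \<inter> (C \<union> D) = {}" using m(3) by (simp add: indep_def mm mm')
  have neq: "C \<noteq> A" "C \<noteq> B" "D \<noteq> A" "D \<noteq> B" "A \<union> B \<noteq> C"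
      "A \<union> B \<noteq> D" "C \<union> D \<noteq> A" "C \<union> D \<noteq> B"
    using dis ne by blast+
  have P: "merge m \<pi> \<in> wpartitions n k" "merge m' \<pi> \<in> wpartitions n k"
    using step_ok_merge(1)[OF \<pi>] m by auto
  have cd': "(C, c) \<in> merge m \<pi>" "(D, d) \<in> merge m \<pi>"
    unfolding mm mem_merge[OF \<pi> ab] using cd neq by simp_all
  have ab': "(A, a) \<in> merge m' \<pi>" "(B, b) \<in> merge m' \<pi>"
    unfolding mm' mem_merge[OF \<pi> cd(1,2)] using ab neq by (simp_all add: neq[symmetric])
  show "step_ok k (merge m \<pi>) m'" unfolding mm' using cd' cd(3,4) by (rule step_okI)
  show "merge m' (merge m \<pi>) = merge m (merge m' \<pi>)"
  proof (rule Set.set_eqI)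
    fix p :: "nat set \<times> (nat \<Rightarrow> nat)"
    have "p \<in> merge m' (merge m \<pi>) \<longleftrightarrow>
        p \<in> merge m \<pi> \<and> fst p \<noteq> C \<and> fst p \<noteq> D \<or>
            p = (C \<union> D, merged_weight c d s)"
      unfolding mm' by (rule mem_merge[OF P(1) cd'])
    moreover have "p \<in> merge m (merge m' \<pi>) \<longleftrightarrow>
        p \<in> merge m' \<pi> \<and> fst p \<noteq> A \<and> fst p \<noteq> B \<or>
            p = (A \<union> B, merged_weight a b r)"
      unfolding mm by (rule mem_merge[OF P(2) ab'])
    ultimately show "p \<in> merge m' (merge m \<pi>) \<longleftrightarrow> p \<in> merge m (merge m' \<pi>)"
      unfolding mm mm' mem_merge[OF \<pi> ab] mem_merge[OF \<pi> cd(1,2)]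
      by (cases "p = (A \<union> B, merged_weight a b r)"; cases "p = (C \<union> D, merged_weight c d s)")
        (simp_all add: neq, blast?)
  qed
qed

lemma indep_sym: "indep m m' = indep m' m"
  by (auto simp: indep_def split: prod.splits)

text \<open>Only the four blocks of \<open>m\<close> and \<open>m'\<close> are lost. A first move
  that took one block from each would put parts of both unions into a single final block, which is
  impossible; so the moves use the same blocks, and the final weights determine their
  colors.\<close>

lemma pairs_indep:
  assumes \<pi>: "\<pi> \<in> wpartitions n k" and m: "step_ok k \<pi> m" "step_ok k \<pi> m'" "indep m m'"
  shows "pairs k \<pi> (merge m' (merge m \<pi>)) = {(m, m'), (m', m)}"
proof (intro equalityI subsetI)
  fix pq assume "pq \<in> {(m, m'), (m', m)}"
  then show "pq \<in> pairs k \<pi> (merge m' (merge m \<pi>))"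
    using step_ok_indep[OF \<pi> m] step_ok_indep(1)[OF \<pi> m(2,1)] m indep_sym[of m m']
        by (auto simp: pairs_def)
next
  let ?\<pi>'' = "merge m' (merge m \<pi>)"
  fix pq assume pq: "pq \<in> pairs k \<pi> ?\<pi>''"
  obtain r' E F s' G H where eq: "pq = ((r', E, F), (s', G, H))" by (cases pq) auto
  obtain r A B a b where mm: "m = (r, A, B)" and ab: "(A, a) \<in> \<pi>" "(B, b) \<in> \<pi>" "Min A < Min B"
    using m(1) by (auto elim: step_okE)
  obtain s C D c d where mm': "m' = (s, C, D)" and cd: "(C, c) \<in> \<pi>" "(D, d) \<in> \<pi>"
      "Min C < Min D"
    using m(2) by (auto elim: step_okE)
  note ne = wpart_blockD(2)[OF \<pi> ab(1)] wpart_blockD(2)[OF \<pi> ab(2)] wpart_blockD(2)[OF \<pi> cd(1)]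
    wpart_blockD(2)[OF \<pi> cd(2)]
  have dis: "(A \<union> B) \<inter> (C \<union> D) = {}" using m(3) by (simp add: indep_def mm mm')
  have P': "merge m \<pi> \<in> wpartitions n k" using step_ok_merge(1)[OF \<pi> m(1)] .
  have P'': "?\<pi>'' \<in> wpartitions n k"
    by (rule step_ok_merge(1)[OF P' step_ok_indep(1)[OF \<pi> m]])
  have neq: "C \<noteq> A" "C \<noteq> B" "D \<noteq> A" "D \<noteq> B" "A \<union> B \<noteq> C"
      "A \<union> B \<noteq> D"
    using dis ne by blast+
  have cd': "(C, c) \<in> merge m \<pi>" "(D, d) \<in> merge m \<pi>"
    unfolding mm mem_merge[OF \<pi> ab(1,2)] using cd neq by simp_all
  have mem'': "p \<in> ?\<pi>'' \<longleftrightarrow> p \<in> \<pi> \<and>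
      fst p \<notin> {A, B, C, D} \<or> p = (A \<union> B, merged_weight a b r)
      \<or> p = (C \<union> D, merged_weight c d s)" for p
  proof -
    have "p \<in> ?\<pi>'' \<longleftrightarrow> p \<in> merge m \<pi> \<and>
        fst p \<noteq> C \<and> fst p \<noteq> D \<or> p = (C \<union> D, merged_weight c d s)"
      unfolding mm' by (rule mem_merge[OF P' cd'])
    then show ?thesis unfolding mm mem_merge[OF \<pi> ab(1,2)]
      by (cases "p = (A \<union> B, merged_weight a b r)"; cases "p = (C \<union> D, merged_weight c d s)")
        (simp_all add: neq, blast?)
  qed
  have gone: "X \<in> {A, B, C, D}" if X: "X \<in> fst ` \<pi> - fst ` ?\<pi>''" for X
  proof -
    obtain x where "(X, x) \<in> \<pi>" "(X, x) \<notin> ?\<pi>''" using X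
        unfolding Diff_iff in_fst_image by blast
    then show ?thesis unfolding mem'' by auto
  qed
  have uni: "X = Y" if "X \<in> fst ` ?\<pi>''" "Y \<in> fst ` ?\<pi>''" "X \<inter> Y \<noteq> {}" for X Y
    using that wpart_disjoint[OF P''] unfolding in_fst_image by blast
  have new: "A \<union> B \<in> fst ` ?\<pi>''" "C \<union> D \<in> fst ` ?\<pi>''"
    unfolding in_fst_image mem'' by auto
  note pb = pairs_blocks[OF \<pi> pq[unfolded eq]]
  obtain Z where Z: "Z \<in> fst ` ?\<pi>''" "E \<union> F \<subseteq> Z" using pb(4) by blast
  have colors: "r' \<in> {1..k}" "s' \<in> {1..k}" "step_ok k \<pi> (r', E, F)"
     "step_ok k (merge (r', E, F) \<pi>) (s', G, H)" "merge (s', G, H) (merge (r', E, F) \<pi>) = ?\<pi>''"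
    using pq unfolding eq pairs_def by (auto simp: step_ok_def)
  have EF: "E \<in> {A, B, C, D}" "F \<in> {A, B, C, D}" using gone pb(1,2) by blast+
  have *: "{E, F} \<subseteq> {A, B} \<or> {E, F} \<subseteq> {C, D}"
  proof (rule ccontr)
    assume "\<not> ?thesis"
    then obtain X Y where XY: "X \<in> {E, F}" "Y \<in> {E, F}" "X \<in> {A, B}"
        "Y \<in> {C, D}" using EF by blast
    then have "X \<noteq> {}" "Y \<noteq> {}" "X \<subseteq> Z" "Y \<subseteq> Z"
        "X \<subseteq> A \<union> B" "Y \<subseteq> C \<union> D" using ne Z(2) by blast+
    then have "Z = A \<union> B" "Z = C \<union> D" using uni[OF Z(1) new(1)] uni[OF Z(1) new(2)] by blast+
    then show False using dis ne by blast
  qed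
  have eqs: "p = A \<and> q = B" if "p \<in> {A, B}" "q \<in> {A, B}" "Min p < Min q" for p q
    using that ab(3) by auto
  have eqs': "p = C \<and> q = D" if "p \<in> {C, D}" "q \<in> {C, D}" "Min p < Min q" for p q
    using that cd(3) by auto
  have G1: "X \<in> {A, B, C, D} - {E, F} \<union> {E \<union> F}"
      "X \<notin> fst ` ?\<pi>''" if "X = G \<or> X = H" for X
  proof -
    have X: "X \<in> (fst ` \<pi> - {E, F} \<union> {E \<union> F}) - fst ` ?\<pi>''"
        using pb(5,6) that by auto
    then show "X \<notin> fst ` ?\<pi>''" by simp
    show "X \<in> {A, B, C, D} - {E, F} \<union> {E \<union> F}" using X gone[of X] by blast
  qed
  have wu: "w = w'" if "(X, w) \<in> ?\<pi>''" "(X, w') \<in> ?\<pi>''" for X w w'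
    using wpart_weight_unique[OF P''] that by blast
  have new': "(A \<union> B, merged_weight a b r) \<in> ?\<pi>''"
      "(C \<union> D, merged_weight c d s) \<in> ?\<pi>''"
    unfolding mem'' by auto
  show "pq \<in> {(m, m'), (m', m)}"
    using *
  proof
    assume "{E, F} \<subseteq> {A, B}"
    then have E: "E = A" "F = B" using eqs[of E F] pb(3) by auto
    then have "G \<in> {C, D}" "H \<in> {C, D}" using G1[of G] G1[of H] new E by auto
    from eqs'[OF this pb(7)] have G: "G = C" "H = D" by simp_all
    have P1: "merge (r', E, F) \<pi> \<in> wpartitions n k" by (rule step_ok_merge(1)[OF \<pi> colors(3)])
    have c1: "(C, c) \<in> merge (r', E, F) \<pi>" "(D, d) \<in> merge (r', E, F) \<pi>"
        "(A \<union> B, merged_weight a b r') \<in> merge (r', E, F) \<pi>"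
      unfolding E mem_merge[OF \<pi> ab(1,2)] using cd neq by simp_all
    have "(A \<union> B, merged_weight a b r') \<in> ?\<pi>''"
        "(C \<union> D, merged_weight c d s') \<in> ?\<pi>''"
      unfolding colors(5)[symmetric] G mem_merge[OF P1 c1(1,2)] using c1(3) neq by simp_all
    then have "r' = r" "s' = s"
      using wu[OF new'(1)] wu[OF new'(2)] merged_weight_inj by metis+
    then show ?thesis by (simp add: eq mm mm' E G)
  next
    assume "{E, F} \<subseteq> {C, D}"
    then have E: "E = C" "F = D" using eqs'[of E F] pb(3) by auto
    then have "G \<in> {A, B}" "H \<in> {A, B}" using G1[of G] G1[of H] new E by auto
    from eqs[OF this pb(7)] have G: "G = A" "H = B" by simp_all
    have P1: "merge (r', E, F) \<pi> \<in> wpartitions n k" by (rule step_ok_merge(1)[OF \<pi> colors(3)])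
    have neq': "A \<noteq> C" "A \<noteq> D" "B \<noteq> C" "B \<noteq> D"
        "C \<union> D \<noteq> A" "C \<union> D \<noteq> B" using dis ne by blast+
    have c1: "(A, a) \<in> merge (r', E, F) \<pi>" "(B, b) \<in> merge (r', E, F) \<pi>"
        "(C \<union> D, merged_weight c d r') \<in> merge (r', E, F) \<pi>"
      unfolding E mem_merge[OF \<pi> cd(1,2)] using ab neq' by simp_all
    have "(C \<union> D, merged_weight c d r') \<in> ?\<pi>''"
        "(A \<union> B, merged_weight a b s') \<in> ?\<pi>''"
      unfolding colors(5)[symmetric] G mem_merge[OF P1 c1(1,2)] using c1(3) neq' by simp_all
    then have "r' = s" "s' = r"
      using wu[OF new'(2)] wu[OF new'(1)] merged_weight_inj by metis+
    then show ?thesis by (simp add: eq mm mm' E G)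
  qed
qed

definition merged_weight3 :: "(nat \<Rightarrow> nat) \<Rightarrow> (nat \<Rightarrow> nat)
    \<Rightarrow> (nat \<Rightarrow> nat) \<Rightarrow> nat \<Rightarrow> nat \<Rightarrow> nat \<Rightarrow> nat" where
  "merged_weight3 a b c r s = merged_weight (merged_weight a b r) c s"

lemma merged_weight3_perm:
  "merged_weight3 a b c r s = merged_weight3 b a c r s"
  "merged_weight3 a b c r s = merged_weight3 b c a r s"
  "merged_weight3 a b c r s = merged_weight3 a b c s r"
  by (auto simp: merged_weight3_def merged_weight_def)

text \<open>The final weight shows the two colors only as a multiset; for different colors the
  interval therefore contains chains of both color orders.\<close>

lemma merged_weight3_inj:
  assumes "merged_weight3 a b c r s = merged_weight3 a b c r' s'"
  shows "r' = r \<and> s' = s \<or> r' = s \<and> s' = r"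
proof -
  have *: "(if i = r then 1 else 0) + (if i = s then 1 else 0) =
      (if i = r' then 1 else 0) + (if i = s' then 1 else (0::nat))" for i
    using fun_cong[OF assms, of i] by (simp add: merged_weight3_def merged_weight_def)
  show ?thesis
  proof (cases "r' = r")
    case True
    then show ?thesis using *[of s] by (cases "s' = s") simp_all
  next
    case False
    then have "s' = r" using *[of r] by (cases "s' = r") simp_all
    then show ?thesis using *[of s] by (cases "r' = s") simp_all
  qed
qed

lemma mem_merge_merge:
  assumes \<pi>: "\<pi> \<in> wpartitions n k" and UV: "(U, u) \<in> \<pi>"
      "(V, v) \<in> \<pi>" and W: "(W, w) \<in> \<pi>"
    and ne: "U \<noteq> V" "U \<noteq> W" "V \<noteq> W" and r: "r \<in> {1..k}"
  shows "p \<in> merge (s, U \<union> V, W) (merge (r, U, V) \<pi>) \<longleftrightarrow>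
    p \<in> \<pi> \<and> fst p \<notin> {U, V, W} \<or>
        p = (U \<union> V \<union> W, merged_weight3 u v w r s)"
proof -
  have P': "merge (r, U, V) \<pi> \<in> wpartitions n k" by (rule merge_wpart(1)[OF \<pi> UV ne(1) r])
  have in': "(U \<union> V, merged_weight u v r) \<in> merge (r, U, V) \<pi>"
      "(W, w) \<in> merge (r, U, V) \<pi>"
    unfolding mem_merge[OF \<pi> UV] using W ne by simp_all
  have "fst p \<noteq> U \<union> V" if "p \<in> \<pi>"
    using wpart_Un_notin[OF \<pi> UV ne(1), of "snd p"] that by (metis prod.collapse)
  then show ?thesis
    unfolding mem_merge[OF P' in'] mem_merge[OF \<pi> UV] merged_weight3_def
    by (cases "p \<in> \<pi>"; cases "p = (U \<union> V, merged_weight u v r)") simp_all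
qed

text \<open>Meant for blocks of increasing minimum: then every move in the list has its smaller
  minimum first, as \<open>step_ok\<close> demands.\<close>

definition triples :: "nat \<Rightarrow> nat \<Rightarrow> nat set \<Rightarrow> nat set \<Rightarrow> nat set \<Rightarrow> (move \<times> move) list" where
  "triples r s X Y Z =
     [((r, Y, Z), (s, X, Y \<union> Z)), ((r, X, Y), (s, X \<union> Y, Z)), ((r, X, Z), (s,
         X \<union> Z, Y))]"

lemma triples_step:
  assumes \<pi>: "\<pi> \<in> wpartitions n k" and XYZ: "(X, x) \<in> \<pi>" "(Y, y) \<in> \<pi>"
      "(Z, z) \<in> \<pi>"
    and less: "Min X < Min Y" "Min Y < Min Z" and r: "r \<in> {1..k}" and s: "s \<in> {1..k}"
    and pq: "(p, q) \<in> set (triples r s X Y Z)"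
  shows "step_ok k \<pi> p" "step_ok k (merge p \<pi>) q"
    "e \<in> merge q (merge p \<pi>) \<longleftrightarrow>
      e \<in> \<pi> \<and> fst e \<notin> {X, Y, Z} \<or>
          e = (X \<union> Y \<union> Z, merged_weight3 x y z r s)"
proof -
  have XZ: "Min X < Min Z" using less by simp
  have ne: "X \<noteq> Y" "X \<noteq> Z" "Y \<noteq> Z" using less by auto
  note fin = wpart_blockD(2,3)[OF \<pi> XYZ(1)] wpart_blockD(2,3)[OF \<pi> XYZ(2)]
    wpart_blockD(2,3)[OF \<pi> XYZ(3)]
  have mins: "Min (X \<union> Y) = Min X" "Min (X \<union> Z) = Min X" "Min (Y \<union> Z) = Min Y"
    using fin less XZ by (simp_all add: Min_Un)
  consider (1) "p = (r, Y, Z)" "q = (s, X, Y \<union> Z)" | (2) "p = (r, X, Y)" "q = (s, X \<union> Y, Z)"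
    | (3) "p = (r, X, Z)" "q = (s, X \<union> Z, Y)"
    using pq by (auto simp: triples_def)
  then have "step_ok k \<pi> p \<and> step_ok k (merge p \<pi>) q \<and>
      (e \<in> merge q (merge p \<pi>) \<longleftrightarrow>
      e \<in> \<pi> \<and> fst e \<notin> {X, Y, Z} \<or>
          e = (X \<union> Y \<union> Z, merged_weight3 x y z r s))"
  proof cases
    case 1
    have m: "(X, x) \<in> merge p \<pi>" "(Y \<union> Z, merged_weight y z r) \<in> merge p \<pi>"
      unfolding 1 mem_merge[OF \<pi> XYZ(2,3)] using XYZ ne by simp_all
    have "step_ok k (merge p \<pi>) q"
      unfolding 1(2) by (rule step_okI[OF m]) (use less mins s in auto)
    moreover have "step_ok k \<pi> p" unfolding 1 by (rule step_okI[OF XYZ(2,3) less(2) r])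
    moreover have "merge q (merge p \<pi>) = merge (s, Y \<union> Z, X) (merge (r, Y, Z) \<pi>)"
      unfolding 1 by (simp add: merge_commute[of s X])
    moreover have "{Y, Z, X} = {X, Y, Z}" "Y \<union> Z \<union> X = X \<union> Y \<union> Z" by auto
    ultimately show ?thesis
      using mem_merge_merge[OF \<pi> XYZ(2,3,1) ne(3) ne(1)[symmetric] ne(2)[symmetric] r, of e s]
        merged_weight3_perm(2)[of x y z r s] by simp
  next
    case 2
    have m: "(X \<union> Y, merged_weight x y r) \<in> merge p \<pi>" "(Z, z) \<in> merge p \<pi>"
      unfolding 2 mem_merge[OF \<pi> XYZ(1,2)] using XYZ ne by simp_all
    have "step_ok k (merge p \<pi>) q"
      unfolding 2(2) by (rule step_okI[OF m]) (use less mins s in auto)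
    moreover have "step_ok k \<pi> p" unfolding 2 by (rule step_okI[OF XYZ(1,2) less(1) r])
    ultimately show ?thesis
      using mem_merge_merge[OF \<pi> XYZ ne r, of e s] 2 by simp
  next
    case 3
    have m: "(X \<union> Z, merged_weight x z r) \<in> merge p \<pi>" "(Y, y) \<in> merge p \<pi>"
      unfolding 3 mem_merge[OF \<pi> XYZ(1,3)] using XYZ ne by simp_all
    have "step_ok k (merge p \<pi>) q"
      unfolding 3(2) by (rule step_okI[OF m]) (use less mins s in auto)
    moreover have "step_ok k \<pi> p" unfolding 3 by (rule step_okI[OF XYZ(1,3) XZ r])
    moreover have "{X, Z, Y} = {X, Y, Z}" "X \<union> Z \<union> Y = X \<union> Y \<union> Z" by auto
    moreover have "merged_weight3 x z y r s = merged_weight3 x y z r s"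
      by (metis merged_weight3_perm(1,2))
    ultimately show ?thesis
      using mem_merge_merge[OF \<pi> XYZ(1,3,2) ne(2,1) ne(3)[symmetric] r, of e s] 3 by simp
  qed
  then show "step_ok k \<pi> p" "step_ok k (merge p \<pi>) q"
    "e \<in> merge q (merge p \<pi>) \<longleftrightarrow>
      e \<in> \<pi> \<and> fst e \<notin> {X, Y, Z} \<or>
          e = (X \<union> Y \<union> Z, merged_weight3 x y z r s)" by auto
qed

text \<open>The first move joins two of the three lost blocks, the second adds the remaining one,
  and the colors are known up to order. This gives three chains for equal colors, the terms of
  Jacobi, and six for different colors, the terms of compatibility.\<close>

lemma pairs_triples:
  assumes \<pi>: "\<pi> \<in> wpartitions n k" and XYZ: "(X, x) \<in> \<pi>" "(Y, y) \<in> \<pi>"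
      "(Z, z) \<in> \<pi>"
    and less: "Min X < Min Y" "Min Y < Min Z" and r: "r \<in> {1..k}" and s: "s \<in> {1..k}"
    and mm: "(m, m') \<in> set (triples r s X Y Z)"
  shows "pairs k \<pi> (merge m' (merge m \<pi>)) = set (triples r s X Y Z) \<union> set (triples s r X Y Z)"
proof (intro equalityI subsetI)
  let ?\<pi>'' = "merge m' (merge m \<pi>)"
  note mem'' = triples_step(3)[OF \<pi> XYZ less r s mm]
  {
    fix pq assume "pq \<in> set (triples r s X Y Z) \<union> set (triples s r X Y Z)"
    then obtain p q r' s' where pq: "pq = (p, q)" "(p, q) \<in> set (triples r' s' X Y Z)"
        "r' = r \<and> s' = s \<or> r' = s \<and> s' = r"
      by (cases pq) blast
    have rs': "r' \<in> {1..k}" "s' \<in> {1..k}" using pq(3) r s by auto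
    note st = triples_step[OF \<pi> XYZ less rs' pq(2)]
    have "merged_weight3 x y z r' s' = merged_weight3 x y z r s"
      using pq(3) merged_weight3_perm(3)[of x y z r s] by auto
    then have "merge q (merge p \<pi>) = ?\<pi>''"
      by (intro Set.set_eqI) (simp only: st(3) mem'')
    then show "pq \<in> pairs k \<pi> ?\<pi>''" using st(1,2) by (simp add: pairs_def pq(1))
  }
  fix pq assume pq: "pq \<in> pairs k \<pi> ?\<pi>''"
  obtain r' E F s' G H where eq: "pq = ((r', E, F), (s', G, H))" by (cases pq) auto
  note pb = pairs_blocks[OF \<pi> pq[unfolded eq]]
  have XZ: "Min X < Min Z" using less by simp
  note fin = wpart_blockD(2,3)[OF \<pi> XYZ(1)] wpart_blockD(2,3)[OF \<pi> XYZ(2)]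
    wpart_blockD(2,3)[OF \<pi> XYZ(3)]
  have mins: "Min (X \<union> Y) = Min X" "Min (X \<union> Z) = Min X" "Min (Y \<union> Z) = Min Y"
    using fin less XZ by (simp_all add: Min_Un)
  have gone: "B \<in> {X, Y, Z}" if B: "B \<in> fst ` \<pi> - fst ` ?\<pi>''" for B
  proof -
    obtain b where "(B, b) \<in> \<pi>" "(B, b) \<notin> ?\<pi>''" using B
        unfolding Diff_iff in_fst_image by blast
    then show ?thesis unfolding mem'' by auto
  qed
  have G1: "B \<in> {X, Y, Z} - {E, F} \<union> {E \<union> F}" if "B = G \<or> B = H" for B
    using pb(5,6) that gone[of B] by blast
  have cases: "E = X \<and> F = Y \<or> E = X \<and> F = Z \<or> E = Y \<and> F = Z"
    using gone[OF pb(1)] gone[OF pb(2)] pb(3) less XZ by auto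
  have ok: "step_ok k \<pi> (r', E, F)" "step_ok k (merge (r', E, F) \<pi>) (s', G, H)"
    and fin'': "merge (s', G, H) (merge (r', E, F) \<pi>) = ?\<pi>''"
    using pq by (simp_all add: eq pairs_def)
  have rs': "r' \<in> {1..k}" "s' \<in> {1..k}" using ok by (simp_all add: step_ok_def)
  have c1: "G = X \<and> H = Y \<union> Z" if "E = Y" "F = Z"
    using G1[of G] G1[of H] pb(7) mins less XZ that by auto
  have c2: "G = X \<union> Y \<and> H = Z" if "E = X" "F = Y"
    using G1[of G] G1[of H] pb(7) mins less XZ that by auto
  have c3: "G = X \<union> Z \<and> H = Y" if "E = X" "F = Z"
    using G1[of G] G1[of H] pb(7) mins less XZ that by auto
  have tr: "((r', E, F), (s', G, H)) \<in> set (triples r' s' X Y Z)"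
    using cases
  proof (elim disjE conjE)
    assume "E = X" "F = Y"
    with c2[OF this] show ?thesis by (simp add: triples_def)
  next
    assume "E = X" "F = Z"
    with c3[OF this] show ?thesis by (simp add: triples_def)
  next
    assume "E = Y" "F = Z"
    with c1[OF this] show ?thesis by (simp add: triples_def)
  qed
  have "(X \<union> Y \<union> Z, merged_weight3 x y z r' s') \<in> ?\<pi>''"
    using triples_step(3)[OF \<pi> XYZ less rs' tr] by (simp only: fin'') simp
  moreover have "(X \<union> Y \<union> Z, merged_weight3 x y z r s) \<in> ?\<pi>''"
    unfolding mem'' by simp
  moreover have "?\<pi>'' \<in> wpartitions n k"
    using step_ok_merge(1)[OF step_ok_merge(1)[OF \<pi> ok(1)] ok(2)] fin'' by simp
  ultimately have "merged_weight3 x y z r s = merged_weight3 x y z r' s'"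
    using wpart_weight_unique by blast
  from merged_weight3_inj[OF this] show "pq \<in> set (triples r s X Y Z) \<union> set (triples s r X Y Z)"
    using tr by (auto simp: eq)
qed

text \<open>The distinction is whether the second move uses the block created by the first; if it
  does, the position of the third block among the minima selects the member of
  \<open>triples\<close>.\<close>

lemma two_steps_cases:
  assumes \<pi>: "\<pi> \<in> wpartitions n k" and m: "step_ok k \<pi> m"
      and m': "step_ok k (merge m \<pi>) m'"
  obtains "step_ok k \<pi> m'" "indep m m'"
  | X Y Z x y z r s where "(X, x) \<in> \<pi>" "(Y, y) \<in> \<pi>" "(Z, z) \<in> \<pi>"
      "Min X < Min Y" "Min Y < Min Z"
      "r \<in> {1..k}" "s \<in> {1..k}" "(m, m') \<in> set (triples r s X Y Z)"
proof -
  obtain r A B a b where mm: "m = (r, A, B)" and ab: "(A, a) \<in> \<pi>" "(B, b) \<in> \<pi>"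
      "Min A < Min B" "r \<in> {1..k}"
    using m by (auto elim: step_okE)
  obtain s C D c d where mm': "m' = (s, C, D)" and cd: "(C, c) \<in> merge m \<pi>"
      "(D, d) \<in> merge m \<pi>"
      "Min C < Min D" "s \<in> {1..k}"
    using m' by (auto elim: step_okE)
  have AB: "A \<noteq> B" "C \<noteq> D" using ab cd by auto
  have minAB: "Min (A \<union> B) = Min A"
    using Min_Un_less wpart_blockD(2,3)[OF \<pi> ab(1)] wpart_blockD(2,3)[OF \<pi> ab(2)] ab(3) by blast
  have mem: "(E, e) \<in> merge m \<pi> \<longleftrightarrow> (E, e) \<in> \<pi> \<and>
      E \<noteq> A \<and> E \<noteq> B \<or> (E, e) = (A \<union> B, merged_weight a b r)" for E e
    unfolding mm mem_merge[OF \<pi> ab(1,2)] by simp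
  consider (1) "C = A \<union> B" | (2) "C \<noteq> A \<union> B"
      "D = A \<union> B" | (3) "C \<noteq> A \<union> B" "D \<noteq> A \<union> B" by blast
  then show thesis
  proof cases
    case 1
    then have D: "(D, d) \<in> \<pi>" "D \<noteq> A" "D \<noteq> B" using cd(2) AB mem by auto
    have AD: "Min A < Min D" using cd(3) minAB 1 by simp
    consider "Min B < Min D" | "Min D < Min B" using wpart_Min_neq[OF \<pi> D(1) ab(2)] D by linarith
    then show thesis
    proof cases
      case 1
      show thesis
        by (rule that(2)[OF ab(1,2) D(1) ab(3) 1 ab(4) cd(4)])
          (simp add: triples_def mm mm' \<open>C = A \<union> B\<close>)
    next
      case 2
      show thesis
        by (rule that(2)[OF ab(1) D(1) ab(2) AD 2 ab(4) cd(4)])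
          (simp add: triples_def mm mm' \<open>C = A \<union> B\<close>)
    qed
  next
    case 2
    then have C: "(C, c) \<in> \<pi>" "C \<noteq> A" "C \<noteq> B" using cd(1) mem by auto
    have CA: "Min C < Min A" using cd(3) minAB 2 by simp
    show thesis
      by (rule that(2)[OF C(1) ab(1,2) CA ab(3,4) cd(4)]) (simp add: triples_def mm mm' 2)
  next
    case 3
    then have CD: "(C, c) \<in> \<pi>" "C \<noteq> A" "C \<noteq> B" "(D, d) \<in> \<pi>"
        "D \<noteq> A" "D \<noteq> B"
      using cd(1,2) mem by auto
    have "step_ok k \<pi> m'" unfolding mm' by (rule step_okI[OF CD(1,4) cd(3,4)])
    moreover have "indep m m'"
      using wpart_disjoint[OF \<pi> CD(1) ab(1) CD(2)] wpart_disjoint[OF \<pi> CD(1) ab(2) CD(3)]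
        wpart_disjoint[OF \<pi> CD(4) ab(1) CD(5)] wpart_disjoint[OF \<pi> CD(4) ab(2) CD(6)]
      unfolding indep_def mm mm' by auto
    ultimately show thesis by (rule that(1))
  qed
qed

section \<open>Maximal chains as sequences of merges\<close>

fun valid :: "nat \<Rightarrow> wpart \<Rightarrow> move list \<Rightarrow> bool" where
  "valid k \<pi> [] \<longleftrightarrow> True"
| "valid k \<pi> (m # ms) \<longleftrightarrow> step_ok k \<pi> m \<and> valid k (merge m \<pi>) ms"

lemma valid_append: "valid k \<pi> (us @ vs) \<longleftrightarrow> valid k \<pi> us \<and>
    valid k (fold merge us \<pi>) vs"
  by (induction us arbitrary: \<pi>) auto

lemma valid_nth:
  "valid k \<pi> ms \<longleftrightarrow> (\<forall>i<length ms. step_ok k (fold merge (take i ms)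
      \<pi>) (ms ! i))"
proof (induction ms arbitrary: \<pi>)
  case (Cons m ms)
  show ?case unfolding valid.simps Cons.IH length_Cons All_less_Suc2 by simp
qed simp

lemma valid_wpart:
  "\<pi> \<in> wpartitions n k \<Longrightarrow> valid k \<pi> ms \<Longrightarrow>
     fold merge ms \<pi> \<in> wpartitions n k \<and> card \<pi> = card (fold merge ms \<pi>) + length ms"
proof (induction ms arbitrary: \<pi>)
  case (Cons m ms)
  then have "step_ok k \<pi> m" "valid k (merge m \<pi>) ms" by simp_all
  with step_ok_merge[OF Cons.prems(1)] Cons.IH[of "merge m \<pi>"] show ?case by simp
qed simp

lemma fst_wbot: "fst ` wbot n = (\<lambda>i. {i}) ` {1..n}"
  by (simp add: wbot_def image_image)

lemma mem_wbot: "(A, a) \<in> wbot n \<longleftrightarrow> (\<exists>i\<in>{1..n}. A = {i} \<and>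
    a = (\<lambda>_. 0))"
  by (auto simp: wbot_def)

lemma wbot_wpart: "wbot n \<in> wpartitions n k"
proof -
  have "partition_on {1..n} (fst ` wbot n)"
    unfolding fst_wbot by (rule partition_onI) (auto simp: disjnt_def)
  moreover have "inj_on fst (wbot n)" by (auto simp: inj_on_def wbot_def)
  moreover have "(\<lambda>_. 0) \<in> wcomp 0" by (simp add: wcomp_def supp_def)
  moreover have "supp (\<lambda>_. 0) = {}" by (simp add: supp_def)
  ultimately show ?thesis
    unfolding wpartitions_def by (auto simp: mem_wbot)
qed

lemma card_wbot: "card (wbot n) = n"
  unfolding wbot_def by (subst card_image) (auto simp: inj_on_def)

lemma wcovers_facts:
  assumes "wcovers n k u v"
  shows "u \<in> wpartitions n k" "v \<in> wpartitions n k" "card u = Suc (card v)"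
proof -
  show "u \<in> wpartitions n k" "v \<in> wpartitions n k" using assms by (auto simp: wcovers_def)
  then show "card u = Suc (card v)"
    using wcovers_step[OF assms] step_ok_merge(3) by blast
qed

text \<open>The number of blocks drops by one along each cover and so grades the order.\<close>

lemma wle_rank:
  assumes "wle n k u v"
  shows "card v \<le> card u" "card v = card u \<Longrightarrow> u = v"
      "card u = Suc (card v) \<Longrightarrow> wcovers n k u v"
proof -
  have "card v \<le> card u \<and> (card v = card u \<longrightarrow> u = v) \<and>
      (card u = Suc (card v) \<longrightarrow> wcovers n k u v)"
    using assms unfolding wle_def
  proof (induction rule: converse_rtranclp_induct)
    case (step u w)
    then show ?case using wcovers_facts(3)[OF step(1)] by auto
  qed simp
  then show "card v \<le> card u" "card v = card u \<Longrightarrow> u = v"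
      "card u = Suc (card v) \<Longrightarrow> wcovers n k u v"
    by auto
qed

text \<open>The blocks that disappear are the two that were merged, their minima fix the order, and
  the weight of the union fixes the color. So a maximal chain determines its sequence of
  moves.\<close>

lemma step_unique:
  assumes \<pi>: "\<pi> \<in> wpartitions n k" and m: "step_ok k \<pi> m" and m': "step_ok k \<pi> m'"
    and eq: "merge m \<pi> = merge m' \<pi>"
  shows "m = m'"
proof -
  obtain r A B a b where mm: "m = (r, A, B)" and ab: "(A, a) \<in> \<pi>" "(B, b) \<in> \<pi>"
      "Min A < Min B" "r \<in> {1..k}"
    using m by (auto elim: step_okE)
  obtain s C D c d where mm': "m' = (s, C, D)" and cd: "(C, c) \<in> \<pi>" "(D, d) \<in> \<pi>"
      "Min C < Min D"
    using m' by (auto elim: step_okE)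
  have gone: "E \<in> {A, B}" if E: "E \<in> fst ` \<pi>" "E \<notin> fst ` merge m \<pi>" for E
    using E unfolding mm merge_blocks[OF \<pi> ab(1,2)] by blast
  have "C \<in> fst ` \<pi>" "D \<in> fst ` \<pi>" using m' by (simp_all add: mm' step_ok_def)
  then have "C \<in> {A, B}" "D \<in> {A, B}"
    using gone step_blocks_disappear[OF \<pi> m'[unfolded mm']] unfolding eq mm' by blast+
  then have CD: "C = A" "D = B" using cd(3) ab(3) by auto
  have "(A \<union> B, merged_weight a b r) \<in> merge m \<pi>"
    unfolding mm mem_merge[OF \<pi> ab(1,2)] by simp
  moreover have "(A \<union> B, merged_weight a b s) \<in> merge m \<pi>"
    unfolding eq mm' CD mem_merge[OF \<pi> ab(1,2)] by simp
  ultimately have "r = s"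
    using wpart_weight_unique[OF step_ok_merge(1)[OF \<pi> m]] merged_weight_inj by metis
  then show ?thesis by (simp add: mm mm' CD)
qed

definition state :: "nat \<Rightarrow> move list \<Rightarrow> nat \<Rightarrow> wpart" where
  "state n ms i = fold merge (take i ms) (wbot n)"

definition full_seqs :: "nat \<Rightarrow> nat \<Rightarrow> (nat \<Rightarrow> nat)
    \<Rightarrow> move list set" where
  "full_seqs n k \<mu> = {ms. valid k (wbot n) ms \<and> fold merge ms (wbot n) = wtop n \<mu>}"

definition open_chain :: "nat \<Rightarrow> (nat \<Rightarrow> nat)
    \<Rightarrow> move list \<Rightarrow> wpart set" where
  "open_chain n \<mu> ms = {state n ms i | i. i \<le> length ms} - {wbot n, wtop n \<mu>}"

section \<open>Facets of the open interval\<close>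

locale weighted_interval =
  fixes n k :: nat and \<mu> :: "nat \<Rightarrow> nat"
  assumes n: "n \<ge> 1" and \<mu>: "\<mu> \<in> wcomp (n - 1)" "supp \<mu> \<subseteq> {1..k}"
begin

abbreviation "P \<equiv> wpartitions n k"
abbreviation "leq \<equiv> wle n k"
abbreviation "MS \<equiv> full_seqs n k \<mu>"
abbreviation "st \<equiv> state n"
abbreviation "Faces \<equiv> faces P leq (wbot n) (wtop n \<mu>)"

lemma card_wtop: "card (wtop n \<mu>) = 1"
  by (simp add: wtop_def)

lemma bot_eq_top_iff: "wbot n = wtop n \<mu> \<longleftrightarrow> n = 1"
proof
  show "wbot n = wtop n \<mu> \<Longrightarrow> n = 1" using card_wbot[of n] card_wtop by simp
next
  assume "n = 1"
  then have "(\<Sum>j\<in>{1..k}. \<mu> j) = 0" using \<mu> wcomp_iff by auto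
  then have "\<mu> j = 0" for j using \<mu>(2) by (cases "j \<in> {1..k}") (auto simp: supp_def)
  then have "\<mu> = (\<lambda>_. 0)" by auto
  then show "wbot n = wtop n \<mu>" using \<open>n = 1\<close> by (simp add: wbot_def wtop_def)
qed

lemma full_length: "ms \<in> MS \<Longrightarrow> length ms = n - 1"
  using valid_wpart[OF wbot_wpart, of k n ms] card_wbot[of n] card_wtop by (auto simp: full_seqs_def)

lemma full_state:
  assumes "ms \<in> MS" "i \<le> n - 1"
  shows "st ms i \<in> P" "card (st ms i) = n - i"
proof -
  have "valid k (wbot n) (take i ms)"
    using assms(1) valid_append[of k "wbot n" "take i ms" "drop i ms"] by (simp add: full_seqs_def)
  from valid_wpart[OF wbot_wpart this] have "st ms i \<in> P \<and> n = card (st ms i) + i"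
    using full_length[OF assms(1)] assms(2) by (simp add: state_def card_wbot)
  then show "st ms i \<in> P" "card (st ms i) = n - i" by linarith+
qed

lemma full_step:
  assumes "ms \<in> MS" "i < n - 1"
  shows "step_ok k (st ms i) (ms ! i)" "st ms (Suc i) = merge (ms ! i) (st ms i)"
    "wcovers n k (st ms i) (st ms (Suc i))"
proof -
  show 1: "step_ok k (st ms i) (ms ! i)"
    using assms full_length[OF assms(1)] valid_nth by (auto simp: full_seqs_def state_def)
  show 2: "st ms (Suc i) = merge (ms ! i) (st ms i)"
    using assms full_length[OF assms(1)] by (simp add: state_def take_Suc_conv_app_nth)
  show "wcovers n k (st ms i) (st ms (Suc i))"
    unfolding 2 by (rule step_ok_merge(2)[OF full_state(1) 1]) (use assms in auto)
qed

lemma full_ends: "ms \<in> MS \<Longrightarrow> st ms 0 = wbot n"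
    "ms \<in> MS \<Longrightarrow> st ms (n - 1) = wtop n \<mu>"
  using full_length[of ms] by (simp_all add: state_def full_seqs_def)

lemma full_wle:
  assumes "ms \<in> MS" "i \<le> j" "j \<le> n - 1"
  shows "leq (st ms i) (st ms j)"
  using assms(2,3)
proof (induction j rule: dec_induct)
  case base
  show ?case by (simp add: wle_def)
next
  case (step j)
  then show ?case
    using full_step(3)[OF assms(1), of j] by (auto simp: wle_def intro: rtranclp.rtrancl_into_rtrancl)
qed

lemma full_wle_iff:
  assumes "ms \<in> MS" "i \<le> n - 1" "j \<le> n - 1"
  shows "leq (st ms i) (st ms j) \<longleftrightarrow> i \<le> j"
  using full_wle[OF assms(1) _ assms(3)] wle_rank(1) full_state(2)[OF assms(1,2)]
    full_state(2)[OF assms(1,3)] assms(2,3) n by fastforce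

lemma state_eq_iff:
  assumes "ms \<in> MS" "ms' \<in> MS" "i \<le> n - 1" "j \<le> n - 1" "st ms i = st ms' j"
  shows "i = j"
  using full_state(2)[OF assms(1,3)] full_state(2)[OF assms(2,4)] assms(3-5) n by auto

lemma open_chain_eq:
  assumes "ms \<in> MS"
  shows "open_chain n \<mu> ms = st ms ` {1..<n - 1}"
proof (intro equalityI subsetI)
  fix z assume "z \<in> open_chain n \<mu> ms"
  then obtain i where i: "z = st ms i" "i \<le> n - 1" "z \<noteq> wbot n" "z \<noteq> wtop n \<mu>"
    using full_length[OF assms] by (auto simp: open_chain_def)
  then have "i \<noteq> 0" "i \<noteq> n - 1" using full_ends[OF assms] by metis+
  then show "z \<in> st ms ` {1..<n - 1}" using i by auto
next
  fix z assume "z \<in> st ms ` {1..<n - 1}"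
  then obtain i where i: "z = st ms i" "1 \<le> i" "i < n - 1" by auto
  then have "z \<noteq> st ms 0" "z \<noteq> st ms (n - 1)"
    using state_eq_iff[OF assms assms, of i 0] state_eq_iff[OF assms assms, of i "n - 1"] by auto
  then show "z \<in> open_chain n \<mu> ms"
    using i full_length[OF assms] full_ends[OF assms] by (auto simp: open_chain_def)
qed

lemma inj_on_state: "ms \<in> MS \<Longrightarrow> inj_on (st ms) {..n - 1}"
  using state_eq_iff by (auto simp: inj_on_def)

lemma card_open_chain: "ms \<in> MS \<Longrightarrow> card (open_chain n \<mu> ms) = n - 2"
  unfolding open_chain_eq
  by (subst card_image) (auto intro: inj_on_subset[OF inj_on_state])

lemma interval_rank:
  assumes "z \<in> open_interval P leq (wbot n) (wtop n \<mu>)"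
  shows "2 \<le> card z" "card z \<le> n - 1"
proof -
  have z: "leq (wbot n) z" "z \<noteq> wbot n" "leq z (wtop n \<mu>)" "z \<noteq> wtop n \<mu>"
    using assms by (auto simp: open_interval_def)
  show "2 \<le> card z" using wle_rank(1,2)[OF z(3)] z(4) card_wtop by fastforce
  show "card z \<le> n - 1" using wle_rank(1,2)[OF z(1)] z(2) card_wbot[of n] by fastforce
qed

lemma chain_inj_card:
  assumes "\<forall>u\<in>c. \<forall>v\<in>c. leq u v \<or> leq v u"
  shows "inj_on card c"
  using assms wle_rank(2) by (metis inj_onI)

lemma face_card_le:
  assumes "c \<subseteq> open_interval P leq (wbot n) (wtop n \<mu>)"
      "\<forall>u\<in>c. \<forall>v\<in>c. leq u v \<or> leq v u"
  shows "card c \<le> n - 2" "card ` c \<subseteq> {2..n - 1}"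
proof -
  show sub: "card ` c \<subseteq> {2..n - 1}" using interval_rank assms(1) by fastforce
  have "card c = card (card ` c)" using chain_inj_card[OF assms(2)] by (simp add: card_image)
  also have "\<dots> \<le> card {2..n - 1}" by (rule card_mono[OF _ sub]) simp
  finally show "card c \<le> n - 2" by simp
qed

text \<open>Block numbers in the open interval run from 2 to \<open>n - 1\<close>, so a face has at
  most \<open>n - 2\<close> elements. Every cochain of degree \<open>n - 3\<close> is therefore a
  cocycle.\<close>

lemma no_faces_above: "Faces (int n - 2) = {}"
proof (cases "n = 1")
  case True
  then show ?thesis using bot_eq_top_iff by (simp add: faces_def)
next
  case False
  then have ne: "wbot n \<noteq> wtop n \<mu>" and n2: "n \<ge> 2" using bot_eq_top_iff n by auto
  show ?thesis
  proof (rule ccontr)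
    assume "Faces (int n - 2) \<noteq> {}"
    then obtain c where c: "c \<subseteq> open_interval P leq (wbot n) (wtop n \<mu>)"
        "\<forall>u\<in>c. \<forall>v\<in>c. leq u v \<or> leq v u" "int (card c) = int n - 1"
      using ne by (auto simp: faces_def)
    show False using face_card_le(1)[OF c(1,2)] c(3) n2 by simp
  qed
qed

lemma open_chain_face:
  assumes "ms \<in> MS" "c \<subseteq> open_chain n \<mu> ms" "n \<noteq> 1"
  shows "c \<in> Faces (int (card c) - 1)"
proof -
  have "st ms i \<in> open_interval P leq (wbot n) (wtop n \<mu>)" if "1 \<le> i" "i < n - 1" for i
  proof -
    have "leq (wbot n) (st ms i)" "leq (st ms i) (wtop n \<mu>)"
      using full_wle[OF assms(1), of 0 i] full_wle[OF assms(1), of i "n - 1"] that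
        full_ends[OF assms(1)] by auto
    moreover have "st ms i \<in> open_chain n \<mu> ms" using that by (simp add: open_chain_eq[OF assms(1)])
    then have "st ms i \<noteq> wbot n" "st ms i \<noteq> wtop n \<mu>" by (auto simp: open_chain_def)
    ultimately show ?thesis using full_state(1)[OF assms(1), of i] that by (simp add: open_interval_def)
  qed
  then have "c \<subseteq> open_interval P leq (wbot n) (wtop n \<mu>)"
    using assms(2) unfolding open_chain_eq[OF assms(1)] by auto
  moreover have "finite c" using assms(2) unfolding open_chain_eq[OF assms(1)] by (rule finite_subset) simp
  moreover have "\<forall>u\<in>c. \<forall>v\<in>c. leq u v \<or> leq v u"
  proof (intro ballI)
    fix u v assume "u \<in> c" "v \<in> c"
    then have "u \<in> st ms ` {1..<n - 1}" "v \<in> st ms ` {1..<n - 1}"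
      using assms(2) unfolding open_chain_eq[OF assms(1)] by blast+
    then obtain i j where "u = st ms i" "v = st ms j" "i < n - 1" "j < n - 1" by auto
    then show "leq u v \<or> leq v u" using full_wle_iff[OF assms(1)] by (simp add: nat_le_linear)
  qed
  ultimately show ?thesis using assms(3) bot_eq_top_iff by (simp add: faces_def)
qed

text \<open>For \<open>n = 2\<close> the only face is empty and says nothing about comparability, so
  the relation between the two ends has to be read off from the total weight one of
  \<open>\<mu>\<close>.\<close>

lemma bot_le_top2:
  assumes "n = 2"
  shows "leq (wbot n) (wtop n \<mu>)"
proof -
  have "(\<Sum>j\<in>{1..k}. \<mu> j) = 1" using \<mu> wcomp_iff assms by auto
  then obtain r where r: "r \<in> {1..k}" "\<mu> r = 1"
      "\<And>j. j \<in> {1..k} \<Longrightarrow> r \<noteq> j \<Longrightarrow> \<mu> j = 0"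
    unfolding sum_eq_1_iff[OF finite_atLeastAtMost] by blast
  have \<mu>_eq: "\<mu> = merged_weight (\<lambda>_. 0) (\<lambda>_. 0) r"
  proof
    fix j
    show "\<mu> j = merged_weight (\<lambda>_. 0) (\<lambda>_. 0) r j"
      using r(2) r(3)[of j] \<mu>(2) by (cases "j \<in> {1..k}") (auto simp: merged_weight_def supp_def)
  qed
  have bot: "({1}, \<lambda>_. 0) \<in> wbot n" "({2}, \<lambda>_. 0) \<in> wbot n"
    using assms by (auto simp: mem_wbot)
  have iv: "{Suc 0..2} = {1, 2}" by auto
  have "merge (r, {1}, {2}) (wbot n) = wtop n \<mu>"
    unfolding merge_eq[OF wbot_wpart[where k = k] bot] by (auto simp: wbot_def wtop_def assms \<mu>_eq iv)
  then have "wcovers n k (wbot n) (wtop n \<mu>)"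
    using merge_wpart(2)[OF wbot_wpart bot _ r(1)] by simp
  then show ?thesis by (simp add: wle_def)
qed

text \<open>A chain of \<open>n - 2\<close> elements meets every rank strictly between the ends;
  consecutive members are then covers, and each cover is a move.\<close>

lemma faces_top: "Faces (int n - 3) = open_chain n \<mu> ` MS"
proof (cases "n = 1")
  case True
  \<comment> \<open>The ends coincide, and both sides consist of the empty face, which by convention
    has degree -2 here.\<close>
  have "MS = {[]}"
    using True full_length bot_eq_top_iff by (auto simp: full_seqs_def)
  then show ?thesis using True bot_eq_top_iff by (simp add: faces_def open_chain_def state_def)
next
  case False
  then have ne: "wbot n \<noteq> wtop n \<mu>" and n2: "n \<ge> 2" using bot_eq_top_iff n by auto
  show ?thesis
  proof (intro equalityI subsetI)
    fix c assume "c \<in> open_chain n \<mu> ` MS"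
    then obtain ms where ms: "ms \<in> MS" "c = open_chain n \<mu> ms" by auto
    have "int (card c) - 1 = int n - 3" using card_open_chain[OF ms(1)] ms(2) n2 by simp
    moreover have "c \<in> Faces (int (card c) - 1)"
      by (rule open_chain_face[OF ms(1) _ False]) (simp add: ms(2))
    ultimately show "c \<in> Faces (int n - 3)" by metis
  next
    fix c assume "c \<in> Faces (int n - 3)"
    then have c: "c \<subseteq> open_interval P leq (wbot n) (wtop n \<mu>)" "finite c"
        "\<forall>u\<in>c. \<forall>v\<in>c. leq u v \<or> leq v u" "card c = n - 2"
      using ne n2 by (auto simp: faces_def)
    have inj: "inj_on card c" by (rule chain_inj_card[OF c(3)])
    have ranks: "card ` c = {2..n - 1}"
      by (rule card_subset_eq) (use face_card_le(2)[OF c(1,3)] c(4)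
          n2 in \<open>auto simp: card_image[OF inj]\<close>)
    \<comment> \<open>\<open>s i\<close> is meant to have \<open>n - i\<close> blocks; the choice
      inside \<open>c\<close> is unique because block numbers are injective on a chain.\<close>
    define s where "s i = (if i = 0 then wbot n else if i = n -
        1 then wtop n \<mu> else inv_into c card (n - i))" for i
    have mid: "s i \<in> c" "card (s i) = n - i" if "1 \<le> i" "i < n - 1" for i
    proof -
      have "n - i \<in> card ` c" unfolding ranks using that by auto
      then show "s i \<in> c" "card (s i) = n - i"
        using that by (simp_all add: s_def inv_into_into f_inv_into_f)
    qed
    have rank: "card (s i) = n - i" if "i \<le> n - 1" for i
      using mid(2)[of i] that card_wbot[of n] card_wtop n2 by (cases "i = 0"; cases "i = n -
          1") (auto simp: s_def)
    have cov: "wcovers n k (s i) (s (Suc i))" if i: "i < n - 1" for i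
    proof -
      have le: "leq (s i) (s (Suc i))"
      proof -
        have int: "leq (wbot n) z" "leq z (wtop n \<mu>)" if "z \<in> c" for z
          using c(1) that by (auto simp: open_interval_def)
        consider "i = 0" "Suc i = n - 1" | "i = 0" "Suc i < n - 1" | "i > 0"
            "Suc i = n - 1" | "i > 0" "Suc i < n - 1"
          using i by linarith
        then show ?thesis
        proof cases
          case 1
          then have "n = 2" by simp
          then show ?thesis using bot_le_top2 1 by (simp add: s_def)
        next
          case 2
          then show ?thesis using int(1)[OF mid(1)[of "Suc i"]] by (simp add: s_def)
        next
          case 3
          then show ?thesis using int(2)[OF mid(1)[of i]] n2 by (simp add: s_def)
        next
          case 4
          then have "leq (s i) (s (Suc i)) \<or> leq (s (Suc i)) (s i)"
            using c(3) mid(1)[of i] mid(1)[of "Suc i"] by auto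
          moreover have "\<not> leq (s (Suc i)) (s i)"
            using wle_rank(1)[of n k "s (Suc i)" "s i"] rank[of i] rank[of "Suc i"] that by fastforce
          ultimately show ?thesis by blast
        qed
      qed
      then show ?thesis
        using rank[of i] rank[of "Suc i"] that by (intro wle_rank(3)[OF le]) simp
    qed
    then have "\<forall>i. \<exists>m. i < n - 1 \<longrightarrow> step_ok k (s i) m \<and>
        s (Suc i) = merge m (s i)"
      using wcovers_step by blast
    then obtain f where f: "\<And>i. i < n - 1 \<Longrightarrow> step_ok k (s i) (f i) \<and>
        s (Suc i) = merge (f i) (s i)" by metis
    define ms where "ms = map f [0..<n - 1]"
    have state: "st ms i = s i" if "i \<le> n - 1" for i
      using that
    proof (induction i)
      case 0
      then show ?case by (simp add: state_def s_def)
    next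
      case (Suc i)
      then show ?case using f[of i] by (simp add: state_def take_Suc_conv_app_nth ms_def)
    qed
    have "valid k (wbot n) ms"
      unfolding valid_nth using f state by (simp add: state_def ms_def)
    moreover have "fold merge ms (wbot n) = wtop n \<mu>"
      using state[of "n - 1"] n2 by (simp add: state_def s_def ms_def)
    ultimately have ms: "ms \<in> MS" by (simp add: full_seqs_def)
    have "c = st ms ` {1..<n - 1}"
    proof (intro equalityI subsetI)
      fix z assume "z \<in> st ms ` {1..<n - 1}"
      then show "z \<in> c" using state mid(1) by auto
    next
      fix z assume z: "z \<in> c"
      then have r: "card z \<in> {2..n - 1}" using ranks by blast
      have "s (n - card z) = z"
        using r z inj by (auto simp: s_def inv_into_f_f)
      moreover have "n - card z \<le> n - 1" using r by auto
      ultimately have "z = st ms (n - card z)" using state by metis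
      then show "z \<in> st ms ` {1..<n - 1}" using r by (intro image_eqI[of _ _ "n - card z"]) auto
    qed
    then show "c \<in> open_chain n \<mu> ` MS" using open_chain_eq[OF ms] ms by auto
  qed
qed

end

section \<open>Coboundaries in top degree\<close>

definition face_indicator :: "'p set \<Rightarrow> 'p set \<Rightarrow> 'a::field" where
  "face_indicator c = (\<lambda>c'. if c' = c then 1 else 0)"

context weighted_interval
begin

definition omit :: "nat \<Rightarrow> move list \<Rightarrow> wpart set" where
  "omit i ms = st ms ` ({1..<n - 1} - {i})"

lemma omit_eq:
  assumes "ms \<in> MS" "1 \<le> i" "i < n - 1"
  shows "open_chain n \<mu> ms - {st ms i} = omit i ms"
  unfolding open_chain_eq[OF assms(1)] omit_def
  using state_eq_iff[OF assms(1,1)] assms(2,3) by auto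

lemma finite_full: "finite MS"
proof -
  have "set ms \<subseteq> {1..k} \<times> Pow {1..n} \<times> Pow {1..n}" if ms: "ms \<in> MS" for ms
  proof
    fix m assume "m \<in> set ms"
    then obtain i where i: "i < n - 1" "m = ms ! i" using full_length[OF ms] by (auto simp: in_set_conv_nth)
    obtain r A B a b where m: "m = (r, A, B)" "(A, a) \<in> st ms i" "(B, b) \<in> st ms i" "r \<in> {1..k}"
      using full_step(1)[OF ms i(1)] i(2) by (auto elim: step_okE)
    have "st ms i \<in> P" using full_state(1)[OF ms] i by simp
    from wpart_blockD(1)[OF this m(2)] wpart_blockD(1)[OF this m(3)] m
    show "m \<in> {1..k} \<times> Pow {1..n} \<times> Pow {1..n}" by auto
  qed
  then have "MS \<subseteq> {ms. set ms \<subseteq> {1..k} \<times> Pow {1..n} \<times> Pow {1..n} \<and> length ms = n - 1}"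
    using full_length by blast
  then show ?thesis by (rule finite_subset) (intro finite_lists_length_eq, simp)
qed

lemma nth_eqI:
  assumes "ms \<in> MS" "ms' \<in> MS" "i < n - 1" "st ms i = st ms' i" "st ms (Suc i) = st ms' (Suc i)"
  shows "ms ! i = ms' ! i"
  using step_unique[OF full_state(1)[OF assms(1)] full_step(1)[OF assms(1,3)], of "ms' ! i"]
    full_step(1)[OF assms(2,3)] full_step(2)[OF assms(1,3)] full_step(2)[OF assms(2,3)] assms(3-5)
  by simp

lemma open_chain_inj: "inj_on (open_chain n \<mu>) MS"
proof (rule inj_onI)
  fix ms ms' assume ms: "ms \<in> MS" and ms': "ms' \<in> MS"
      and eq: "open_chain n \<mu> ms = open_chain n \<mu> ms'"
  have st: "st ms i = st ms' i" if "i \<le> n - 1" for i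
  proof (cases "i = 0 \<or> i = n - 1")
    case True
    then show ?thesis using full_ends[OF ms] full_ends[OF ms'] by auto
  next
    case False
    then have "st ms i \<in> st ms ` {1..<n - 1}" using that by (intro imageI) auto
    then have "st ms i \<in> st ms' ` {1..<n - 1}"
      using eq unfolding open_chain_eq[OF ms] open_chain_eq[OF ms'] by simp
    then obtain j where j: "st ms i = st ms' j" "j < n - 1" by auto
    then have "i = j" using state_eq_iff[OF ms ms' that, of j] by simp
    then show ?thesis using j by simp
  qed
  show "ms = ms'"
    by (rule nth_equalityI) (use full_length[OF ms] full_length[OF ms'] nth_eqI[OF ms ms'] st in auto)
qed

text \<open>States of different index have different numbers of blocks, so a chain with one rank
  omitted reveals that rank, and equal elements have equal index.\<close>

lemma omit_eqD:
  assumes ms: "ms \<in> MS" and ms': "ms' \<in> MS" and i: "1 \<le> i" "i < n - 1"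
      and i': "1 \<le> i'" "i' < n - 1"
    and eq: "omit i ms = omit i' ms'"
  shows "i' = i" "j \<le> n - 1 \<Longrightarrow> j \<noteq> i \<Longrightarrow> st ms j = st ms' j"
proof -
  have *: "st ms j = st ms' j \<and> j \<noteq> i'" if j: "1 \<le> j" "j < n - 1" "j \<noteq> i" for j
  proof -
    have "st ms j \<in> omit i ms" unfolding omit_def using j by auto
    then have "st ms j \<in> omit i' ms'" using eq by simp
    then obtain j' where j': "j' \<in> {1..<n - 1} - {i'}" "st ms j = st ms' j'"
      unfolding omit_def by blast
    then have "j = j'" using state_eq_iff[OF ms ms', of j j'] j by simp
    then show ?thesis using j' by simp
  qed
  show "i' = i" using *[OF i'] by blast
  show "st ms j = st ms' j" if "j \<le> n - 1" "j \<noteq> i"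
  proof (cases "j = 0 \<or> j = n - 1")
    case True
    then show ?thesis using full_ends[OF ms] full_ends[OF ms'] by auto
  next
    case False
    then show ?thesis using *[of j] that by simp
  qed
qed

text \<open>State \<open>i\<close> lies between move \<open>i - 1\<close> and move \<open>i\<close>,
  hence the successor.\<close>

lemma split_full:
  assumes "ms \<in> MS" "1 \<le> i" "i < n - 1"
  obtains us m m' vs where "ms = us @ [m, m'] @ vs" "i = Suc (length us)"
proof -
  have l: "length ms = n - 1" by (rule full_length[OF assms(1)])
  have "drop (i - 1) ms = ms ! (i - 1) # ms ! i # drop (Suc i) ms"
    using assms l Cons_nth_drop_Suc[of "i - 1" ms] Cons_nth_drop_Suc[of i ms] by simp
  then have "ms = take (i - 1) ms @ [ms ! (i - 1), ms ! i] @ drop (Suc i) ms"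
    using append_take_drop_id[of "i - 1" ms] by simp
  moreover have "i = Suc (length (take (i - 1) ms))" using assms l by simp
  ultimately show thesis by (rule that)
qed

abbreviation fill :: "move list \<Rightarrow> move list \<Rightarrow> move \<times> move \<Rightarrow> move list" where
  "fill us vs pq \<equiv> us @ [fst pq, snd pq] @ vs"

abbreviation pairs_at :: "move list \<Rightarrow> move \<Rightarrow> move \<Rightarrow> (move \<times> move) set" where
  "pairs_at us m m' \<equiv> pairs k (fold merge us (wbot n)) (merge m' (merge m (fold merge us (wbot n))))"

lemma inj_fill: "inj_on (fill us vs) S"
  by (rule inj_onI) (auto simp: prod_eq_iff)

lemma fill_full:
  assumes "us @ [m, m'] @ vs \<in> MS" "pq \<in> pairs_at us m m'"
  shows "fill us vs pq \<in> MS"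
  using assms by (auto simp: full_seqs_def valid_append pairs_def)

text \<open>The maximal chains over a face lacking rank \<open>i\<close> share all states but one.
  By \<open>step_unique\<close> they share all moves except the two around the gap, and these run
  through an interval of length two.\<close>

lemma fiber:
  assumes ms: "us @ [m, m'] @ vs \<in> MS" and i: "i = Suc (length us)"
  shows "{ms' \<in> MS. omit i ms' = omit i (us @ [m, m'] @ vs)} = fill us vs ` pairs_at us m m'"
proof (intro equalityI subsetI)
  let ?ms = "us @ [m, m'] @ vs" and ?\<pi> = "fold merge us (wbot n)"
  have len: "length us + 2 + length vs = n - 1" using full_length[OF ms] by simp
  have i1: "1 \<le> i" "i < n - 1" using len i by auto
  {
    fix ms' assume "ms' \<in> fill us vs ` pairs_at us m m'"
    then obtain pq where pq: "pq \<in> pairs_at us m m'" "ms' = fill us vs pq" by auto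
    have "ms' \<in> MS" unfolding pq(2) by (rule fill_full[OF ms pq(1)])
    moreover have "st ms' j = st ?ms j" if "j \<noteq> i" for j
    proof (cases "j \<le> length us")
      case True
      then show ?thesis by (simp add: state_def pq(2))
    next
      case False
      then obtain d where "j = length us + 2 + d"
        using \<open>j \<noteq> i\<close> i by (metis add_2_eq_Suc' le_add_diff_inverse not_less_eq_eq le_antisym not_less)
      then show ?thesis using pq(1) by (auto simp: state_def pq(2) pairs_def)
    qed
    ultimately show "ms' \<in> {ms' \<in> MS. omit i ms' = omit i ?ms}"
      by (auto simp: omit_def intro!: image_cong)
  }
  fix ms' assume "ms' \<in> {ms' \<in> MS. omit i ms' = omit i ?ms}"
  then have ms': "ms' \<in> MS" and eq: "omit i ms' = omit i ?ms" by auto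
  have st: "st ms' j = st ?ms j" if "j \<le> n - 1" "j \<noteq> i" for j
    by (rule omit_eqD(2)[OF ms' ms i1 i1 eq that])
  obtain us' p q vs' where sp: "ms' = us' @ [p, q] @ vs'" "i = Suc (length us')"
    by (rule split_full[OF ms' i1])
  have nth: "ms' ! j = ?ms ! j" if "j < n - 1" "j \<noteq> i" "Suc j \<noteq> i" for j
    by (rule nth_eqI[OF ms' ms that(1)]) (use that st in auto)
  have lens: "length us' = length us" "length vs' = length vs"
    using sp i len full_length[OF ms'] by auto
  have us: "us' = us"
  proof (rule nth_equalityI[OF lens(1)])
    fix j assume "j < length us'"
    then show "us' ! j = us ! j" using nth[of j] sp lens len by (simp add: nth_append)
  qed
  have vs: "vs' = vs"
  proof (rule nth_equalityI[OF lens(2)])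
    fix j assume "j < length vs'"
    then show "vs' ! j = vs ! j"
      using nth[of "length us + 2 + j"] sp lens len i by (simp add: nth_append)
  qed
  have "(p, q) \<in> pairs_at us m m'"
  proof -
    have "valid k (wbot n) ms'" using ms' by (simp add: full_seqs_def)
    then have "step_ok k ?\<pi> p" "step_ok k (merge p ?\<pi>) q"
      by (simp_all add: sp(1) us valid_append)
    moreover have "merge q (merge p ?\<pi>) = merge m' (merge m ?\<pi>)"
      using st[of "Suc i"] i i1 by (simp add: state_def sp(1) us)
    ultimately show ?thesis by (simp add: pairs_def)
  qed
  then show "ms' \<in> fill us vs ` pairs_at us m m'"
    unfolding sp(1) us vs by (intro image_eqI[of _ _ "(p, q)"]) auto
qed

abbreviation \<delta> :: "(wpart set \<Rightarrow> 'a::field) \<Rightarrow> wpart set \<Rightarrow> 'a" where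
  "\<delta> \<equiv> coboundary P leq (wbot n) (wtop n \<mu>) (int n - 4)"

abbreviation Z_top :: "(wpart set \<Rightarrow> 'a::field) set" where
  "Z_top \<equiv> cocycles P leq (wbot n) (wtop n \<mu>) (int n - 3)"

abbreviation B_top :: "(wpart set \<Rightarrow> 'a::field) set" where
  "B_top \<equiv> coboundaries P leq (wbot n) (wtop n \<mu>) (int n - 3)"

text \<open>The position of a vertex in the chain is given by its index, so the sign depends only on
  the omitted index. It is common to all chains over the same face, which makes the relations in top
  degree unsigned sums over fibers.\<close>

lemma coboundary_open_chain:
  assumes ms: "ms \<in> MS"
  shows "\<delta> g (open_chain n \<mu> ms) = (\<Sum>i\<in>{1..<n - 1}. (- 1) ^ (i - 1) * g (omit i ms))"
proof -
  let ?c = "open_chain n \<mu> ms"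
  have face: "?c \<in> Faces (int n - 4 + 1)" using faces_top ms by simp
  have inj: "inj_on (st ms) {1..<n - 1}" by (rule inj_on_subset[OF inj_on_state[OF ms]]) auto
  have pos: "card {w \<in> ?c. leq w (st ms i) \<and>
      w \<noteq> st ms i} = i - 1" if i: "i \<in> {1..<n - 1}" for i
  proof -
    have "{w \<in> ?c. leq w (st ms i) \<and> w \<noteq> st ms i} = st ms ` {1..<i}"
    proof (intro equalityI subsetI)
      fix w assume w: "w \<in> {w \<in> ?c. leq w (st ms i) \<and> w \<noteq> st ms i}"
      then have "w \<in> st ms ` {1..<n - 1}" by (simp add: open_chain_eq[OF ms])
      then obtain j where j: "w = st ms j" "1 \<le> j" "j < n - 1" by force
      then have "j \<le> i" "j \<noteq> i" using w full_wle_iff[OF ms, of j i] i by auto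
      then show "w \<in> st ms ` {1..<i}" using j by auto
    next
      fix w assume "w \<in> st ms ` {1..<i}"
      then obtain j where j: "w = st ms j" "1 \<le> j" "j < i" by auto
      then show "w \<in> {w \<in> ?c. leq w (st ms i) \<and> w \<noteq> st ms i}"
        using i full_wle[OF ms, of j i] state_eq_iff[OF ms ms, of j i] by (auto simp: open_chain_eq[OF ms])
    qed
    moreover have "inj_on (st ms) {1..<i}" by (rule inj_on_subset[OF inj]) (use i in auto)
    ultimately show ?thesis by (simp add: card_image)
  qed
  have "\<delta> g ?c = (\<Sum>z\<in>?c. (- 1) ^ card {w \<in> ?c. leq w z \<and>
      w \<noteq> z} * g (?c - {z}))"
    using face by (simp add: coboundary_def)
  also have "\<dots> = (\<Sum>i\<in>{1..<n - 1}. (- 1) ^ card {w \<in> ?c. leq w (st ms i) \<and>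
      w \<noteq> st ms i} * g (?c - {st ms i}))"
    by (subst (1) open_chain_eq[OF ms], subst sum.reindex[OF inj]) simp
  also have "\<dots> = (\<Sum>i\<in>{1..<n - 1}. (- 1) ^ (i - 1) * g (omit i ms))"
    by (rule sum.cong[OF refl]) (use pos omit_eq[OF ms] in auto)
  finally show ?thesis .
qed

lemma Z_top_eq: "(Z_top :: (wpart set \<Rightarrow> 'a::field) set) =
    {f. \<forall>c. f c \<noteq> 0 \<longrightarrow> c \<in> open_chain n \<mu> ` MS}"
proof -
  have "coboundary P leq (wbot n) (wtop n \<mu>) (int n - 3) f =
      (\<lambda>c. 0)" for f :: "wpart set \<Rightarrow> 'a"
    using no_faces_above by (auto simp: coboundary_def)
  then show ?thesis by (simp add: cocycles_def cochains_def faces_top)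
qed

lemma B_top_eq: "(B_top :: (wpart set \<Rightarrow> 'a::field) set) =
    \<delta> ` cochains P leq (wbot n) (wtop n \<mu>) (int n - 4)"
  by (simp add: coboundaries_def)

lemma coboundary_outside: "c \<notin> open_chain n \<mu> ` MS \<Longrightarrow> \<delta> g c = 0"
  using faces_top by (simp add: coboundary_def)

lemma cohomology_quotient: "function_quotient (Z_top :: (wpart set \<Rightarrow> 'a::field) set) B_top"
proof
  show "(\<lambda>x. 0) \<in> (Z_top :: (wpart set \<Rightarrow> 'a) set)" by (simp add: Z_top_eq)
  show "(\<lambda>x. u x + v x) \<in> Z_top" if "u \<in> Z_top"
      "v \<in> Z_top" for u v :: "wpart set \<Rightarrow> 'a"
    using that unfolding Z_top_eq by (auto, metis add.right_neutral)
  show "(\<lambda>x. a * u x) \<in> Z_top" if "u \<in> Z_top" for a and u :: "wpart set \<Rightarrow> 'a"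
    using that unfolding Z_top_eq by auto
  show "B_top \<subseteq> (Z_top :: (wpart set \<Rightarrow> 'a) set)"
    unfolding B_top_eq Z_top_eq using coboundary_outside by fastforce
  let ?C = "cochains P leq (wbot n) (wtop n \<mu>) (int n - 4) :: (wpart set \<Rightarrow> 'a) set"
  have "\<delta> (\<lambda>c. 0) = (\<lambda>x. 0 :: 'a)" by (auto simp: coboundary_def)
  moreover have "(\<lambda>c. 0) \<in> ?C" by (simp add: cochains_def)
  ultimately show "(\<lambda>x. 0) \<in> (B_top :: (wpart set \<Rightarrow> 'a) set)"
    unfolding B_top_eq by (metis imageI)
  show "(\<lambda>x. u x + v x) \<in> B_top" if uv: "u \<in> B_top"
      "v \<in> B_top" for u v :: "wpart set \<Rightarrow> 'a"
  proof -
    obtain f g where fg: "f \<in> ?C" "g \<in> ?C" "u = \<delta> f" "v = \<delta> g"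
      using uv unfolding B_top_eq by blast
    then have "(\<lambda>c. f c + g c) \<in> ?C" by (auto simp: cochains_def) (metis add.right_neutral)
    moreover have "(\<lambda>x. u x + v x) = \<delta> (\<lambda>c. f c + g c)"
      by (auto simp: fg coboundary_def distrib_left sum.distrib)
    ultimately show ?thesis unfolding B_top_eq by blast
  qed
  show "(\<lambda>x. a * u x) \<in> B_top" if u: "u \<in> B_top" for a and u :: "wpart set \<Rightarrow> 'a"
  proof -
    obtain f where f: "f \<in> ?C" "u = \<delta> f" using u unfolding B_top_eq by blast
    then have "(\<lambda>c. a * f c) \<in> ?C" by (auto simp: cochains_def)
    moreover have "(\<lambda>x. a * u x) = \<delta> (\<lambda>c. a * f c)"
      by (auto simp: f coboundary_def sum_distrib_left mult.left_commute)
    ultimately show ?thesis unfolding B_top_eq by blast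
  qed
qed

lemma finite_pairs_at:
  assumes "us @ [m, m'] @ vs \<in> MS"
  shows "finite (pairs_at us m m')"
proof (rule finite_imageD[OF _ inj_fill])
  show "finite (fill us vs ` pairs_at us m m')"
    using fill_full[OF assms] by (intro finite_subset[OF _ finite_full]) auto
qed

lemma pairs_sum_coboundary:
  assumes ms: "us @ [m, m'] @ vs \<in> MS"
  shows "(\<lambda>c. \<Sum>pq\<in>pairs_at us m m'. face_indicator (open_chain n \<mu> (fill us vs pq)) c :: 'a::field) \<in> B_top"
proof -
  define i where "i = Suc (length us)"
  let ?ms = "us @ [m, m'] @ vs"
  have i: "1 \<le> i" "i < n - 1" using full_length[OF ms] by (auto simp: i_def)
  \<comment> \<open>The scalar cancels the sign that the coboundary attaches to index
    \<open>i\<close>.\<close>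
  define g :: "wpart set \<Rightarrow> 'a" where "g c = (- 1) ^ (i - 1) * face_indicator (omit i ?ms) c" for c
  have "omit i ?ms \<subseteq> open_chain n \<mu> ?ms" unfolding omit_eq[OF ms i, symmetric] by auto
  moreover have "card (omit i ?ms) = n - 3"
  proof -
    have "st ?ms i \<in> open_chain n \<mu> ?ms" unfolding open_chain_eq[OF ms] using i by (intro imageI) auto
    moreover have "finite (open_chain n \<mu> ?ms)" unfolding open_chain_eq[OF ms] by simp
    ultimately show ?thesis
      unfolding omit_eq[OF ms i, symmetric] using card_open_chain[OF ms] by simp
  qed
  moreover have "int (n - 3) - 1 = int n - 4" using i by simp
  ultimately have "omit i ?ms \<in> Faces (int n - 4)"
    using open_chain_face[OF ms, of "omit i ?ms"] i by auto
  then have "g \<in> cochains P leq (wbot n) (wtop n \<mu>) (int n - 4)"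
    by (auto simp: cochains_def g_def face_indicator_def)
  moreover have "(\<lambda>c. \<Sum>pq\<in>pairs_at us m m'. face_indicator (open_chain n \<mu> (fill us vs pq)) c) = \<delta> g"
  proof
    fix c
    show "(\<Sum>pq\<in>pairs_at us m m'. face_indicator (open_chain n \<mu> (fill us vs pq)) c) =
        \<delta> g c"
    proof (cases "c \<in> open_chain n \<mu> ` MS")
      case False
      then have "face_indicator (open_chain n \<mu> (fill us vs pq)) c = (0 :: 'a)" if "pq
          \<in> pairs_at us m m'" for pq
        using fill_full[OF ms that] by (auto simp: face_indicator_def)
      then show ?thesis unfolding coboundary_outside[OF False] by (intro sum.neutral ballI)
    next
      case True
      then obtain ms' where ms': "ms' \<in> MS" "c = open_chain n \<mu> ms'" by auto
      have "(\<Sum>pq\<in>pairs_at us m m'. face_indicator (open_chain n \<mu> (fill us vs pq)) c)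
          = (\<Sum>ms''\<in>fill us vs ` pairs_at us m m'. if ms'' = ms' then 1 else 0 :: 'a)"
        unfolding sum.reindex[OF inj_fill] o_def
        by (rule sum.cong[OF refl])
          (use fill_full[OF ms] inj_on_eq_iff[OF open_chain_inj ms'(1)]
              in \<open>auto simp: face_indicator_def ms'(2)\<close>)
      also have "\<dots> = (if omit i ms' = omit i ?ms then 1 else 0)"
        using finite_pairs_at[OF ms] ms'(1) unfolding fiber[OF ms i_def, symmetric]
        by (subst sum.delta) (auto intro: finite_subset[OF _ finite_full])
      also have "\<dots> = (\<Sum>j\<in>{1..<n - 1}. if j = i then (if omit i ms' =
          omit i ?ms then 1 else 0) else 0)"
        using i by simp
      also have "\<dots> = (\<Sum>j\<in>{1..<n - 1}. (- 1) ^ (j - 1) * g (omit j ms'))"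
      proof (rule sum.cong[OF refl])
        fix j assume j: "j \<in> {1..<n - 1}"
        have "omit j ms' \<noteq> omit i ?ms" if "j \<noteq> i"
          using omit_eqD(1)[OF ms'(1) ms _ _ i, of j] j that by auto
        then show "(if j = i then (if omit i ms' = omit i ?ms then 1 else 0) else 0) =
            (- 1) ^ (j - 1) * g (omit j ms')"
          by (auto simp: g_def face_indicator_def simp flip: power_add power_mult_distrib)
      qed
      also have "\<dots> = \<delta> g c" unfolding ms'(2) coboundary_open_chain[OF ms'(1)] ..
      finally show ?thesis .
    qed
  qed
  ultimately show ?thesis unfolding B_top_eq by blast
qed

text \<open>Exchanging sums and grouping the chains by the face left after omitting rank
  \<open>i\<close> gives, for each such face, a multiple of the sum of \<open>\<epsilon>\<close>
  over its fiber.\<close>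

lemma coboundary_orthogonal:
  fixes \<epsilon> :: "move list \<Rightarrow> 'a::field"
  assumes \<epsilon>: "\<And>us m m' vs. us @ [m, m'] @ vs \<in> MS \<Longrightarrow>
      (\<Sum>pq\<in>pairs_at us m m'. \<epsilon> (fill us vs pq)) = 0"
    and h: "h \<in> B_top"
  shows "(\<Sum>ms\<in>MS. h (open_chain n \<mu> ms) * \<epsilon> ms) = 0"
proof -
  obtain g where g: "h = \<delta> g" using h unfolding B_top_eq by blast
  have inner: "(\<Sum>ms\<in>MS. g (omit i ms) * \<epsilon> ms) = 0" if i: "i \<in> {1..<n - 1}" for i
  proof -
    have "(\<Sum>ms\<in>MS. g (omit i ms) * \<epsilon> ms) =
        (\<Sum>y\<in>omit i ` MS. \<Sum>ms | ms \<in> MS \<and> omit i ms = y. g (omit i ms) * \<epsilon> ms)"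
      by (rule sum.image_gen[OF finite_full])
    also have "\<dots> = 0"
    proof (rule sum.neutral, rule ballI)
      fix y assume "y \<in> omit i ` MS"
      then obtain ms where ms: "ms \<in> MS" "y = omit i ms" by auto
      obtain us m m' vs where sp: "ms = us @ [m, m'] @ vs" "i = Suc (length us)"
        using split_full[OF ms(1)] i by (metis atLeastLessThan_iff)
      have "(\<Sum>ms | ms \<in> MS \<and> omit i ms = y. g (omit i ms) * \<epsilon> ms) =
          (\<Sum>ms\<in>fill us vs ` pairs_at us m m'. g y * \<epsilon> ms)"
        unfolding fiber[OF ms(1)[unfolded sp(1)] sp(2), symmetric]
        by (rule sum.cong) (auto simp: ms(2) sp(1))
      also have "\<dots> = g y * (\<Sum>pq\<in>pairs_at us m m'. \<epsilon> (fill us vs pq))"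
        unfolding sum.reindex[OF inj_fill] by (simp add: sum_distrib_left)
      also have "\<dots> = 0" using \<epsilon>[OF ms(1)[unfolded sp(1)]] by simp
      finally show "(\<Sum>ms | ms \<in> MS \<and> omit i ms = y. g (omit i ms) * \<epsilon> ms) = 0" .
    qed
    finally show ?thesis .
  qed
  have "(\<Sum>ms\<in>MS. h (open_chain n \<mu> ms) * \<epsilon> ms) =
      (\<Sum>ms\<in>MS. \<Sum>i\<in>{1..<n - 1}. (- 1) ^ (i - 1) * (g (omit i ms) * \<epsilon> ms))"
    by (rule sum.cong[OF refl]) (simp add: g coboundary_open_chain sum_distrib_right mult.assoc)
  also have "\<dots> = (\<Sum>i\<in>{1..<n - 1}. (- 1) ^ (i -
      1) * (\<Sum>ms\<in>MS. g (omit i ms) * \<epsilon> ms))"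
    by (subst sum.swap) (simp add: sum_distrib_left)
  also have "\<dots> = 0" using inner by simp
  finally show ?thesis .
qed

end

section \<open>Signs of chains and exchanges of independent merges\<close>

fun inv_sign :: "nat list \<Rightarrow> 'a::comm_ring_1" where
  "inv_sign [] = 1"
| "inv_sign (x # xs) = (- 1) ^ length (filter (\<lambda>y. y < x) xs) * inv_sign xs"

lemma inv_sign_swap:
  "x \<noteq> y \<Longrightarrow> inv_sign (us @ x # y # vs) = - inv_sign (us @ y # x # vs)"
  by (induction us) auto

lemma inv_sign_square: "inv_sign xs * inv_sign xs = (1 :: 'a::comm_ring_1)"
proof (induction xs)
  case (Cons x xs)
  have "inv_sign (x # xs) * inv_sign (x # xs) = ((- 1) ^ length (filter (\<lambda>y. y < x) xs) *
     (- 1) ^ length (filter (\<lambda>y. y < x) xs)) * (inv_sign xs * inv_sign xs :: 'a)"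
    by (simp only: inv_sign.simps ac_simps)
  then show ?case using Cons by (simp flip: power_mult_distrib)
qed simp

text \<open>Merging \<open>A\<close> and \<open>B\<close> removes the minimum of \<open>B\<close> from the set of block minima; the sign of
  a maximal chain is that of the resulting permutation of \<open>{2..n}\<close>.\<close>

definition removed :: "move \<Rightarrow> nat" where
  "removed m = Min (snd (snd m))"

definition seq_sign :: "move list \<Rightarrow> 'a::comm_ring_1" where
  "seq_sign ms = inv_sign (map removed ms)"

lemma seq_sign_square: "seq_sign ms * seq_sign ms = (1 :: 'a::comm_ring_1)"
  by (simp add: seq_sign_def inv_sign_square)

lemma seq_sign_swap:
  "removed m \<noteq> removed m' \<Longrightarrow> seq_sign (us @ m # m' # vs) = - seq_sign (us
      @ m' # m # vs)"
  unfolding seq_sign_def map_append list.map by (rule inv_sign_swap)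

text \<open>On full sequences these exchanges keep the tree of merges (\<open>tree_of_swap\<close>)
  and change only the order in which its nodes are visited; they serve to reach postorder.\<close>

inductive swap_step :: "move list \<Rightarrow> move list \<Rightarrow> bool" where
  "indep m m' \<Longrightarrow> swap_step (us @ m # m' # vs) (us @ m' # m # vs)"

abbreviation swaps :: "move list \<Rightarrow> move list \<Rightarrow> bool" where
  "swaps \<equiv> swap_step\<^sup>*\<^sup>*"

lemma swap_step_context: "swap_step xs ys \<Longrightarrow> swap_step (us @ xs @ vs) (us @ ys @ vs)"
proof (induction rule: swap_step.induct)
  case (1 m m' us' vs')
  from swap_step.intros[OF 1, of "us @ us'" "vs' @ vs"] show ?case by simp
qed

lemma swaps_context: "swaps xs ys \<Longrightarrow> swaps (us @ xs @ vs) (us @ ys @ vs)"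
  by (induction rule: rtranclp_induct) (auto intro: swap_step_context rtranclp.rtrancl_into_rtrancl)

lemma swaps_append: "swaps xs xs' \<Longrightarrow> swaps ys ys' \<Longrightarrow>
    swaps (xs @ ys) (xs' @ ys')"
  using swaps_context[of xs xs' "[]" ys] swaps_context[of ys ys' xs' "[]"] by simp

lemma swaps_past: "(\<And>w. w \<in> set ws \<Longrightarrow> indep m w) \<Longrightarrow>
    swaps (m # ws) (ws @ [m])"
proof (induction ws)
  case (Cons w ws)
  have "swap_step (m # w # ws) (w # m # ws)"
    using swap_step.intros[of m w "[]" ws] Cons.prems by simp
  moreover have "swaps (w # m # ws) (w # ws @ [m])"
    using swaps_context[OF Cons.IH, of "[w]" "[]"] Cons.prems by simp
  ultimately show ?case by simp
qed simp

lemma swaps_blocks: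
  "(\<And>v w. v \<in> set vs \<Longrightarrow> w \<in> set ws \<Longrightarrow>
      indep v w) \<Longrightarrow> swaps (vs @ ws) (ws @ vs)"
proof (induction vs)
  case (Cons v vs)
  have "swaps (v # vs @ ws) (v # ws @ vs)"
    using swaps_context[OF Cons.IH, of "[v]" "[]"] Cons.prems by simp
  moreover have "swaps (v # ws @ vs) (ws @ v # vs)"
    using swaps_context[OF swaps_past[of ws v], of "[]" vs] Cons.prems by simp
  ultimately show ?case by simp
qed simp

text \<open>Stable sorting: a member with \<open>q\<close> moves past the later members with
  \<open>p\<close>, while each class keeps its internal order.\<close>

lemma swaps_partition:
  assumes "\<And>w. w \<in> set ws \<Longrightarrow> p w \<noteq> q w"
    and "\<And>v w. v \<in> set ws \<Longrightarrow> w \<in> set ws \<Longrightarrow>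
        p v \<Longrightarrow> q w \<Longrightarrow> indep w v"
  shows "swaps ws (filter p ws @ filter q ws)"
  using assms
proof (induction ws)
  case (Cons w ws)
  have "swaps (w # ws) (w # filter p ws @ filter q ws)"
    using swaps_context[OF Cons.IH, of "[w]" "[]"] Cons.prems by simp
  moreover have "swaps (w # filter p ws @ filter q ws) (filter p ws @ w # filter q ws)" if "q w"
    using swaps_context[OF swaps_past[of "filter p ws" w], of "[]" "filter q ws"] Cons.prems that by simp
  ultimately show ?case using Cons.prems(1)[of w] by (cases "q w") auto
qed simp

context weighted_interval
begin

text \<open>Two chains that differ by exchanging independent merges add up to a coboundary; since
  the exchange also reverses \<open>seq_sign\<close>, the signed chains are congruent modulo
  coboundaries.\<close>

definition signed_chain :: "move list \<Rightarrow> wpart set \<Rightarrow> 'a::field" where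
  "signed_chain ms = (\<lambda>c. seq_sign ms * face_indicator (open_chain n \<mu> ms) c)"

lemma indep_steps:
  assumes \<pi>: "\<pi> \<in> P" and m: "step_ok k \<pi> m" "step_ok k (merge m \<pi>) m'"
      and ind: "indep m m'"
  shows "step_ok k \<pi> m'" "removed m \<noteq> removed m'" "m \<noteq> m'"
proof -
  obtain r A B a b where mm: "m = (r, A, B)" and ab: "(A, a) \<in> \<pi>" "(B, b) \<in> \<pi>"
    using m(1) by (auto elim: step_okE)
  note B = wpart_blockD(2,3)[OF \<pi> ab(2)]
  show m': "step_ok k \<pi> m'"
  proof (rule two_steps_cases[OF \<pi> m])
    fix X Y Z x y z r s
    assume XYZ: "(X, x) \<in> \<pi>" "(Y, y) \<in> \<pi>" "(Z, z) \<in> \<pi>"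
        "(m, m') \<in> set (triples r s X Y Z)"
    have "X \<noteq> {}" "Y \<noteq> {}" "Z \<noteq> {}" using wpart_blockD(2)[OF \<pi>] XYZ by blast+
    then have "\<not> indep m m'" using XYZ(4) by (auto simp: triples_def indep_def)
    then show ?thesis using ind by blast
  qed
  obtain s C D c d where mm': "m' = (s, C, D)" and cd: "(C, c) \<in> \<pi>" "(D, d) \<in> \<pi>"
    using m' by (auto elim: step_okE)
  note D = wpart_blockD(2,3)[OF \<pi> cd(2)]
  have "B \<inter> D = {}" using ind by (auto simp: indep_def mm mm')
  then show ne: "removed m \<noteq> removed m'"
    using Min_in[OF B(2,1)] Min_in[OF D(2,1)] by (auto simp: removed_def mm mm')
  then show "m \<noteq> m'" by auto
qed

lemma split_steps:
  assumes "us @ [m, m'] @ vs \<in> MS"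
  shows "fold merge us (wbot n) \<in> P" "step_ok k (fold merge us (wbot n)) m"
    "step_ok k (merge m (fold merge us (wbot n))) m'"
proof -
  have "valid k (wbot n) (us @ [m, m'] @ vs)" using assms by (simp add: full_seqs_def)
  then show "step_ok k (fold merge us (wbot n)) m" "step_ok k (merge m (fold merge us (wbot n))) m'"
    "fold merge us (wbot n) \<in> P"
    using valid_wpart[OF wbot_wpart[of n k], of us] by (simp_all add: valid_append)
qed

lemma swap_full:
  assumes "us @ [m, m'] @ vs \<in> MS" "indep m m'"
  shows "us @ [m', m] @ vs \<in> MS" "pairs_at us m m' = {(m, m'), (m', m)}" "m \<noteq> m'"
    "seq_sign (us @ [m, m'] @ vs) = - (seq_sign (us @ [m', m] @ vs) :: 'a::comm_ring_1)"
proof -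
  note sp = split_steps[OF assms(1)]
  note ind = indep_steps[OF sp assms(2)]
  show p: "pairs_at us m m' = {(m, m'), (m', m)}"
    by (rule pairs_indep[OF sp(1,2) ind(1) assms(2)])
  then show "us @ [m', m] @ vs \<in> MS" using fill_full[OF assms(1), of "(m', m)"] by simp
  show "m \<noteq> m'" by (rule ind(3))
  show "seq_sign (us @ [m, m'] @ vs) = - (seq_sign (us @ [m', m] @ vs) :: 'a)"
    using seq_sign_swap[OF ind(2)] by simp
qed

lemma B_top_add: "u \<in> B_top \<Longrightarrow> v \<in> B_top \<Longrightarrow>
    (\<lambda>x. u x + v x) \<in> (B_top :: (wpart set \<Rightarrow> 'a::field) set)"
  by (rule function_quotient.add_W[OF cohomology_quotient])

lemma B_top_smult: "u \<in> B_top \<Longrightarrow> (\<lambda>x. a * u x)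
    \<in> (B_top :: (wpart set \<Rightarrow> 'a::field) set)"
  by (rule function_quotient.smult_W[OF cohomology_quotient])

lemma B_top_zero: "(\<lambda>x. 0) \<in> (B_top :: (wpart set \<Rightarrow> 'a::field) set)"
  by (rule function_quotient.zero_W[OF cohomology_quotient])

lemma swap_step_full:
  assumes "swap_step ms ms'" "ms \<in> MS"
  shows "ms' \<in> MS" "(\<lambda>c. signed_chain ms c - signed_chain ms' c :: 'a::field) \<in> B_top"
proof -
  obtain m m' us vs where ms: "indep m m'" "ms = us @ [m, m'] @ vs" "ms' = us @ [m', m] @ vs"
    using assms(1) by (auto elim: swap_step.cases)
  note MS = assms(2)[unfolded ms(2)]
  note sw = swap_full[OF MS ms(1)]
  show "ms' \<in> MS" unfolding ms(3) by (rule sw(1))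
  have "(\<lambda>c. face_indicator (open_chain n \<mu> ms) c +
      face_indicator (open_chain n \<mu> ms') c :: 'a) \<in> B_top"
    using pairs_sum_coboundary[OF MS, where 'a = 'a] sw(3) unfolding sw(2) by (simp add: ms)
  note B = B_top_smult[OF this, of "seq_sign ms"]
  have sg: "seq_sign ms' = (- seq_sign ms :: 'a)" using sw(4)[where 'a = 'a] by (simp add: ms)
  have "(\<lambda>c. signed_chain ms c - signed_chain ms' c :: 'a) =
      (\<lambda>c. seq_sign ms * (face_indicator (open_chain n \<mu> ms) c +
          face_indicator (open_chain n \<mu> ms') c))"
    by (rule ext) (simp add: signed_chain_def sg algebra_simps)
  then show "(\<lambda>c. signed_chain ms c - signed_chain ms' c :: 'a) \<in> B_top" using B by simp
qed

lemma swaps_full: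
  assumes "swaps ms ms'" "ms \<in> MS"
  shows "ms' \<in> MS \<and> (\<lambda>c. signed_chain ms c - signed_chain ms' c :: 'a::field) \<in> B_top"
  using assms
proof (induction rule: rtranclp_induct)
  case base
  then show ?case by (simp add: B_top_zero)
next
  case (step y z)
  then have y: "y \<in> MS" "(\<lambda>c. signed_chain ms c - signed_chain y c :: 'a) \<in> B_top" by auto
  note z = swap_step_full[OF step.hyps(2) y(1)]
  show ?case using z(1) B_top_add[OF y(2) z(2)] by simp
qed

text \<open>The first and third ways of merging remove \<open>Min Z\<close> before
  \<open>Min Y\<close>, the second removes them in the opposite order. The signs of \<open>T\<close>
  therefore undo those of \<open>signed_chain\<close>, and \<open>T\<close> is a constant multiple
  of the unsigned sum over a fiber, or over one half of it when the colors differ.\<close>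

lemma triples_B_top:
  assumes XYZ: "(X, x) \<in> fold merge us (wbot n)" "(Y, y) \<in> fold merge us (wbot n)"
      "(Z, z) \<in> fold merge us (wbot n)"
    and less: "Min X < Min Y" "Min Y < Min Z"
    and mm: "(m, m') \<in> set (triples r s X Y Z)" and MS: "us @ [m, m'] @ vs \<in> MS"
    and rs: "r \<in> {1..k}" "s \<in> {1..k}"
  defines "T \<equiv> \<lambda>r s c. signed_chain (us @ [(r, Y, Z), (s, X, Y \<union> Z)] @ vs) c
      - signed_chain (us @ [(r, X, Y), (s, X \<union> Y, Z)] @ vs) c
      + signed_chain (us @ [(r, X, Z), (s, X \<union> Z, Y)] @ vs) c :: 'a::field"
  shows "r = s \<Longrightarrow> T r s \<in> B_top"
      "r \<noteq> s \<Longrightarrow> (\<lambda>c. T r s c + T s r c) \<in> B_top"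
proof -
  let ?\<pi> = "fold merge us (wbot n)"
  note sp = split_steps[OF MS]
  note fin = wpart_blockD(2,3)[OF sp(1) XYZ(1)] wpart_blockD(2,3)[OF sp(1) XYZ(2)]
    wpart_blockD(2,3)[OF sp(1) XYZ(3)]
  have mins: "Min (Y \<union> Z) = Min Y"
    using fin less by (simp_all add: Min_Un)
  have neq: "X \<noteq> Y" "X \<noteq> Z" "Y \<noteq> Z" "Y \<noteq> X" "Z \<noteq> X"
      "Z \<noteq> Y" using less by auto
  define \<chi> where "\<chi> pq c = (face_indicator (open_chain n \<mu> (fill us vs pq)) c :: 'a)" for pq c
  define \<sigma> where "\<sigma> = (inv_sign (map removed us @ Min Z # Min Y # map removed vs) :: 'a)"
  have T: "T r s c = \<sigma> * (\<Sum>pq\<in>set (triples r s X Y Z). \<chi> pq c)" for r s c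
  proof -
    have "inv_sign (map removed us @ Min Y # Min Z # map removed vs) = - \<sigma>"
      unfolding \<sigma>_def by (rule inv_sign_swap) (use less in auto)
    then show ?thesis
      using neq by (simp add: T_def signed_chain_def seq_sign_def removed_def mins triples_def \<chi>_def
          \<sigma>_def[symmetric] algebra_simps)
  qed
  have sum: "(\<lambda>c. \<Sum>pq\<in>set (triples r s X Y Z)
      \<union> set (triples s r X Y Z). \<chi> pq c) \<in> B_top"
    using pairs_sum_coboundary[OF MS, where 'a = 'a]
    unfolding pairs_triples[OF sp(1) XYZ less rs mm] \<chi>_def .
  show "T r s \<in> B_top" if "r = s"
    using B_top_smult[OF sum, of \<sigma>] that by (simp add: T[abs_def])
  show "(\<lambda>c. T r s c + T s r c) \<in> B_top" if "r \<noteq> s"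
  proof -
    have "set (triples r s X Y Z) \<inter> set (triples s r X Y Z) = {}"
      using that by (auto simp: triples_def)
    then have "(\<Sum>pq\<in>set (triples r s X Y Z) \<union> set (triples s r X Y Z). \<chi> pq c) =
       (\<Sum>pq\<in>set (triples r s X Y Z). \<chi> pq c) +
           (\<Sum>pq\<in>set (triples s r X Y Z). \<chi> pq c)" for c
      by (intro sum.union_disjoint) auto
    then show ?thesis using B_top_smult[OF sum, of \<sigma>] by (simp add: T distrib_left)
  qed
qed

end

section \<open>Chains of trees\<close>

definition orient :: "move \<Rightarrow> move" where
  "orient = (\<lambda>(r, A, B). if Min A < Min B then (r, A, B) else (r, B, A))"

definition orient_sign :: "nat set \<Rightarrow> nat set \<Rightarrow> 'a::comm_ring_1" where
  "orient_sign A B = (if Min A < Min B then 1 else - 1)"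

text \<open>Exchanging the children of a node leaves its oriented merge unchanged but negates the
  bracket; this sign records the parity of the nodes whose children are in the wrong order.\<close>

fun tree_sign :: "ctree \<Rightarrow> 'a::comm_ring_1" where
  "tree_sign (Leaf i) = 1"
| "tree_sign (Node j l r) = tree_sign l * tree_sign r * orient_sign (set (leaves l)) (set (leaves r))"

abbreviation moves :: "ctree \<Rightarrow> move list" where
  "moves t \<equiv> map orient (postorder t)"

lemma merge_orient: "merge (orient m) = merge m"
  by (cases m) (auto simp: orient_def merge_commute)

lemma tree_sign_square: "tree_sign t * tree_sign t = (1 :: 'a::comm_ring_1)"
proof (induction t)
  case (Node j l r)
  have "tree_sign (Node j l r) * tree_sign (Node j l r) = (tree_sign l * tree_sign l) *
      (tree_sign r * tree_sign r) * (orient_sign (set (leaves l)) (set (leaves r)) *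
      orient_sign (set (leaves l)) (set (leaves r)) :: 'a)"
    by (simp only: tree_sign.simps ac_simps)
  then show ?case using Node by (simp add: orient_sign_def)
qed simp

lemma Min_neq_disjoint:
  fixes A B :: "nat set"
  assumes "finite A" "A \<noteq> {}" "finite B" "B \<noteq> {}" "A \<inter> B = {}"
  shows "Min A \<noteq> Min B"
  using assms Min_in[of A] Min_in[of B] by (metis disjoint_iff)

lemma orient_swap:
  assumes "Min A \<noteq> Min B"
  shows "orient (r, A, B) = orient (r, B, A)" "orient_sign A B = - (orient_sign B A :: 'a::comm_ring_1)"
  using assms by (auto simp: orient_def orient_sign_def)

lemma orient_cases:
  "Min A < Min B \<Longrightarrow> orient (r, A, B) = (r, A, B)"
  "\<not> Min A < Min B \<Longrightarrow> orient (r, A, B) = (r, B, A)"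
  by (simp_all add: orient_def)

lemma orient_sign_cases:
  "Min A < Min B \<Longrightarrow> orient_sign A B = (1 :: 'a::comm_ring_1)"
  "\<not> Min A < Min B \<Longrightarrow> orient_sign A B = (- 1 :: 'a::comm_ring_1)"
  by (simp_all add: orient_sign_def)

lemma normalized_Min_less:
  assumes "normalized (Node j l r)" "distinct (leaves (Node j l r))"
  shows "Min (set (leaves l)) < Min (set (leaves r))"
proof -
  let ?A = "set (leaves l)" and ?B = "set (leaves r)"
  have d: "?A \<inter> ?B = {}" and ne: "?A \<noteq> {}" "?B \<noteq> {}" using assms(2) by auto
  have "Min (?A \<union> ?B) \<in> ?A" using assms(1) by simp
  moreover have mm: "Min (?A \<union> ?B) = min (Min ?A) (Min ?B)" using ne by (intro Min_Un) auto
  moreover have "Min ?B \<in> ?B" using ne by (intro Min_in) auto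
  ultimately have "min (Min ?A) (Min ?B) \<noteq> Min ?B" using d by (metis disjoint_iff)
  then show ?thesis by linarith
qed

lemma normalized_moves:
  assumes "normalized t" "distinct (leaves t)"
  shows "moves t = postorder t" "tree_sign t = (1 :: 'a::comm_ring_1)"
proof -
  have "moves t = postorder t \<and> tree_sign t = (1 :: 'a)"
    using assms
  proof (induction t)
    case (Node j l r)
    then show ?case
      using normalized_Min_less[OF Node.prems] by (auto simp: orient_def orient_sign_def)
  qed simp
  then show "moves t = postorder t" "tree_sign t = (1 :: 'a)" by auto
qed

lemma postorder_sub:
  "m \<in> set (postorder t) \<Longrightarrow> fst (snd m) \<union> snd (snd m) \<subseteq> set (leaves t)"
  by (induction t) auto

lemma moves_sub:
  assumes "(r, A, B) \<in> set (moves t)"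
  shows "A \<union> B \<subseteq> set (leaves t)"
proof -
  obtain m where m: "m \<in> set (postorder t)" "(r, A, B) = orient m"
    using assms unfolding set_map by blast
  obtain s C D where [simp]: "m = (s, C, D)" by (rule prod_cases3)
  have "A \<union> B = C \<union> D" using m(2) by (auto simp: orient_def split: if_splits)
  then show ?thesis using postorder_sub[OF m(1)] by simp
qed

lemma moves_indep:
  assumes "set (leaves t) \<inter> set (leaves t') = {}" "m \<in> set (moves t)" "m' \<in> set (moves t')"
  shows "indep m m'"
proof -
  obtain r A B s C D where m: "m = (r, A, B)" "m' = (s, C, D)" by (cases m; cases m') auto
  show ?thesis
    using moves_sub[of r A B t] moves_sub[of s C D t'] assms unfolding m indep_def by auto
qed

lemma swaps_trees:
  "set (leaves t) \<inter> set (leaves t') = {} \<Longrightarrow>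
      swaps (moves t @ moves t') (moves t' @ moves t)"
  by (rule swaps_blocks) (rule moves_indep)

text \<open>\<open>R\<close> holds the blocks that the subtree does not touch, which lets the
  induction apply to the right child after the left one has been merged.\<close>

lemma postorder_valid:
  assumes "distinct (leaves t)" "\<pi> \<in> wpartitions n k" "set (colors t) \<subseteq> {1..k}"
    and "\<pi> = R \<union> (\<lambda>i. ({i}, \<lambda>_. 0)) ` set (leaves t)"
    and "\<And>p. p \<in> R \<Longrightarrow> fst p \<inter> set (leaves t) = {}"
  shows "valid k \<pi> (moves t)"
    "fold merge (moves t) \<pi> = R \<union> {(set (leaves t), count_list (colors t))}"
proof -
  have "valid k \<pi> (moves t) \<and>
      fold merge (moves t) \<pi> = R \<union> {(set (leaves t), count_list (colors t))}"
    using assms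
  proof (induction t arbitrary: \<pi> R)
    case (Leaf i)
    then show ?case by (auto simp: fun_eq_iff)
  next
    case (Node j l r)
    let ?sing = "\<lambda>t. (\<lambda>i. ({i}, \<lambda>_. 0 :: nat)) ` set (leaves t)"
    let ?L = "(set (leaves l), count_list (colors l))" and ?R = "(set (leaves r), count_list (colors r))"
    have d: "distinct (leaves l)" "distinct (leaves r)" "set (leaves l) \<inter> set (leaves r) = {}"
      "set (colors l) \<subseteq> {1..k}" "set (colors r) \<subseteq> {1..k}" "j \<in> {1..k}"
      using Node.prems(1,3) by auto
    have 1: "valid k \<pi> (moves l) \<and> fold merge (moves l) \<pi> = (R \<union> ?sing r) \<union> {?L}"
      by (rule Node.IH(1)[OF d(1) Node.prems(2) d(4)]) (use Node.prems(4,5) d in auto)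
    then have P1: "(R \<union> ?sing r) \<union> {?L} \<in> wpartitions n k"
      using valid_wpart[OF Node.prems(2), of "moves l"] by metis
    have 2: "valid k ((R \<union> ?sing r) \<union> {?L}) (moves r) \<and>
        fold merge (moves r) ((R \<union> ?sing r) \<union> {?L}) = (R \<union> {?L}) \<union> {?R}"
      by (rule Node.IH(2)[OF d(2) P1 d(5)]) (use Node.prems(5) d in auto)
    then have P2: "(R \<union> {?L}) \<union> {?R} \<in> wpartitions n k"
      using valid_wpart[OF P1, of "moves r"] by metis
    let ?\<pi> = "(R \<union> {?L}) \<union> {?R}" and ?m = "orient (j, set (leaves l), set (leaves r))"
    have in\<pi>: "?L \<in> ?\<pi>" "?R \<in> ?\<pi>" by auto
    have neq: "Min (set (leaves l)) \<noteq> Min (set (leaves r))"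
      by (rule Min_neq_disjoint) (use d in auto)
    have ok: "step_ok k ?\<pi> ?m"
    proof (cases "Min (set (leaves l)) < Min (set (leaves r))")
      case True
      have "step_ok k ?\<pi> (j, set (leaves l), set (leaves r))"
        by (rule step_okI[OF in\<pi> True d(6)])
      then show ?thesis unfolding orient_cases(1)[OF True] .
    next
      case False
      have "step_ok k ?\<pi> (j, set (leaves r), set (leaves l))"
        by (rule step_okI[OF in\<pi>(2,1) _ d(6)]) (use False neq in linarith)
      then show ?thesis unfolding orient_cases(2)[OF False] .
    qed
    have mg: "merge ?m ?\<pi> = R \<union> {(set (leaves (Node j l r)), count_list (colors (Node j l r)))}"
    proof -
      have "?L \<notin> R" "?R \<notin> R"
        using Node.prems(5)[of ?L] Node.prems(5)[of ?R] leaves_nonempty[of l] leaves_nonempty[of r]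
        by auto
      then have "?\<pi> - {?L, ?R} = R" by auto
      moreover have "merged_weight (count_list (colors l)) (count_list (colors r)) j =
          count_list (colors (Node j l r))"
        by (auto simp: merged_weight_def)
      ultimately show ?thesis
        unfolding merge_orient merge_eq[OF P2 in\<pi>] by simp
    qed
    have ml: "moves (Node j l r) = moves l @ moves r @ [?m]" by simp
    have "fold merge (moves (Node j l r)) \<pi> = merge ?m ?\<pi>"
      unfolding ml fold_append o_apply using 1 2 by simp
    moreover have "valid k \<pi> (moves (Node j l r))"
      unfolding ml valid_append using 1 2 ok by simp
    ultimately show ?case unfolding mg by blast
  qed
  then show "valid k \<pi> (moves t)"
    "fold merge (moves t) \<pi> = R \<union> {(set (leaves t), count_list (colors t))}" by auto
qed

text \<open>The merges outside the hole see only the leaf set \<open>S\<close> of what fills it, so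
  the surrounding moves and the sign factor are the same for all fillings with that leaf
  set.\<close>

lemma ctx_postorder:
  assumes "ctx K"
  shows "\<exists>pre post c. \<forall>t. set (leaves t) = S \<longrightarrow>
    moves (K t) = pre @ moves t @ post \<and> tree_sign (K t) = c * (tree_sign t :: 'a::comm_ring_1)"
  using assms
proof (induction arbitrary: S)
  case hole
  show ?case by (intro exI[of _ "[]"] exI[of _ 1]) simp
next
  case (left K j r)
  obtain pre post c where *: "\<And>t. set (leaves t) = S \<union> set (leaves r) \<Longrightarrow>
    moves (K t) = pre @ moves t @ post \<and> tree_sign (K t) = c * (tree_sign t :: 'a)"
    using left.IH[of "S \<union> set (leaves r)"] by blast
  have "moves (K (Node j t r)) = pre @ moves t @ (moves r @ [orient (j, S, set (leaves r))] @ post) \<and>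
      tree_sign (K (Node j t r)) = (c * tree_sign r * orient_sign S (set (leaves r))) * (tree_sign t :: 'a)"
    if "set (leaves t) = S" for t
    using *[of "Node j t r"] that by simp
  then show ?case by blast
next
  case (right K j l)
  obtain pre post c where *: "\<And>t. set (leaves t) = set (leaves l) \<union> S \<Longrightarrow>
    moves (K t) = pre @ moves t @ post \<and> tree_sign (K t) = c * (tree_sign t :: 'a)"
    using right.IH[of "set (leaves l) \<union> S"] by blast
  have "moves (K (Node j l t)) = (pre @ moves l) @ moves t @ ([orient (j, set (leaves l), S)] @ post) \<and>
      tree_sign (K (Node j l t)) = (c * tree_sign l * orient_sign (set (leaves l)) S) * (tree_sign t :: 'a)"
    if "set (leaves t) = S" for t
    using *[of "Node j l t"] that by simp
  then show ?case by blast
qed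

section \<open>Lie relations among signed chains of trees\<close>

context weighted_interval
begin

abbreviation "TT \<equiv> labeled_trees_of_type n \<mu>"

definition tree_cochain :: "ctree \<Rightarrow> wpart set \<Rightarrow> 'a::field" where
  "tree_cochain t = (\<lambda>c. tree_sign t * signed_chain (moves t) c)"

lemma moves_full:
  assumes "t \<in> TT"
  shows "moves t \<in> MS"
proof -
  have t: "distinct (leaves t)" "set (leaves t) = {1..n}" "\<And>j. count_list (colors t) j = \<mu> j"
    using assms by (auto simp: labeled_trees_of_type_def labeled_trees_def)
  have c: "set (colors t) \<subseteq> {1..k}"
    using ctx_labeled_sub(3)[OF ctx.hole assms] \<mu>(2) by blast
  have w: "wbot n = {} \<union> (\<lambda>i. ({i}, \<lambda>_. 0)) ` set (leaves t)"
      by (simp add: wbot_def t(2))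
  have "valid k (wbot n) (moves t)"
    by (rule postorder_valid(1)[OF t(1) wbot_wpart c w]) simp
  moreover have "fold merge (moves t) (wbot n) = {} \<union> {(set (leaves t), count_list (colors t))}"
    by (rule postorder_valid(2)[OF t(1) wbot_wpart c w]) simp
  moreover have "count_list (colors t) = \<mu>" using t(3) by auto
  ultimately show ?thesis by (simp add: full_seqs_def wtop_def t(2))
qed

lemma open_tree_chain_eq: "open_tree_chain n \<mu> t = open_chain n \<mu> (moves t)"
proof -
  have "fold merge (map orient xs) = fold merge xs" for xs
    by (induction xs) (auto simp: merge_orient)
  then show ?thesis
    by (auto simp: open_tree_chain_def tree_chain_def open_chain_def state_def take_map)
qed

text \<open>Summing over the cyclic rotations of three blocks gives, up to sign, the full coboundary
  relation; both sides are antisymmetric in the blocks, so one may sort them.\<close>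

definition bracket_chain ::
    "move list \<Rightarrow> move list \<Rightarrow> nat \<Rightarrow> nat \<Rightarrow> nat set \<Rightarrow> nat set \<Rightarrow> nat set \<Rightarrow> wpart set \<Rightarrow> 'a::field" where
  "bracket_chain us vs i j A B C = (\<lambda>c. orient_sign B C * orient_sign A (B \<union> C) *
     signed_chain (us @ [orient (j, B, C), orient (i, A, B \<union> C)] @ vs) c)"

definition cyclic_sum ::
    "move list \<Rightarrow> move list \<Rightarrow> nat \<Rightarrow> nat \<Rightarrow> nat set \<Rightarrow> nat set \<Rightarrow> nat set \<Rightarrow> wpart set \<Rightarrow> 'a::field" where
  "cyclic_sum us vs i j A B C = (\<lambda>c. bracket_chain us vs i j A B C c
     + bracket_chain us vs i j C A B c + bracket_chain us vs i j B C A c)"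

lemma bracket_chain_swap:
  "Min B \<noteq> Min C \<Longrightarrow>
     bracket_chain us vs i j A C B = (\<lambda>c. - bracket_chain us vs i j A B C c :: 'a::field)"
  using orient_swap(1)[of C B j] orient_swap(2)[of C B, where 'a = 'a]
  by (auto simp: bracket_chain_def Un_commute[of C B])

lemma cyclic_sum_rotate: "cyclic_sum us vs i j B C A = cyclic_sum us vs i j A B C"
  by (simp add: cyclic_sum_def add.commute add.left_commute)

lemma cyclic_sum_swap:
  assumes "Min A \<noteq> Min B" "Min A \<noteq> Min C" "Min B \<noteq> Min C"
  shows "cyclic_sum us vs i j A C B = (\<lambda>c. - cyclic_sum us vs i j A B C c)"
  using assms by (simp add: cyclic_sum_def bracket_chain_swap[of B C] bracket_chain_swap[of A B]
      bracket_chain_swap[of C A] algebra_simps)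

text \<open>For increasing minima the orientation signs of the three summands are +, -, +, so the
  cyclic sum is the alternating sum of \<open>triples_B_top\<close>.\<close>

lemma cyclic_sum_sorted:
  assumes ABC: "(A, a) \<in> fold merge us (wbot n)" "(B, b) \<in> fold merge us (wbot n)"
      "(C, c) \<in> fold merge us (wbot n)"
    and less: "Min A < Min B" "Min B < Min C"
    and mm: "(m, m') \<in> set (triples j i A B C)" and MS: "us @ [m, m'] @ vs \<in> MS"
    and ij: "i \<in> {1..k}" "j \<in> {1..k}"
  shows "i = j \<Longrightarrow> cyclic_sum us vs i j A B C
      \<in> (B_top :: (wpart set \<Rightarrow> 'a::field) set)"
    "i \<noteq> j \<Longrightarrow> (\<lambda>c. cyclic_sum us vs i j A B C c +
        cyclic_sum us vs j i A B C c :: 'a) \<in> B_top"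
proof -
  note sp = split_steps[OF MS]
  note fin = wpart_blockD(2,3)[OF sp(1) ABC(1)] wpart_blockD(2,3)[OF sp(1) ABC(2)]
    wpart_blockD(2,3)[OF sp(1) ABC(3)]
  have mins: "Min (A \<union> B) = Min A" "Min (B \<union> C) = Min B"
      "Min (C \<union> A) = Min A" "Min (A \<union> C) = Min A"
    using Min_Un_less fin less by (simp_all add: Un_commute[of C A] del: Min_gr_iff Min_less_iff)
  have not_less: "\<not> Min C < Min (A \<union> B)" "\<not> Min C < Min A"
      "\<not> Min B < Min (C \<union> A)"
    and less': "Min A < Min (B \<union> C)"
    using less unfolding mins by linarith+
  have eq: "cyclic_sum us vs i j A B C = (\<lambda>c. signed_chain (us
      @ [(j, B, C), (i, A, B \<union> C)] @ vs) c
      - signed_chain (us @ [(j, A, B), (i, A \<union> B, C)] @ vs) c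
      + signed_chain (us @ [(j, A, C), (i, A \<union> C, B)] @ vs) c :: 'a)" for i j
    unfolding cyclic_sum_def bracket_chain_def orient_cases(1)[OF less(1)] orient_cases(1)[OF less(2)]
      orient_cases(1)[OF less'] orient_cases(2)[OF not_less(1)] orient_cases(2)[OF not_less(2)]
      orient_cases(2)[OF not_less(3)] orient_sign_cases(1)[OF less(1)] orient_sign_cases(1)[OF less(2)]
      orient_sign_cases(1)[OF less'] orient_sign_cases(2)[OF not_less(1)] orient_sign_cases(2)[OF not_less(2)]
      orient_sign_cases(2)[OF not_less(3)]
    by (simp add: Un_commute[of C A])
  note tr = triples_B_top[OF ABC less mm MS ij(2,1), where 'a = 'a]
  show "i = j \<Longrightarrow> cyclic_sum us vs i j A B C
      \<in> (B_top :: (wpart set \<Rightarrow> 'a::field) set)"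
    using tr(1) unfolding eq by blast
  show "i \<noteq> j \<Longrightarrow> (\<lambda>c. cyclic_sum us vs i j A B C c +
      cyclic_sum us vs j i A B C c :: 'a) \<in> B_top"
    using tr(2) unfolding eq by blast
qed

end

context weighted_interval
begin

lemma oriented_blocks:
  assumes MS: "us @ [orient (j, B, C), orient (i, A, B \<union> C)] @ vs \<in> MS"
      and dis: "A \<inter> (B \<union> C) = {}"
  obtains a b c where "(A, a) \<in> fold merge us (wbot n)" "(B, b) \<in> fold merge us (wbot n)"
    "(C, c) \<in> fold merge us (wbot n)" "B \<noteq> C" "i \<in> {1..k}" "j \<in> {1..k}"
proof -
  let ?\<pi> = "fold merge us (wbot n)"
  note sp = split_steps[OF MS]
  have 1: "B \<in> fst ` ?\<pi>" "C \<in> fst ` ?\<pi>" "B \<noteq> C" "j \<in> {1..k}"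
    using sp(2) by (auto simp: step_ok_def orient_def simp del: Min_gr_iff Min_less_iff split: if_splits)
  then obtain b c where bc: "(B, b) \<in> ?\<pi>" "(C, c) \<in> ?\<pi>" unfolding in_fst_image by blast
  have blocks: "fst ` merge (orient (j, B, C)) ?\<pi> = fst ` ?\<pi> - {B, C} \<union> {B \<union> C}"
    unfolding merge_orient by (rule merge_blocks[OF sp(1) bc])
  have 2: "A \<in> fst ` merge (orient (j, B, C)) ?\<pi>" "i \<in> {1..k}"
    using sp(3) by (auto simp: step_ok_def orient_def simp del: Min_gr_iff Min_less_iff split: if_splits)
  have "A \<noteq> B \<union> C" using dis wpart_blockD(2)[OF sp(1) bc(1)] by blast
  then have "A \<in> fst ` ?\<pi>" using 2(1) unfolding blocks by blast
  then obtain a where "(A, a) \<in> ?\<pi>" unfolding in_fst_image by blast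
  then show thesis using that bc 1 2 by blast
qed

lemma cyclic_sum_B_top:
  assumes MS: "us @ [orient (j, B, C), orient (i, A, B \<union> C)] @ vs \<in> MS"
      and dis: "A \<inter> (B \<union> C) = {}"
  shows "(i = j \<longrightarrow> cyclic_sum us vs i j A B C
      \<in> (B_top :: (wpart set \<Rightarrow> 'a::field) set)) \<and>
    (i \<noteq> j \<longrightarrow> (\<lambda>c. cyclic_sum us vs i j A B C c +
        cyclic_sum us vs j i A B C c :: 'a) \<in> B_top)"
proof -
  let ?\<pi> = "fold merge us (wbot n)"
  obtain a b c where abc: "(A, a) \<in> ?\<pi>" "(B, b) \<in> ?\<pi>" "(C, c) \<in> ?\<pi>"
      and BC: "B \<noteq> C"
    and ij: "i \<in> {1..k}" "j \<in> {1..k}"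
    by (rule oriented_blocks[OF MS dis])
  note \<pi> = split_steps(1)[OF MS]
  note fin = wpart_blockD(2,3)[OF \<pi> abc(1)] wpart_blockD(2,3)[OF \<pi> abc(2)]
      wpart_blockD(2,3)[OF \<pi> abc(3)]
  have neq: "Min A \<noteq> Min B" "Min A \<noteq> Min C" "Min B \<noteq> Min C"
    using wpart_Min_neq[OF \<pi> abc(1,2)] wpart_Min_neq[OF \<pi> abc(1,3)]
        wpart_Min_neq[OF \<pi> abc(2,3) BC]
      dis fin by blast+
  define good where "good A B C \<longleftrightarrow> (i =
      j \<longrightarrow> cyclic_sum us vs i j A B C
      \<in> (B_top :: (wpart set \<Rightarrow> 'a) set)) \<and>
    (i \<noteq> j \<longrightarrow> (\<lambda>c. cyclic_sum us vs i j A B C c +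
        cyclic_sum us vs j i A B C c :: 'a) \<in> B_top)" for A B C
  have rotate: "good B C A \<Longrightarrow> good A B C" for A B C
    by (simp add: good_def cyclic_sum_rotate)
  have swap: "good A B C" if "good A C B" "Min A \<noteq> Min B" "Min A \<noteq> Min C"
      "Min B \<noteq> Min C" for A B C
  proof -
    have "cyclic_sum us vs i j A C B = (\<lambda>c. - 1 * cyclic_sum us vs i j A B C c :: 'a)" for i j
      using cyclic_sum_swap[OF that(2-4)] by simp
    then have eq: "cyclic_sum us vs i j A B C = (\<lambda>c. -
        1 * cyclic_sum us vs i j A C B c :: 'a)" for i j
      by auto
    show ?thesis
      using that(1) B_top_smult[of "cyclic_sum us vs i j A C B" "- 1 :: 'a"]
        B_top_smult[of "\<lambda>c. cyclic_sum us vs i j A C B c + cyclic_sum us vs j i A C B c" "- 1 :: 'a"]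
      unfolding good_def eq by (cases "i = j") (simp_all add: algebra_simps)
  qed
  have sorted: "good X Y Z"
    if "(X, x) \<in> ?\<pi>" "(Y, y) \<in> ?\<pi>" "(Z, z) \<in> ?\<pi>" "Min X < Min Y" "Min Y < Min Z"
      "(orient (j, B, C), orient (i, A, B \<union> C)) \<in> set (triples j i X Y Z)" for X Y Z x y z
    using cyclic_sum_sorted[OF that MS ij, where 'a = 'a] by (simp add: good_def)
  have minBC: "Min (B \<union> C) = min (Min B) (Min C)" using fin by (intro Min_Un)
  \<comment> \<open>The first three orders are rotations of the sorted one; the last three need one
    exchange in addition.\<close>
  consider "Min A < Min B" "Min B < Min C" | "Min B < Min C" "Min C < Min A" | "Min C < Min A" "Min A < Min B"
    | "Min A < Min C" "Min C < Min B" | "Min C < Min B" "Min B < Min A" | "Min B < Min A" "Min A < Min C"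
    using neq by linarith
  then have "good A B C"
  proof cases
    case 1
    have m: "Min A < Min (B \<union> C)" using 1 unfolding minBC by linarith
    show ?thesis
      by (rule sorted[OF abc 1]) (simp add: orient_cases(1)[OF m] orient_cases(1)[OF 1(2)] triples_def)
  next
    case 2
    have m: "\<not> Min A < Min (B \<union> C)" using 2 unfolding minBC by linarith
    have "good B C A"
      by (rule sorted[OF abc(2,3,1) 2]) (simp add: orient_cases(2)[OF m] orient_cases(1)[OF 2(1)] triples_def)
    then show ?thesis by (rule rotate)
  next
    case 3
    have m: "\<not> Min A < Min (B \<union> C)" "\<not> Min B < Min C" using 3 unfolding minBC by linarith+
    have "good C A B"
      by (rule sorted[OF abc(3,1,2) 3])
        (simp add: orient_cases(2)[OF m(1)] orient_cases(2)[OF m(2)] triples_def Un_commute)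
    then show ?thesis by (rule rotate[OF rotate])
  next
    case 4
    have m: "Min A < Min (B \<union> C)" "\<not> Min B < Min C" using 4 unfolding minBC by linarith+
    have "good A C B"
      by (rule sorted[OF abc(1,3,2) 4])
        (simp add: orient_cases(1)[OF m(1)] orient_cases(2)[OF m(2)] triples_def Un_commute)
    then show ?thesis using neq by (rule swap)
  next
    case 5
    have m: "\<not> Min A < Min (B \<union> C)" "\<not> Min B < Min C" using 5 unfolding minBC by linarith+
    have "good C B A"
      by (rule sorted[OF abc(3,2,1) 5])
        (simp add: orient_cases(2)[OF m(1)] orient_cases(2)[OF m(2)] triples_def Un_commute)
    then have "good A C B" by (rule rotate)
    then show ?thesis using neq by (rule swap)
  next
    case 6
    have m: "\<not> Min A < Min (B \<union> C)" "Min B < Min C" using 6 unfolding minBC by linarith+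
    have "good B A C"
      by (rule sorted[OF abc(2,1,3) 6])
        (simp add: orient_cases(2)[OF m(1)] orient_cases(1)[OF m(2)] triples_def)
    then have "good A C B" by (rule rotate[OF rotate])
    then show ?thesis using neq by (rule swap)
  qed
  then show ?thesis by (simp add: good_def)
qed

text \<open>In postorder the merges inside \<open>a\<close>, \<open>b\<close>, \<open>c\<close>
  precede the two merges at the top. The assumption \<open>sw\<close> rearranges them into an order
  \<open>ws\<close> that can be chosen the same for all three cyclic rotations.\<close>

lemma tree_cochain_term:
  assumes T: "K (Node i a (Node j b c)) \<in> TT"
    and K: "\<And>t. set (leaves t) = set (leaves a) \<union> (set (leaves b)
        \<union> set (leaves c)) \<Longrightarrow>
      moves (K t) = pre @ moves t @ post \<and> tree_sign (K t) = \<kappa> * (tree_sign t :: 'a::field)"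
    and sw: "swaps (moves a @ moves b @ moves c) ws"
    and \<tau>: "tree_sign a * tree_sign b * tree_sign c = (\<tau> :: 'a)"
  defines "A \<equiv> set (leaves a)" and "B \<equiv> set (leaves b)" and "C \<equiv> set (leaves c)"
  shows "(pre @ ws) @ [orient (j, B, C), orient (i, A, B \<union> C)] @ post \<in> MS"
    "(\<lambda>x. tree_cochain (K (Node i a (Node j b c))) x
        - \<kappa> * \<tau> * bracket_chain (pre @ ws) post i j A B C x) \<in> B_top"
proof -
  let ?t = "Node i a (Node j b c)" and ?ms' = "(pre @ ws)
      @ [orient (j, B, C), orient (i, A, B \<union> C)] @ post"
  have Kt: "moves (K ?t) = pre @ moves ?t @ post" "tree_sign (K ?t) = \<kappa> * (tree_sign ?t :: 'a)"
    using K[of ?t] by simp_all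
  have "swaps (pre @ (moves a @ moves b @ moves c) @ ([orient (j, B, C), orient (i, A, B \<union> C)] @ post))
     (pre @ ws @ ([orient (j, B, C), orient (i, A, B \<union> C)] @ post))"
    by (rule swaps_context[OF sw])
  then have "swaps (moves (K ?t)) ?ms'"
    unfolding Kt by (simp add: A_def B_def C_def)
  from swaps_full[OF this moves_full[OF T], where 'a = 'a]
  have ms': "?ms' \<in> MS" and B: "(\<lambda>x. signed_chain (moves (K ?t)) x -
      signed_chain ?ms' x :: 'a) \<in> B_top"
    by auto
  show "?ms' \<in> MS" by (rule ms')
  have sign: "tree_sign (K ?t) = \<kappa> * \<tau> * orient_sign B C * (orient_sign A (B \<union> C) :: 'a)"
    unfolding Kt(2) \<tau>[symmetric] by (simp add: A_def B_def C_def ac_simps)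
  have "(\<lambda>x. tree_cochain (K ?t) x - \<kappa> * \<tau> * bracket_chain (pre @ ws) post i j A B C x) =
     (\<lambda>x. (\<kappa> * \<tau> * orient_sign B C * orient_sign A (B \<union> C))
         * (signed_chain (moves (K ?t)) x - signed_chain ?ms' x))"
    unfolding tree_cochain_def bracket_chain_def sign by (rule ext) (simp only: right_diff_distrib mult.assoc)
  then show "(\<lambda>x. tree_cochain (K ?t) x - \<kappa> * \<tau> * bracket_chain (pre
      @ ws) post i j A B C x) \<in> B_top"
    using B_top_smult[OF B] by simp
qed

text \<open>One choice of \<open>us\<close>, \<open>vs\<close> and \<open>\<kappa>\<close> serves
  all colors \<open>i\<close> and \<open>j\<close>, since the other merges and the signs do not
  involve these colors. This allows the two halves of the compatibility relation to be
  added.\<close>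

lemma tree_cochain_cyclic:
  assumes K: "ctx K" and disj: "set (leaves x) \<inter> set (leaves y) = {}"
    "set (leaves x) \<inter> set (leaves z) = {}" "set (leaves y) \<inter> set (leaves z) = {}"
  shows "\<exists>us vs \<kappa>. \<forall>i j. K (Node i x (Node j y z))
      \<in> TT \<longrightarrow> K (Node i z (Node j x y)) \<in> TT \<longrightarrow>
      K (Node i y (Node j z x)) \<in> TT \<longrightarrow>
     us @ [orient (j, set (leaves y), set (leaves z)),
       orient (i, set (leaves x), set (leaves y) \<union> set (leaves z))] @ vs \<in> MS \<and>
     (\<lambda>c. tree_cochain (K (Node i x (Node j y z))) c + tree_cochain (K (Node i z (Node j x y))) c
        + tree_cochain (K (Node i y (Node j z x))) c
        - \<kappa> * cyclic_sum us vs i j (set (leaves x)) (set (leaves y)) (set (leaves z))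
            c :: 'a::field) \<in> B_top"
proof -
  obtain pre post \<kappa> where K': "\<And>t. set (leaves t) =
      set (leaves x) \<union> (set (leaves y) \<union> set (leaves z)) \<Longrightarrow>
      moves (K t) = pre @ moves t @ post \<and> tree_sign (K t) = \<kappa> * (tree_sign t :: 'a)"
    using ctx_postorder[OF K, where 'a = 'a] by blast
  define \<tau> where "\<tau> = (tree_sign x * tree_sign y * tree_sign z :: 'a)"
  define ws where "ws = moves x @ moves y @ moves z"
  have sw1: "swaps (moves x @ moves y @ moves z) ws" by (simp add: ws_def)
  have disj': "set (leaves z) \<inter> set (leaves x) = {}" "set (leaves z) \<inter> set (leaves y) = {}"
    "set (leaves y) \<inter> set (leaves x) = {}"
    using disj by auto
  have "swaps ((moves z @ moves x) @ moves y) ((moves x @ moves z) @ moves y)"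
    by (rule swaps_append[OF swaps_trees[OF disj'(1)] rtranclp.rtrancl_refl])
  also have "swaps ((moves x @ moves z) @ moves y) (moves x @ moves y @ moves z)"
    using swaps_append[OF rtranclp.rtrancl_refl swaps_trees[OF disj'(2)], of "moves x"] by simp
  finally have sw2: "swaps (moves z @ moves x @ moves y) ws" by (simp add: ws_def)
  have "swaps (moves y @ moves z @ moves x) (moves y @ moves x @ moves z)"
    by (rule swaps_append[OF rtranclp.rtrancl_refl swaps_trees[OF disj'(1)]])
  also have "swaps (moves y @ moves x @ moves z) ((moves x @ moves y) @ moves z)"
    using swaps_append[OF swaps_trees[OF disj'(3)] rtranclp.rtrancl_refl, of "moves z"] by simp
  finally have sw3: "swaps (moves y @ moves z @ moves x) ws" by (simp add: ws_def)
  have main: "(pre @ ws) @ [orient (j, set (leaves y), set (leaves z)),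
       orient (i, set (leaves x), set (leaves y) \<union> set (leaves z))] @ post \<in> MS \<and>
     (\<lambda>c. tree_cochain (K (Node i x (Node j y z))) c + tree_cochain (K (Node i z (Node j x y))) c
        + tree_cochain (K (Node i y (Node j z x))) c
        - (\<kappa> * \<tau>) * cyclic_sum (pre @ ws) post i j (set (leaves x)) (set (leaves y))
            (set (leaves z)) c :: 'a) \<in> B_top"
    if T: "K (Node i x (Node j y z)) \<in> TT" "K (Node i z (Node j x y)) \<in> TT"
        "K (Node i y (Node j z x)) \<in> TT"
    for i j
  proof -
    note t1 = tree_cochain_term[where K = K, OF T(1) K' sw1 \<tau>_def[symmetric]]
    have t2: "(\<lambda>c. tree_cochain (K (Node i z (Node j x y))) c -
        \<kappa> * \<tau> * bracket_chain (pre @ ws) post i j (set (leaves z)) (set (leaves x))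
            (set (leaves y)) c) \<in> B_top"
      by (rule tree_cochain_term(2)[OF T(2) K' sw2]) (auto simp: \<tau>_def)
    have t3: "(\<lambda>c. tree_cochain (K (Node i y (Node j z x))) c -
        \<kappa> * \<tau> * bracket_chain (pre @ ws) post i j (set (leaves y)) (set (leaves z))
            (set (leaves x)) c) \<in> B_top"
      by (rule tree_cochain_term(2)[OF T(3) K' sw3]) (auto simp: \<tau>_def)
    have "(\<lambda>c. (tree_cochain (K (Node i x (Node j y z))) c -
        \<kappa> * \<tau> * bracket_chain (pre @ ws) post i j (set (leaves x)) (set (leaves y))
            (set (leaves z)) c)
        + (tree_cochain (K (Node i z (Node j x y))) c -
        \<kappa> * \<tau> * bracket_chain (pre @ ws) post i j (set (leaves z)) (set (leaves x))
            (set (leaves y)) c)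
        + (tree_cochain (K (Node i y (Node j z x))) c -
        \<kappa> * \<tau> * bracket_chain (pre @ ws) post i j (set (leaves y)) (set (leaves z))
            (set (leaves x)) c)) \<in> B_top"
      by (rule B_top_add[OF B_top_add[OF t1(2) t2] t3])
    then have "(\<lambda>c. tree_cochain (K (Node i x (Node j y z))) c +
        tree_cochain (K (Node i z (Node j x y))) c
        + tree_cochain (K (Node i y (Node j z x))) c
        - (\<kappa> * \<tau>) * cyclic_sum (pre @ ws) post i j (set (leaves x)) (set (leaves y))
            (set (leaves z)) c) \<in> B_top"
      by (simp add: cyclic_sum_def algebra_simps)
    then show ?thesis using t1(1) by blast
  qed
  show ?thesis
    by (rule exI[of _ "pre @ ws"], rule exI[of _ post], rule exI[of _ "\<kappa> * \<tau>"])
        (use main in blast)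
qed

lemma tree_cochain_rel:
  assumes R: "R \<in> lie_rels" and K: "ctx K" and T: "\<And>t. t \<in> set R \<Longrightarrow> K t \<in> TT"
  shows "(\<lambda>c. \<Sum>t\<leftarrow>R. tree_cochain (K t) c :: 'a::field) \<in> B_top"
  using R
proof cases
  case (anti j x y)
  have T': "K (Node j x y) \<in> TT" "K (Node j y x) \<in> TT" using T anti by auto
  have disj: "set (leaves x) \<inter> set (leaves y) = {}"
    using ctx_labeled_sub(1)[OF K T'(1)] by simp
  obtain pre post \<kappa> where K': "\<And>t. set (leaves t) =
      set (leaves x) \<union> set (leaves y) \<Longrightarrow>
      moves (K t) = pre @ moves t @ post \<and> tree_sign (K t) = \<kappa> * (tree_sign t :: 'a)"
    using ctx_postorder[OF K, where 'a = 'a] by blast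
  have neq: "Min (set (leaves y)) \<noteq> Min (set (leaves x))"
    by (rule Min_neq_disjoint) (use disj in auto)
  let ?m = "orient (j, set (leaves x), set (leaves y))"
  have m: "orient (j, set (leaves y), set (leaves x)) = ?m" by (rule orient_swap(1)[OF neq])
  have K1: "moves (K (Node j x y)) = pre @ (moves x @ moves y) @ (?m # post)"
    "moves (K (Node j y x)) = pre @ (moves y @ moves x) @ (?m # post)"
    using K'[of "Node j x y"] K'[of "Node j y x"] by (auto simp: m)
  have s: "tree_sign (K (Node j y x)) = - (tree_sign (K (Node j x y)) :: 'a)"
    using K'[of "Node j x y"] K'[of "Node j y x"] orient_swap(2)[OF neq, where 'a =
        'a] by (auto simp: ac_simps)
  have "swaps (moves (K (Node j x y))) (moves (K (Node j y x)))"
    unfolding K1 by (rule swaps_context[OF swaps_trees[OF disj]])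
  from swaps_full[OF this moves_full[OF T'(1)], where 'a = 'a]
  have "(\<lambda>c. signed_chain (moves (K (Node j x y))) c -
      signed_chain (moves (K (Node j y x))) c :: 'a) \<in> B_top"
    by blast
  from B_top_smult[OF this, of "tree_sign (K (Node j x y))"]
  show ?thesis by (simp add: anti tree_cochain_def s algebra_simps)
next
  case (jac j x y z)
  have T': "K (Node j x (Node j y z)) \<in> TT" "K (Node j z (Node j x y)) \<in> TT"
      "K (Node j y (Node j z x)) \<in> TT"
    using T jac by auto
  have disj: "set (leaves x) \<inter> set (leaves y) = {}"
    "set (leaves x) \<inter> set (leaves z) = {}" "set (leaves y) \<inter> set (leaves z) = {}"
    using ctx_labeled_sub(1)[OF K T'(1)] by auto
  obtain us vs \<kappa> where MS: "us @ [orient (j, set (leaves y), set (leaves z)),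
       orient (j, set (leaves x), set (leaves y) \<union> set (leaves z))] @ vs \<in> MS"
    and B: "(\<lambda>c. tree_cochain (K (Node j x (Node j y z))) c +
        tree_cochain (K (Node j z (Node j x y))) c
        + tree_cochain (K (Node j y (Node j z x))) c
        - \<kappa> * cyclic_sum us vs j j (set (leaves x)) (set (leaves y)) (set (leaves z))
            c :: 'a) \<in> B_top"
    using tree_cochain_cyclic[OF K disj, where 'a = 'a] T' by blast
  have C: "cyclic_sum us vs j j (set (leaves x)) (set (leaves y)) (set (leaves z))
      \<in> (B_top :: (wpart set \<Rightarrow> 'a) set)"
    using cyclic_sum_B_top[OF MS] disj by auto
  show ?thesis using B_top_add[OF B B_top_smult[OF C, of \<kappa>]] by (simp add: jac add.assoc)
next
  case (comp i j x y z)
  have T': "K (Node i x (Node j y z)) \<in> TT" "K (Node i z (Node j x y)) \<in> TT"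
      "K (Node i y (Node j z x)) \<in> TT"
    "K (Node j x (Node i y z)) \<in> TT" "K (Node j z (Node i x y)) \<in> TT"
        "K (Node j y (Node i z x)) \<in> TT"
    using T comp by auto
  have disj: "set (leaves x) \<inter> set (leaves y) = {}"
    "set (leaves x) \<inter> set (leaves z) = {}" "set (leaves y) \<inter> set (leaves z) = {}"
    using ctx_labeled_sub(1)[OF K T'(1)] by auto
  obtain us vs \<kappa> where *: "\<And>i j. K (Node i x (Node j y z)) \<in> TT \<Longrightarrow>
      K (Node i z (Node j x y)) \<in> TT \<Longrightarrow>
      K (Node i y (Node j z x)) \<in> TT \<Longrightarrow>
     us @ [orient (j, set (leaves y), set (leaves z)),
       orient (i, set (leaves x), set (leaves y) \<union> set (leaves z))] @ vs \<in> MS \<and>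
     (\<lambda>c. tree_cochain (K (Node i x (Node j y z))) c + tree_cochain (K (Node i z (Node j x y))) c
        + tree_cochain (K (Node i y (Node j z x))) c
        - \<kappa> * cyclic_sum us vs i j (set (leaves x)) (set (leaves y)) (set (leaves z))
            c :: 'a) \<in> B_top"
    using tree_cochain_cyclic[OF K disj, where 'a = 'a] by blast
  note 1 = *[OF T'(1-3)] and 2 = *[OF T'(4-6)]
  have C: "(\<lambda>c. cyclic_sum us vs i j (set (leaves x)) (set (leaves y)) (set (leaves z)) c
      + cyclic_sum us vs j i (set (leaves x)) (set (leaves y)) (set (leaves z)) c :: 'a) \<in> B_top"
    using cyclic_sum_B_top[OF conjunct1[OF 1]] disj comp(2) by auto
  show ?thesis
    using B_top_add[OF B_top_add[OF conjunct2[OF 1] conjunct2[OF 2]] B_top_smult[OF C, of \<kappa>]]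
    by (simp add: comp algebra_simps)
qed

end

section \<open>Recovering a tree from a chain\<close>

fun forest :: "move list \<Rightarrow> (nat set \<Rightarrow> ctree)
    \<Rightarrow> nat set \<Rightarrow> ctree" where
  "forest [] F = F"
| "forest ((r, A, B) # ms) F = forest ms (F(A \<union> B := Node r (F A) (F B)))"

definition leaf_forest :: "nat set \<Rightarrow> ctree" where
  "leaf_forest S = Leaf (Min S)"

lemma forest_append: "forest (us @ vs) F = forest vs (forest us F)"
proof (induction us arbitrary: F)
  case (Cons m us)
  obtain r A B where "m = (r, A, B)" by (rule prod_cases3)
  then show ?case by (simp only: append_Cons forest.simps Cons.IH)
qed simp

lemma forest_outside: "\<not> S \<subseteq> set (leaves t) \<Longrightarrow> forest (postorder t) F S = F S"
proof (induction t arbitrary: F)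
  case (Node j l r)
  then have "\<not> S \<subseteq> set (leaves l)" "\<not> S \<subseteq> set (leaves r)"
      "S \<noteq> set (leaves l) \<union> set (leaves r)"
    by auto
  with Node.IH show ?case by (simp add: forest_append)
qed simp

lemma forest_postorder:
  assumes "distinct (leaves t)" "\<And>i. i \<in> set (leaves t) \<Longrightarrow> F {i} = Leaf i"
  shows "forest (postorder t) F (set (leaves t)) = t"
  using assms
proof (induction t arbitrary: F)
  case (Node j l r)
  let ?F = "forest (postorder l) F"
  have d: "distinct (leaves l)" "distinct (leaves r)" "set (leaves l) \<inter> set (leaves r) = {}"
    using Node.prems(1) by auto
  have l: "?F (set (leaves l)) = l" by (rule Node.IH(1)) (use Node.prems d in auto)
  have r: "forest (postorder r) ?F (set (leaves r)) = r"
  proof (rule Node.IH(2)[OF d(2)])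
    fix i assume "i \<in> set (leaves r)"
    then show "?F {i} = Leaf i" using d(3) Node.prems(2) by (subst forest_outside) auto
  qed
  have "\<not> set (leaves l) \<subseteq> set (leaves r)"
    using d(3) leaves_nonempty[of l] by (metis Int_absorb2 set_empty)
  then have "forest (postorder r) ?F (set (leaves l)) = l" using l by (simp add: forest_outside)
  then show ?case using r by (simp add: forest_append)
qed simp

text \<open>The forest keeps entries for blocks that have already been merged. Later merges read
  only current blocks, so these stale entries do not affect the trees of the final blocks.\<close>

lemma forest_blocks_cong:
  assumes "\<pi> \<in> wpartitions n k" "valid k \<pi> ms"
      "\<And>S. S \<in> fst ` \<pi> \<Longrightarrow> F S = G S"
    "S \<in> fst ` fold merge ms \<pi>"
  shows "forest ms F S = forest ms G S"
  using assms
proof (induction ms arbitrary: \<pi> F G)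
  case (Cons m ms)
  obtain r A B a b where m: "m = (r, A, B)" and ab: "(A, a) \<in> \<pi>" "(B, b) \<in> \<pi>"
    using Cons.prems(2) by (auto elim: step_okE)
  have ok: "step_ok k \<pi> m" "valid k (merge m \<pi>) ms" using Cons.prems(2) by auto
  have AB: "A \<in> fst ` \<pi>" "B \<in> fst ` \<pi>" using ok(1) by (auto simp: m step_ok_def)
  have "forest ms (F(A \<union> B := Node r (F A) (F B))) S =
      forest ms (G(A \<union> B := Node r (G A) (G B))) S"
  proof (rule Cons.IH[OF step_ok_merge(1)[OF Cons.prems(1) ok(1)] ok(2)])
    fix E assume "E \<in> fst ` merge m \<pi>"
    then have "E \<in> fst ` \<pi> \<or> E = A \<union> B"
      unfolding m merge_blocks[OF Cons.prems(1) ab] by blast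
    then show "(F(A \<union> B := Node r (F A) (F B))) E = (G(A \<union> B := Node r (G A) (G B))) E"
      using Cons.prems(3) AB by auto
  qed (use Cons.prems(4) in simp)
  then show ?case by (simp add: m)
qed simp

text \<open>Later merges treat the block \<open>S\<close> as a unit, so the final tree arises from
  the tree stored at \<open>S\<close> by substitution into a context. A relation between trees for
  one block thus becomes a relation in context.\<close>

lemma forest_ctx:
  assumes "\<pi> \<in> wpartitions n k" "valid k \<pi> ms" "S \<in> fst ` \<pi>"
      "fold merge ms \<pi> = {(E, e)}"
  shows "\<exists>K. ctx K \<and> (\<forall>t. forest ms (F(S := t)) E = K t)"
  using assms
proof (induction ms arbitrary: \<pi> F S)
  case Nil
  then have "S = E" by simp
  then show ?case using ctx.hole by (intro exI[of _ "\<lambda>t. t"]) simp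
next
  case (Cons m ms)
  obtain r A B a b where m: "m = (r, A, B)" and ab: "(A, a) \<in> \<pi>" "(B, b) \<in> \<pi>" "Min A < Min B"
    using Cons.prems(2) by (auto elim: step_okE)
  have ok: "step_ok k \<pi> m" "valid k (merge m \<pi>) ms" using Cons.prems(2) by auto
  have neq: "A \<noteq> B" using ab(3) by auto
  have P': "merge m \<pi> \<in> wpartitions n k" by (rule step_ok_merge(1)[OF Cons.prems(1) ok(1)])
  have fin: "fold merge ms (merge m \<pi>) = {(E, e)}" using Cons.prems(4) by simp
  have blocks: "fst ` merge m \<pi> = fst ` \<pi> - {A, B} \<union> {A \<union> B}"
    unfolding m by (rule merge_blocks[OF Cons.prems(1) ab(1,2)])
  obtain s where s: "(S, s) \<in> \<pi>" using Cons.prems(3) unfolding in_fst_image by blast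
  have SAB: "S \<noteq> A \<union> B" using wpart_Un_notin[OF Cons.prems(1) ab(1,2) neq] s by blast
  consider "S = A" | "S = B" | "S \<noteq> A" "S \<noteq> B" by blast
  then show ?case
  proof cases
    case 1
    have AB: "A \<union> B \<in> fst ` merge m \<pi>" unfolding blocks by simp
    obtain K where K: "ctx K" "\<And>t. forest ms (F(A \<union> B := t)) E = K t"
      using Cons.IH[OF P' ok(2) AB fin] by blast
    have "forest (m # ms) (F(S := t)) E = K (Node r t (F B))" for t
    proof -
      have "forest (m # ms) (F(S := t)) E = forest ms (F(A := t, A \<union> B := Node r t (F B))) E"
        using 1 neq by (simp add: m)
      also have "\<dots> = forest ms (F(A \<union> B := Node r t (F B))) E"
        by (rule forest_blocks_cong[OF P' ok(2)]) (use fin blocks neq 1 SAB in auto)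
      finally show ?thesis using K(2) by simp
    qed
    then show ?thesis using ctx.left[OF K(1)] by blast
  next
    case 2
    have AB: "A \<union> B \<in> fst ` merge m \<pi>" unfolding blocks by simp
    obtain K where K: "ctx K" "\<And>t. forest ms (F(A \<union> B := t)) E = K t"
      using Cons.IH[OF P' ok(2) AB fin] by blast
    have "forest (m # ms) (F(S := t)) E = K (Node r (F A) t)" for t
    proof -
      have "forest (m # ms) (F(S := t)) E = forest ms (F(B := t, A \<union> B := Node r (F A) t)) E"
        using 2 neq by (simp add: m)
      also have "\<dots> = forest ms (F(A \<union> B := Node r (F A) t)) E"
        by (rule forest_blocks_cong[OF P' ok(2)]) (use fin blocks neq 2 SAB in auto)
      finally show ?thesis using K(2) by simp
    qed
    then show ?thesis using ctx.right[OF K(1)] by blast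
  next
    case 3
    have S: "S \<in> fst ` merge m \<pi>" unfolding blocks using Cons.prems(3) 3 by simp
    obtain K where K: "ctx K" "\<And>t. forest ms ((F(A \<union> B := Node r (F A) (F B)))(S := t)) E = K t"
      using Cons.IH[OF P' ok(2) S fin] by blast
    have "forest (m # ms) (F(S := t)) E = K t" for t
      using K(2)[of t] 3 SAB by (simp add: m fun_upd_twist)
    then show ?thesis using K(1) by blast
  qed
qed

abbreviation inside :: "nat set \<Rightarrow> move \<Rightarrow> bool" where
  "inside S m \<equiv> fst (snd m) \<union> snd (snd m) \<subseteq> S"

text \<open>The first conjunct places each earlier merge inside one current block, which is unique
  because the merge involves a nonempty set. When \<open>A\<close> and \<open>B\<close> are joined,
  the merges inside the union thus split into those inside \<open>A\<close> and those inside
  \<open>B\<close>, which are independent and can be sorted into postorder.\<close>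

lemma forest_invariant:
  assumes "valid k (wbot n) us"
  shows "(\<forall>m\<in>set us. fst (snd m) \<noteq> {} \<and>
      (\<exists>S\<in>fst ` fold merge us (wbot n). inside S m)) \<and>
    (\<forall>(S, w)\<in>fold merge us (wbot n).
       let t = forest us leaf_forest S in
       distinct (leaves t) \<and> set (leaves t) = S \<and> (\<forall>j. count_list (colors t) j = w j) \<and>
       set (colors t) \<subseteq> {1..} \<and> normalized t \<and>
           swaps (filter (inside S) us) (postorder t))"
  using assms
proof (induction us rule: rev_induct)
  case Nil
  show ?case by (auto simp: Let_def mem_wbot leaf_forest_def)
next
  case (snoc m us)
  let ?\<pi> = "fold merge us (wbot n)" and ?F = "forest us leaf_forest"
  have v: "valid k (wbot n) us" "step_ok k ?\<pi> m" using snoc.prems by (simp_all add: valid_append)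
  have P: "?\<pi> \<in> wpartitions n k" using valid_wpart[OF wbot_wpart v(1)] by blast
  obtain r A B a b where m: "m = (r, A, B)" and ab: "(A, a) \<in> ?\<pi>" "(B, b) \<in> ?\<pi>"
      "Min A < Min B" "r \<in> {1..k}"
    using v(2) by (auto elim: step_okE)
  have neq: "A \<noteq> B" using ab(3) by auto
  have dis: "A \<inter> B = {}" by (rule wpart_disjoint[OF P ab(1,2) neq])
  note A = wpart_blockD(2,3)[OF P ab(1)] and B = wpart_blockD(2,3)[OF P ab(2)]
  have IH1: "\<And>u. u \<in> set us \<Longrightarrow> fst (snd u) \<noteq> {} \<and>
      (\<exists>S\<in>fst ` ?\<pi>. inside S u)"
    using snoc.IH[OF v(1)] by blast
  have IH2: "distinct (leaves (?F S))" "set (leaves (?F S)) = S" "count_list (colors (?F S)) j = w j"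
      "set (colors (?F S)) \<subseteq> {1..}" "normalized (?F S)"
          "swaps (filter (inside S) us) (postorder (?F S))"
    if "(S, w) \<in> ?\<pi>" for S w j
    using snoc.IH[OF v(1)] that by (auto simp: Let_def)
  have blocks: "fst ` merge m ?\<pi> = fst ` ?\<pi> - {A, B} \<union> {A \<union> B}"
    unfolding m by (rule merge_blocks[OF P ab(1,2)])
  have mem: "(S, w) \<in> merge m ?\<pi> \<longleftrightarrow> (S, w) \<in> ?\<pi> \<and>
      S \<noteq> A \<and> S \<noteq> B \<or> S = A \<union> B \<and> w = merged_weight a b r" for S w
    unfolding m mem_merge[OF P ab(1,2)] by simp
  have ABin: "A \<union> B \<in> fst ` merge m ?\<pi>" unfolding blocks by simp
  have part1: "fst (snd u) \<noteq> {} \<and> (\<exists>S\<in>fst ` merge m ?\<pi>. inside S u)" if u: "u \<in> set (us @ [m])" for u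
  proof (cases "u = m")
    case True
    then show ?thesis using ABin A by (auto simp: m)
  next
    case False
    then have "u \<in> set us" using u by simp
    from IH1[OF this] obtain S where S: "fst (snd u) \<noteq> {}" "S \<in> fst ` ?\<pi>" "inside S u" by blast
    show ?thesis
    proof (cases "S = A \<or> S = B")
      case True
      then have "inside (A \<union> B) u" using S(3) by blast
      then show ?thesis using S(1) ABin by blast
    next
      case False
      then show ?thesis using S unfolding blocks by blast
    qed
  qed
  have part2: "let t = forest (us @ [m]) leaf_forest S in
       distinct (leaves t) \<and> set (leaves t) = S \<and> (\<forall>j. count_list (colors t) j = w j) \<and>
       set (colors t) \<subseteq> {1..} \<and> normalized t \<and>
           swaps (filter (inside S) (us @ [m])) (postorder t)"
    if Sw: "(S, w) \<in> merge m ?\<pi>" for S w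
  proof (cases "S = A \<union> B")
    case False
    then have S: "(S, w) \<in> ?\<pi>" "S \<noteq> A" "S \<noteq> B" using Sw mem by auto
    have "S \<inter> A = {}" by (rule wpart_disjoint[OF P S(1) ab(1) S(2)])
    then have "\<not> A \<subseteq> S" using A(1) by blast
    then show ?thesis using IH2[OF S(1)] False by (simp add: forest_append m Let_def)
  next
    case True
    then have w: "w = merged_weight a b r"
      using Sw mem wpart_Un_notin[OF P ab(1,2) neq] by blast
    have t: "forest (us @ [m]) leaf_forest S = Node r (?F A) (?F B)"
      using True by (simp add: forest_append m)
    have Min: "Min (A \<union> B) \<in> A"
      using Min_Un_less[OF A(2,1) B(2,1) ab(3)] Min_in[OF A(2,1)] by simp
    have only: "inside A u \<noteq> inside B u" if u: "u \<in> set us" "inside (A \<union> B) u" for u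
    proof -
      obtain E where E: "fst (snd u) \<noteq> {}" "E \<in> fst ` ?\<pi>" "inside E u"
          using IH1[OF u(1)] by blast
      then obtain e where e: "(E, e) \<in> ?\<pi>" unfolding in_fst_image by blast
      have "E \<inter> A \<noteq> {} \<or> E \<inter> B \<noteq> {}" using E(1,3) u(2) by blast
      then have "E = A \<or> E = B" using wpart_disjoint[OF P e ab(1)] wpart_disjoint[OF P e ab(2)] by blast
      moreover have "\<not> (inside A u \<and> inside B u)" using E(1) dis by blast
      ultimately show ?thesis using E(3) by blast
    qed
    let ?L = "filter (inside (A \<union> B)) us"
    have "swaps ?L (filter (inside A) ?L @ filter (inside B) ?L)"
    proof (rule swaps_partition)
      fix v w assume "inside A v" "inside B w"
      then show "indep w v" using dis by (cases v; cases w) (auto simp: indep_def)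
    qed (use only in auto)
    moreover have "filter (inside A) ?L = filter (inside A) us" "filter (inside B) ?L = filter (inside B) us"
      by (auto simp: filter_filter intro!: filter_cong)
    ultimately have "swaps ?L (filter (inside A) us @ filter (inside B) us)" by simp
    also have "swaps (filter (inside A) us @ filter (inside B) us) (postorder (?F A) @ postorder (?F B))"
      by (rule swaps_append[OF IH2(6)[OF ab(1)] IH2(6)[OF ab(2)]])
    finally have "swaps (?L @ [m]) ((postorder (?F A) @ postorder (?F B)) @ [m])"
      by (rule swaps_append) simp
    then have sw: "swaps (filter (inside S) (us @ [m])) (postorder (Node r (?F A) (?F B)))"
      using IH2(2)[OF ab(1)] IH2(2)[OF ab(2)] by (simp add: True m)
    have cnt: "count_list (colors (Node r (?F A) (?F B))) j = w j" for j
      using IH2(3)[OF ab(1), of j] IH2(3)[OF ab(2), of j] by (simp add: w merged_weight_def)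
    show ?thesis
      unfolding t Let_def
      using IH2(1,2,4,5)[OF ab(1)] IH2(1,2,4,5)[OF ab(2)] dis Min ab(4) sw cnt True by simp
  qed
  have fm: "fold merge (us @ [m]) (wbot n) = merge m ?\<pi>" by simp
  show ?case unfolding fm 
    by (rule conjI, rule ballI, erule part1, rule ballI, rule case_prodI2, rule part2, simp)
qed

context weighted_interval
begin

definition tree_of :: "move list \<Rightarrow> ctree" where
  "tree_of ms = forest ms leaf_forest {1..n}"

lemma tree_of_postorder:
  assumes "t \<in> TT"
  shows "tree_of (postorder t) = t"
proof -
  have "distinct (leaves t)" "set (leaves t) = {1..n}"
    using assms by (auto simp: labeled_trees_of_type_def labeled_trees_def)
  then show ?thesis
    using forest_postorder[of t leaf_forest] by (simp add: tree_of_def leaf_forest_def)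
qed

lemma tree_of_full:
  assumes "ms \<in> MS"
  shows "tree_of ms \<in> TT" "swaps ms (moves (tree_of ms))"
proof -
  have v: "valid k (wbot n) ms" and top: "fold merge ms (wbot n) = {({1..n}, \<mu>)}"
    using assms by (auto simp: full_seqs_def wtop_def)
  note inv = forest_invariant[OF v]
  have t: "distinct (leaves (tree_of ms))" "set (leaves (tree_of ms)) = {1..n}"
      "\<And>j. count_list (colors (tree_of ms)) j = \<mu> j" "set (colors (tree_of ms)) \<subseteq> {1..}"
      "normalized (tree_of ms)" "swaps (filter (inside {1..n}) ms) (postorder (tree_of ms))"
    using bspec[OF conjunct2[OF inv], of "({1..n}, \<mu>)"] unfolding top Let_def prod.case tree_of_def
    by blast+
  show "tree_of ms \<in> TT"
    using t by (simp add: labeled_trees_of_type_def labeled_trees_def)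
  have f: "filter (inside {1..n}) ms = ms"
    using inv unfolding top by (intro filter_True) simp
  show "swaps ms (moves (tree_of ms))"
    using t(6) unfolding f normalized_moves(1)[OF t(5,1)] .
qed

end

section \<open>The basis of the cohomology\<close>

lemma lie_expand_anti: "lie_expand (Node j x y) f = - lie_expand (Node j y x) f"
  using lie_expand_rels[OF lie_rels.anti[of j x y], of f] by (simp add: eq_neg_iff_add_eq_0)

text \<open>Antisymmetry rewrites Jacobi and compatibility into the shape of \<open>triples\<close>;
  the signs +, -, + are those that \<open>seq_sign\<close> gives to the three chains, up to a common
  factor.\<close>

lemma lie_expand_sorted_rel:
  defines "D \<equiv> \<lambda>r s x y z f. lie_expand (Node s x (Node r y z)) f -
      lie_expand (Node s (Node r x y) z) f
     + lie_expand (Node s (Node r x z) y) (f :: ctree \<Rightarrow> 'a::comm_ring_1)"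
  shows "D r r x y z f = 0" "r \<noteq> s \<Longrightarrow> D r s x y z f + D s r x y z f = 0"
proof -
  have inner: "lie_expand (Node s y (Node r x z)) f = - lie_expand (Node s y (Node r z x)) f" for r s x y z
  proof -
    have "lie_expand (Node s y (Node r x z)) f =
        lie_expand y (\<lambda>a. (- 1) * lie_expand (Node r z x) (\<lambda>b. cprod s a b f -
            cprod s b a f))"
      by (subst lie_expand.simps, subst lie_expand_anti[of r x z]) simp
    then show ?thesis unfolding lie_expand_mult by simp
  qed
  have D: "D r s x y z f = lie_expand (Node s x (Node r y z)) f + lie_expand (Node s z (Node r x y)) f
      + lie_expand (Node s y (Node r z x)) f" for r s
    unfolding D_def
    by (simp only: lie_expand_anti[of s "Node r x y" z] lie_expand_anti[of s "Node r x z" y]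
        inner[of s y r x z]) simp
  show "D r r x y z f = 0"
    using lie_expand_rels[OF lie_rels.jac[of r x y z], of f]
        unfolding D by (simp add: add.assoc del: lie_expand.simps)
  show "D r s x y z f + D s r x y z f = 0" if "r \<noteq> s"
    using lie_expand_rels[OF lie_rels.comp[of s r x y z], of f] that unfolding D
    by (simp add: add.assoc del: lie_expand.simps)
qed

context weighted_interval
begin

text \<open>These functionals separate the combs in cohomology: the sign makes all sums over fibers,
  and hence all pairings with coboundaries, vanish.\<close>

definition chain_functional :: "(ctree \<Rightarrow> 'a)
    \<Rightarrow> move list \<Rightarrow> 'a::field" where
  "chain_functional f ms = seq_sign ms * lie_expand (tree_of ms) f"

lemma tree_of_swap:
  assumes MS: "us @ [m, m'] @ vs \<in> MS" and ind: "indep m m'"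
  shows "tree_of (us @ [m, m'] @ vs) = tree_of (us @ [m', m] @ vs)"
proof -
  note sp = split_steps[OF MS]
  obtain r A B a b where m: "m = (r, A, B)" and ab: "(A, a) \<in> fold merge us (wbot n)"
      "(B, b) \<in> fold merge us (wbot n)"
    using sp(2) by (auto elim: step_okE)
  obtain s C D where m': "m' = (s, C, D)" by (rule prod_cases3)
  have ne: "A \<noteq> {}" "B \<noteq> {}" using wpart_blockD(2)[OF sp(1)] ab by blast+
  have dis: "(A \<union> B) \<inter> (C \<union> D) = {}" using ind by (simp add: indep_def m m')
  have neq: "A \<union> B \<noteq> C \<union> D" "A \<noteq> C \<union> D"
      "B \<noteq> C \<union> D" "C \<noteq> A \<union> B" "D \<noteq> A \<union> B"
  proof -
    show "A \<union> B \<noteq> C \<union> D" "A \<noteq> C \<union> D"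
        "B \<noteq> C \<union> D" using dis ne by blast+
    have "step_ok k (fold merge us (wbot n)) m'" using indep_steps(1)[OF sp ind] .
    then obtain c d where "(C, c) \<in> fold merge us (wbot n)" "(D, d) \<in> fold merge us (wbot n)"
      unfolding m' step_ok_def prod.case in_fst_image by blast
    then have "C \<noteq> {}" "D \<noteq> {}" using wpart_blockD(2)[OF sp(1)] by blast+
    then show "C \<noteq> A \<union> B" "D \<noteq> A \<union> B" using dis by blast+
  qed
  have "forest [m, m'] F = forest [m', m] F" for F
    using neq by (simp add: m m' fun_upd_twist)
  then show ?thesis
    unfolding tree_of_def forest_append by simp
qed

text \<open>An exchange of independent merges keeps the tree and reverses the sign. For three blocks
  the later merges form a context, and the signed sum is a Jacobi or compatibility relation inside
  it.\<close>

lemma chain_functional_orthogonal: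
  assumes MS: "us @ [m, m'] @ vs \<in> MS"
  shows "(\<Sum>pq\<in>pairs_at us m m'. chain_functional f (fill us vs pq)) = (0 :: 'a::field)"
proof -
  let ?\<pi> = "fold merge us (wbot n)" and ?F = "forest us leaf_forest"
  note sp = split_steps[OF MS]
  show ?thesis
  proof (rule two_steps_cases[OF sp])
    assume "step_ok k ?\<pi> m'" and ind: "indep m m'"
    note sw = swap_full[OF MS ind]
    show ?thesis
      unfolding sw(2) using sw(3) sw(4)[where 'a = 'a] tree_of_swap[OF MS ind]
      by (simp add: chain_functional_def)
  next
    fix X Y Z x y z r s
    assume XYZ: "(X, x) \<in> ?\<pi>" "(Y, y) \<in> ?\<pi>" "(Z, z) \<in> ?\<pi>"
        and less: "Min X < Min Y" "Min Y < Min Z"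
      and rs: "r \<in> {1..k}" "s \<in> {1..k}" and mm: "(m, m') \<in> set (triples r s X Y Z)"
    note fin = wpart_blockD(2,3)[OF sp(1) XYZ(1)] wpart_blockD(2,3)[OF sp(1) XYZ(2)]
      wpart_blockD(2,3)[OF sp(1) XYZ(3)]
    have neq: "X \<noteq> Y" "X \<noteq> Z" "Y \<noteq> Z" "Y \<noteq> X" "Z \<noteq> X"
        "Z \<noteq> Y" using less by auto
    have dis: "X \<inter> Y = {}" "X \<inter> Z = {}" "Y \<inter> Z = {}"
      using wpart_disjoint[OF sp(1)] XYZ neq by blast+
    have mins: "Min (Y \<union> Z) = Min Y" using Min_Un_less fin less by blast
    let ?S = "X \<union> Y \<union> Z" and ?\<pi>'' = "merge m' (merge m ?\<pi>)"
    have P'': "?\<pi>'' \<in> wpartitions n k"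
      by (rule step_ok_merge(1)[OF step_ok_merge(1)[OF sp(1,2)] sp(3)])
    have v: "valid k ?\<pi>'' vs" and top: "fold merge vs ?\<pi>'' = {({1..n}, \<mu>)}"
      using MS by (auto simp: full_seqs_def valid_append wtop_def)
    have S: "?S \<in> fst ` ?\<pi>''"
      unfolding in_fst_image triples_step(3)[OF sp(1) XYZ less rs mm] by blast
    then obtain w where w: "(?S, w) \<in> ?\<pi>''" unfolding in_fst_image by blast
    obtain K where K: "ctx K" "\<And>t. forest vs (?F(?S := t)) {1..n} = K t"
      using forest_ctx[OF P'' v S top] by blast
    \<comment> \<open>The intermediate union is a proper part of \<open>?S\<close> and hence no
      block of \<open>?\<pi>''\<close>; its stale entry in the forest can be ignored.\<close>
    have junk: "E \<noteq> V" if E: "E \<in> fst ` ?\<pi>''" and V: "V \<subset> ?S" "V \<noteq> {}" for E V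
    proof
      assume "E = V"
      moreover obtain e where "(E, e) \<in> ?\<pi>''" using E unfolding in_fst_image by blast
      ultimately have "V = ?S" using wpart_sub_eq[OF P'' _ w, of V] V by blast
      then show False using V by blast
    qed
    have tree: "tree_of (us @ [(r', A, B), q] @ vs) = K t"
      if "A \<union> B \<subset> ?S" "A \<union> B \<noteq> {}"
        "forest [(r', A, B), q] ?F = ?F(A \<union> B := t', ?S := t)" for r' A B q t t'
    proof -
      have "tree_of (us @ [(r', A, B), q] @ vs) = forest vs (?F(A \<union> B := t', ?S := t)) {1..n}"
        unfolding tree_of_def forest_append that(3) ..
      also have "\<dots> = forest vs (?F(?S := t)) {1..n}"
        by (rule forest_blocks_cong[OF P'' v]) (use junk[OF _ that(1,2)] top in auto)
      finally show ?thesis using K(2) by simp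
    qed
    have strict: "Y \<union> Z \<subset> ?S" "X \<union> Y \<subset> ?S"
        "X \<union> Z \<subset> ?S" using dis fin by blast+
    have trees: "tree_of (us @ [(r, Y, Z), (s, X, Y \<union> Z)] @ vs) =
        K (Node s (?F X) (Node r (?F Y) (?F Z)))"
      "tree_of (us @ [(r, X, Y), (s, X \<union> Y, Z)] @ vs) = K (Node s (Node r (?F X) (?F Y)) (?F Z))"
      "tree_of (us @ [(r, X, Z), (s, X \<union> Z, Y)] @ vs) =
          K (Node s (Node r (?F X) (?F Z)) (?F Y))" for r s
    proof -
      have "X \<noteq> Y \<union> Z" "Z \<noteq> X \<union> Y" "Y \<noteq> X \<union> Z"
          using dis fin by blast+
      then show "tree_of (us @ [(r, Y, Z), (s, X, Y \<union> Z)] @ vs) =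
          K (Node s (?F X) (Node r (?F Y) (?F Z)))"
        "tree_of (us @ [(r, X, Y), (s, X \<union> Y, Z)] @ vs) = K (Node s (Node r (?F X) (?F Y)) (?F Z))"
        "tree_of (us @ [(r, X, Z), (s, X \<union> Z, Y)] @ vs) = K (Node s (Node r (?F X) (?F Z)) (?F Y))"
        using fin by (intro tree strict; simp add: Un_assoc Un_commute[of Z Y])+
    qed
    define \<sigma> where "\<sigma> = (inv_sign (map removed us @ Min Z # Min Y # map removed vs) :: 'a)"
    have neg: "inv_sign (map removed us @ Min Y # Min Z # map removed vs) = - \<sigma>"
      unfolding \<sigma>_def by (rule inv_sign_swap) (use less in auto)
    define D where "D r s = lie_expand (K (Node s (?F X) (Node r (?F Y) (?F Z)))) f
        - lie_expand (K (Node s (Node r (?F X) (?F Y)) (?F Z))) f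
        + lie_expand (K (Node s (Node r (?F X) (?F Z)) (?F Y))) f" for r s
    have sum: "(\<Sum>pq\<in>set (triples r s X Y Z). chain_functional f (fill us vs pq)) =
        \<sigma> * D r s" for r s
    proof -
      note tr = trees[of r s, simplified]
      show ?thesis
        using neq by (simp add: triples_def chain_functional_def tr seq_sign_def removed_def mins
            \<sigma>_def[symmetric] neg D_def algebra_simps)
    qed
    let ?D = "\<lambda>r s. [(1, Node s (?F X) (Node r (?F Y) (?F Z))),
        (- 1, Node s (Node r (?F X) (?F Y)) (?F Z)), (1, Node s (Node r (?F X) (?F Z)) (?F Y))]
        :: ('a \<times> ctree) list"
    have Drr: "D r r = 0" for r
    proof -
      have "(\<Sum>t\<leftarrow>?D r r. fst t * lie_expand (snd t) g) = 0" for g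
        using lie_expand_sorted_rel(1)[of r "?F X" "?F Y" "?F Z" g]
        by (simp add: algebra_simps del: lie_expand.simps)
      from lie_expand_ctx[OF K(1), of fst snd "?D r r" f, OF this] show ?thesis
        by (simp add: D_def algebra_simps del: lie_expand.simps)
    qed
    have Drs: "D r s + D s r = 0" if "r \<noteq> s" for r s
    proof -
      have "(\<Sum>t\<leftarrow>?D r s @ ?D s r. fst t * lie_expand (snd t) g) = 0" for g
        using lie_expand_sorted_rel(2)[OF that, of "?F X" "?F Y" "?F Z" g]
        by (simp add: algebra_simps del: lie_expand.simps)
      from lie_expand_ctx[OF K(1), of fst snd "?D r s @ ?D s r" f, OF this] show ?thesis
        by (simp add: D_def algebra_simps del: lie_expand.simps)
    qed
    have pairs: "pairs_at us m m' = set (triples r s X Y Z) \<union> set (triples s r X Y Z)"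
      by (rule pairs_triples[OF sp(1) XYZ less rs mm])
    show ?thesis
    proof (cases "r = s")
      case True
      then show ?thesis unfolding pairs using sum[of s s] Drr[of s] by simp
    next
      case False
      have "set (triples r s X Y Z) \<inter> set (triples s r X Y Z) = {}"
        using False by (auto simp: triples_def)
      then have "(\<Sum>pq\<in>pairs_at us m m'. chain_functional f (fill us vs pq)) =
          \<sigma> * D r s + \<sigma> * D s r"
        unfolding pairs sum[symmetric] by (intro sum.union_disjoint) auto
      also have "\<dots> = 0" using Drs[OF False] by (simp flip: distrib_left)
      finally show ?thesis .
    qed
  qed
qed

theorem basis_cohomology:
  "vectorspace.basis class_ring
     (cohomology P leq (wbot n) (wtop n \<mu>) (int n -
         3) :: ('a::field, (wpart set \<Rightarrow> 'a) set) module)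
     {face_class P leq (wbot n) (wtop n \<mu>) (int n - 3) (open_tree_chain n \<mu> t) | t. t
         \<in> Comb n \<mu>}"
proof -
  interpret Q: function_quotient "Z_top :: (wpart set \<Rightarrow> 'a) set" B_top
    by (rule cohomology_quotient)
  let ?v = "\<lambda>t. face_indicator (open_chain n \<mu> (moves t)) :: wpart set \<Rightarrow> 'a"
  let ?N = "Q.span ((\<lambda>t. Q.coset (?v t)) ` Comb n \<mu>)"
  have CT: "Comb n \<mu> \<subseteq> TT" by (auto simp: Comb_def)
  have comb: "moves t = postorder t" "tree_of (moves t) = t" if "t \<in> Comb n \<mu>" for t
  proof -
    have "normalized t" "distinct (leaves t)"
      using that by (auto simp: Comb_def labeled_trees_of_type_def labeled_trees_def)
    from normalized_moves(1)[OF this] show "moves t = postorder t" .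
    then show "tree_of (moves t) = t" using tree_of_postorder that CT by auto
  qed
  have ind_Z: "face_indicator (open_chain n \<mu> ms)
      \<in> (Z_top :: (wpart set \<Rightarrow> 'a) set)" if "ms \<in> MS" for ms
    using that by (auto simp: Z_top_eq face_indicator_def)
  have v_Z: "?v t \<in> Z_top" if "t \<in> Comb n \<mu>" for t
    using that CT moves_full ind_Z by blast
  have indpt: "Q.lin_indpt ((\<lambda>t. Q.coset (?v t)) ` Comb n \<mu>)"
  proof (rule Q.coset_lin_indpt[OF v_Z])
    fix J and \<alpha> :: "ctree \<Rightarrow> 'a" and t
    assume J: "finite J" "J \<subseteq> Comb n \<mu>"
        "(\<lambda>x. \<Sum>t\<in>J. \<alpha> t * ?v t x) \<in> B_top" "t \<in> J"
    have "(\<Sum>c\<in>J. (\<alpha> c * seq_sign (moves c)) * lie_expand c f) = 0" for f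
    proof -
      \<comment> \<open>Pairing the coboundary with the functional leaves a relation between
        expansions of combs; the sign of each chain is absorbed into its coefficient.\<close>
      have "0 = (\<Sum>ms\<in>MS. (\<Sum>t\<in>J. \<alpha> t * ?v t (open_chain n \<mu> ms))
          * chain_functional f ms)"
        using coboundary_orthogonal[OF chain_functional_orthogonal J(3), of f] by simp
      also have "\<dots> = (\<Sum>t\<in>J. \<Sum>ms\<in>MS. \<alpha> t * ?v t (open_chain n \<mu> ms) * chain_functional f ms)"
        by (subst sum.swap) (simp add: sum_distrib_right)
      also have "\<dots> = (\<Sum>t\<in>J. \<Sum>ms\<in>MS. if ms =
          moves t then \<alpha> t * chain_functional f ms else 0)"
      proof (intro sum.cong refl)
        fix t ms assume t: "t \<in> J" and ms: "ms \<in> MS"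
        have "moves t \<in> MS" using t J(2) CT moves_full by blast
        then have "open_chain n \<mu> ms = open_chain n \<mu> (moves t) \<longleftrightarrow> ms = moves t"
          using inj_on_eq_iff[OF open_chain_inj ms] by blast
        then show "\<alpha> t * ?v t (open_chain n \<mu> ms) * chain_functional f ms =
            (if ms = moves t then \<alpha> t * chain_functional f ms else 0)"
          by (simp add: face_indicator_def)
      qed
      also have "\<dots> = (\<Sum>t\<in>J. \<alpha> t * chain_functional f (moves t))"
      proof (rule sum.cong[OF refl])
        fix t assume "t \<in> J"
        then have "moves t \<in> MS" using J(2) CT moves_full by blast
        then show "(\<Sum>ms\<in>MS. if ms = moves t then \<alpha> t * chain_functional f ms else 0) =
            \<alpha> t * chain_functional f (moves t)"
          using finite_full by simp
      qed
      also have "\<dots> = (\<Sum>c\<in>J. (\<alpha> c * seq_sign (moves c)) * lie_expand c f)"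
        by (rule sum.cong[OF refl]) (use comb(2) J(2) in \<open>auto simp: chain_functional_def\<close>)
      finally show ?thesis by simp
    qed
    then have "\<alpha> t * seq_sign (moves t) = 0"
      by (rule comb_expansions_independent[OF J(1,2) _ J(4)])
    then have "\<alpha> t * (seq_sign (moves t) * seq_sign (moves t)) = 0" by auto
    then show "\<alpha> t = 0" by (simp add: seq_sign_square)
  qed
  have sub_V: "(\<lambda>t. Q.coset (?v t)) ` Comb n \<mu> \<subseteq> carrier Q.V"
    using v_Z by (auto intro: Q.coset_carrier)
  note subN = Q.span_is_submodule[OF sub_V]
  interpret N: LinearCombinations.submodule class_ring ?N Q.V by (rule subN)
  obtain b where b: "supp \<mu> \<subseteq> {..b}" using supp_bounded[OF \<mu>(1)] by blast
  have tree_Z: "tree_cochain t \<in> (Z_top :: (wpart set \<Rightarrow> 'a) set)" if "t \<in> TT" for t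
    using moves_full[OF that] by (auto simp: Z_top_eq tree_cochain_def signed_chain_def face_indicator_def)
  have tree_N: "Q.coset (tree_cochain t) \<in> ?N" if t: "t \<in> TT" for t
  proof -
    have "Q.coset (tree_cochain c) \<in> ?N" if "c \<in> Comb n \<mu>" for c
      by (rule Q.coset_in_span[where J = "{c}" and \<alpha> = "\<lambda>_. tree_sign c * seq_sign (moves c)"])
        (use v_Z that B_top_zero in \<open>auto simp: tree_cochain_def signed_chain_def mult.assoc\<close>)
    then have "Q.span ((\<lambda>c. Q.coset (tree_cochain c)) ` Comb n \<mu>) \<subseteq> ?N"
      by (intro Q.span_is_subset[OF _ subN]) auto
    moreover have "Q.coset (tree_cochain t) \<in> Q.span ((\<lambda>c. Q.coset (tree_cochain c))
        ` Comb n \<mu>)"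
      by (rule Q.straighten_span[OF tree_Z b tree_cochain_rel t])
    ultimately show ?thesis by blast
  qed
  \<comment> \<open>Exchanges of independent merges take a chain to the postorder chain of its tree,
    so its indicator is congruent to plus or minus the cochain of that tree.\<close>
  have ind_N: "Q.coset (face_indicator (open_chain n \<mu> ms)) \<in> ?N" if ms: "ms \<in> MS" for ms
  proof -
    define t where "t = tree_of ms"
    have t: "t \<in> TT" "swaps ms (moves t)" using tree_of_full[OF ms] by (simp_all add: t_def)
    have B: "(\<lambda>c. signed_chain ms c - signed_chain (moves t) c :: 'a) \<in> B_top"
      using swaps_full[OF t(2) ms] by blast
    have 1: "seq_sign ms * (seq_sign ms * a) = a" "tree_sign t * (tree_sign t * a) = a" for a :: 'a
      using seq_sign_square[of ms, where 'a = 'a] tree_sign_square[of t, where 'a = 'a]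
      by (simp_all flip: mult.assoc)
    have "(\<lambda>c. seq_sign ms * (signed_chain ms c - signed_chain (moves t) c)) =
        (\<lambda>c. face_indicator (open_chain n \<mu> ms) c -
            (seq_sign ms * tree_sign t) * tree_cochain t c :: 'a)"
      by (rule ext) (simp add: signed_chain_def[of ms] tree_cochain_def right_diff_distrib 1 mult.assoc)
    then have "Q.coset (face_indicator (open_chain n \<mu> ms)) =
        Q.coset (\<lambda>c. (seq_sign ms * tree_sign t) * tree_cochain t c)"
      using B_top_smult[OF B, of "seq_sign ms"] by (intro Q.coset_eqI) simp
    then show ?thesis
      using N.smult_closed[OF _ tree_N[OF t(1)], of "seq_sign ms * tree_sign t"]
      by (simp add: Q.coset_smult)
  qed
  have "Q.coset u \<in> ?N" if u: "u \<in> Z_top" for u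
  proof -
    have ux: "u x = (\<Sum>ms\<in>MS. u (open_chain n \<mu> ms)
        * face_indicator (open_chain n \<mu> ms) x)" for x
    proof (cases "x \<in> open_chain n \<mu> ` MS")
      case True
      then obtain ms where ms: "ms \<in> MS" "x = open_chain n \<mu> ms" by blast
      have "(\<Sum>ms'\<in>MS. u (open_chain n \<mu> ms') * face_indicator (open_chain n \<mu> ms') x) =
          (\<Sum>ms'\<in>MS. if ms' = ms then u (open_chain n \<mu> ms') else 0)"
        by (rule sum.cong[OF refl])
          (use inj_on_eq_iff[OF open_chain_inj ms(1)] in \<open>auto simp: face_indicator_def ms(2)\<close>)
      then show ?thesis using finite_full ms by simp
    next
      case False
      then have "u x = 0" using u unfolding Z_top_eq by blast
      moreover have "(\<Sum>ms\<in>MS. u (open_chain n \<mu> ms)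
          * face_indicator (open_chain n \<mu> ms) x) = 0"
        by (rule sum.neutral) (use False in \<open>auto simp: face_indicator_def\<close>)
      ultimately show ?thesis by simp
    qed
    have "(\<lambda>x. u x - (\<Sum>ms\<in>MS. u (open_chain n \<mu> ms)
        * face_indicator (open_chain n \<mu> ms) x)) = (\<lambda>x. 0)"
      by (rule ext, rule iffD2[OF right_minus_eq], rule ux)
    then have "Q.coset u \<in> Q.span ((\<lambda>ms. Q.coset (face_indicator (open_chain n \<mu> ms))) ` MS)"
      by (intro Q.coset_in_span[where J = MS and \<alpha> =
          "\<lambda>ms. u (open_chain n \<mu> ms)"] ind_Z finite_full)
        (use B_top_zero in auto)
    moreover have "Q.span ((\<lambda>ms. Q.coset (face_indicator (open_chain n \<mu> ms))) ` MS)
        \<subseteq> ?N"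
      using ind_N by (intro Q.span_is_subset[OF _ subN]) auto
    ultimately show ?thesis by blast
  qed
  then have "carrier Q.V \<subseteq> ?N" unfolding Q.carrier_V by blast
  then have "?N = carrier Q.V" using N.subset by blast
  then have "Q.basis ((\<lambda>t. Q.coset (?v t)) ` Comb n \<mu>)"
    unfolding Q.basis_def using indpt sub_V by blast
  moreover have "{face_class P leq (wbot n) (wtop n \<mu>) (int n -
      3) (open_tree_chain n \<mu> t) | t. t \<in> Comb n \<mu>} =
      (\<lambda>t. Q.coset (?v t)) ` Comb n \<mu>"
    by (auto simp: face_class_def Q.coset_def face_indicator_def open_tree_chain_eq)
  ultimately show ?thesis by (simp add: cohomology_def)
qed

end

theorem theorem5p7:
  fixes n k :: nat and \<mu> :: "nat \<Rightarrow> nat"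
  assumes "n \<ge> 1" and "k \<ge> 1"
    and "\<mu> \<in> wcomp (n - 1)" and "supp \<mu> \<subseteq> {1..k}"
  shows "vectorspace.basis class_ring
           (cohomology (wpartitions n k) (wle n k) (wbot n) (wtop n \<mu>) (int n - 3)
              :: ('a::field, (wpart set \<Rightarrow> 'a) set) module)
           {face_class (wpartitions n k) (wle n k) (wbot n) (wtop n \<mu>) (int n - 3)
              (open_tree_chain n \<mu> t) | t. t \<in> Comb n \<mu>}
       \<and> vectorspace.basis class_ring
           (Lie n \<mu> :: ('a, (ctree \<Rightarrow> 'a) set) module)
           {lie_class n t | t. t \<in> Comb n \<mu>}"
proof -
  interpret weighted_interval n k \<mu>
    by unfold_locales (fact assms(1,3,4))+
  show ?thesis
    using basis_cohomology basis_Lie[OF assms(3)] by (simp add: Setcompr_eq_image)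
qed

end
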